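(* Let $n$ be a positive integer, $C\in M_n(\mathbb{Z}_+\cup\{\infty\})$, $1\le i,j\le n$ with $i\ne j$, and $\tilde\lambda=(\lambda_i,\lambda_j)\in\mathbb{B}_{C_{ii}}\times\mathbb{B}_{C_{jj}}$. The set $G(C,\tilde\lambda,i,j)$, equipped with the topology of pointwise convergence, is homeomorphic to a closed ball (of positive radius) in $\mathbb{C}^{C_{ij}}$ (equipped with the weak topology).
   Context: $\mathbb{Z}_+$ is the set of non-negative integers; $\infty$ stands for countable infinity, $\mathbb{C}^\infty=\ell_2$ and $\mathbb{C}^0=\{0\}$. $\mathbb{B}_k$ is the open unit ball of $\mathbb{C}^k$ (interpreted as $\{0\}$ if $k=0$). Inner products are linear in the second variable. The correspondence $E(C)$. Let $C$ be an $n\times n$ matrix ($n<\infty$) with entries in $\mathbb{Z}_+\cup\{\infty\}$ and let $A=D_n$ be the algebra of diagonal complex $n\times n$ matrices. For each $i,j$ let $E(C)_{ij}=\mathbb{C}^{C_{ij}}$, a Hilbert space of dimension $C_{ij}$. $E(C)$ is the vector space of $n\times n$ matrices $\xi$ whose $(i,j)$ entry $\xi_{ij}$ is a vector in $E(C)_{ij}$. For $D=\mathrm{diag}(d_1,\ldots,d_n)\in A$, the right and left actions are $(\xi D)_{ij}=\xi_{ij}d_j$ and $(\varphi(D)\xi)_{ij}=d_i\xi_{ij}$, and the $A$-valued inner product is the diagonal matrix $\langle\xi,\eta\rangle$ with $j$-th diagonal entry $\sum_{i=1}^n\langle\xi_{ij},\eta_{ij}\rangle$. This makes $E(C)$ a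 W*-correspondence over $A$ (a self-dual right Hilbert $C^*$-module with left action given by a normal $*$-homomorphism $\varphi:A\to\mathcal{L}(E(C))$ into the adjointable operators). The algebra. For a W*-correspondence $E$ over $A$, the full Fock space is $\mathcal{F}(E)=A\oplus E\oplus E^{\otimes 2}\oplus\cdots$ (internal tensor products over $A$). $A$ acts on the left by $\varphi_\infty(a)=\mathrm{diag}(a,\varphi(a),\varphi^{(2)}(a),\ldots)$, where $\varphi^{(k)}(a)(\xi_1\otimes\cdots\otimes\xi_k)=\varphi(a)\xi_1\otimes\xi_2\otimes\cdots\otimes\xi_k$. For $\xi\in E$ the creation operator is $T_\xi(\xi_1\otimes\cdots\otimes\xi_k)=\xi\otimes\xi_1\otimes\cdots\otimes\xi_k$ (and $T_\xi a=\xi a$ for $a\in A$). $\mathcal{T}_+(E)$ is the norm-closed subalgebra of $\mathcal{L}(\mathcal{F}(E))$ generated by $\{T_\xi:\xi\in E\}$ and $\varphi_\infty(A)$. Write $\mathcal{T}_+(C)=\mathcal{T}_+(E(C))$. Characters. $\delta_i(\mathrm{diag}(d_1,\ldots,d_n))=d_i$. For $1\le i\le n$ and $\lambda$ in the closed unit ball of $\mathbb{C}^{C_{ii}}$, $\varphi_{(i,\lambda)}$ denotes the character (one-dimensional contractive representation) of $\mathcal{T}_+(C)$ with $\varphi_{(i,\lambda)}(\varphi_\infty(D))=\delta_i(D)$ for $D\in A$ and $\varphi_{(i,\lambda)}(T_\xi)=\langle\lambda,\xi_{ii}\rangle$ for $\xi\in E(C)$. $G(C,\tilde\lambda,i,j)$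 is the set of all contractive representations $\rho$ of $\mathcal{T}_+(C)$ on $\mathbb{C}^2$ such that: (G1) $\rho(\varphi_\infty(D))=\mathrm{diag}(\delta_i(D),\delta_j(D))$ for $D\in A$; (G2) the image of $\rho$ is contained in $T_2$, the upper triangular $2\times2$ matrices; (G3) for every $S\in\mathcal{T}_+(C)$, $(\rho(S))_{11}=\varphi_{(i,\lambda_i)}(S)$ and $(\rho(S))_{22}=\varphi_{(j,\lambda_j)}(S)$. The topology of pointwise convergence: $\rho_\alpha\to\rho$ iff $\rho_\alpha(S)\to\rho(S)$ for every $S\in\mathcal{T}_+(C)$. *)

theory Defs
  imports
    "HOL-Analysis.Analysis"
    "HOL-Library.Extended_Nat"
    "HOL-Library.Function_Algebras"
begin

text \<open>Vectors of $\ell_2(W)$ are functions on the whole type that vanish off \<open>W\<close>.\<close>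

definition ell2 :: "'w set \<Rightarrow> ('w \<Rightarrow> complex) set" where
  "ell2 W = {x. (\<forall>w. w \<notin> W \<longrightarrow> x w = 0) \<and> (\<lambda>w. (cmod (x w))\<^sup>2) summable_on UNIV}"

text \<open>Linear in the second variable.\<close>

definition ip :: "('w \<Rightarrow> complex) \<Rightarrow> ('w \<Rightarrow> complex) \<Rightarrow> complex" where
  "ip x y = (\<Sum>\<^sub>\<infinity>w. cnj (x w) * y w)"

definition ell2_norm :: "('w \<Rightarrow> complex) \<Rightarrow> real" where
  "ell2_norm x = sqrt (\<Sum>\<^sub>\<infinity>w. (cmod (x w))\<^sup>2)"

text \<open>$\mathbb{C}^k$ for \<open>k\<close> a natural number or \<open>\<infinity>\<close>;
  the case \<open>k = \<infinity>\<close> is $\ell_2(\mathbb{N})$.\<close>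

definition coords :: "enat \<Rightarrow> nat set" where
  "coords k = {c. enat c < k}"

definition Cspace :: "enat \<Rightarrow> (nat \<Rightarrow> complex) set" where
  "Cspace k = ell2 (coords k)"

definition open_unit_ball :: "enat \<Rightarrow> (nat \<Rightarrow> complex) set" where
  "open_unit_ball k = {x \<in> Cspace k. ell2_norm x < 1}"

definition closed_ball :: "enat \<Rightarrow> (nat \<Rightarrow> complex) \<Rightarrow> real \<Rightarrow> (nat \<Rightarrow> complex) set" where
  "closed_ball k z r = {x \<in> Cspace k. ell2_norm (x - z) \<le> r}"

text \<open>The coarsest topology on $\mathbb{C}^k$ for which all functionals \<open>\<langle>y, \<cdot>\<rangle>\<close>
  are continuous.\<close>

definition weak_topology :: "enat \<Rightarrow> (nat \<Rightarrow> complex) topology" where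
  "weak_topology k =
     pullback_topology (Cspace k) (\<lambda>x. \<lambda>y\<in>Cspace k. ip y x)
       (product_topology (\<lambda>_. euclidean) (Cspace k))"

text \<open>The index type \<open>'n\<close> has \<open>n\<close> elements.\<close>

definition diag_algebra :: "(complex ^ 'n ^ 'n) set" where
  "diag_algebra = {D. \<forall>i j. i \<noteq> j \<longrightarrow> D $ i $ j = 0}"

definition delta :: "'n \<Rightarrow> complex ^ 'n ^ 'n \<Rightarrow> complex" where
  "delta i D = D $ i $ i"

text \<open>The library norm of a matrix is the Euclidean one, so the C*-norm is written as
  an operator norm.\<close>

definition mat_norm :: "complex ^ 'm::finite ^ 'm \<Rightarrow> real" where
  "mat_norm M = onorm ((*v) M)"

text \<open>For a matrix \<open>W\<close> of index sets, the module of matrices with \<open>(i,j)\<close> entry in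
  $\ell_2(W_{ij})$.\<close>

definition mat_module :: "('n \<Rightarrow> 'n \<Rightarrow> 'w set) \<Rightarrow> ('n \<Rightarrow> 'n \<Rightarrow> 'w \<Rightarrow> complex) set" where
  "mat_module W = {\<xi>. \<forall>i j. \<xi> i j \<in> ell2 (W i j)}"

definition mod_ip ::
    "('n::finite \<Rightarrow> 'n \<Rightarrow> 'w \<Rightarrow> complex) \<Rightarrow> ('n \<Rightarrow> 'n \<Rightarrow> 'w \<Rightarrow> complex) \<Rightarrow> complex ^ 'n ^ 'n" where
  "mod_ip \<xi> \<eta> = (\<chi> a b. if a = b then (\<Sum>i\<in>UNIV. ip (\<xi> i b) (\<eta> i b)) else 0)"

definition mod_norm :: "('n::finite \<Rightarrow> 'n \<Rightarrow> 'w \<Rightarrow> complex) \<Rightarrow> real" where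
  "mod_norm \<xi> = sqrt (mat_norm (mod_ip \<xi> \<xi>))"

definition right_act ::
    "('n \<Rightarrow> 'n \<Rightarrow> 'w \<Rightarrow> complex) \<Rightarrow> complex ^ 'n ^ 'n \<Rightarrow> ('n \<Rightarrow> 'n \<Rightarrow> 'w \<Rightarrow> complex)" where
  "right_act \<xi> D = (\<lambda>i j w. \<xi> i j w * D $ j $ j)"

definition left_act ::
    "complex ^ 'n ^ 'n \<Rightarrow> ('n \<Rightarrow> 'n \<Rightarrow> 'w \<Rightarrow> complex) \<Rightarrow> ('n \<Rightarrow> 'n \<Rightarrow> 'w \<Rightarrow> complex)" where
  "left_act D \<xi> = (\<lambda>i j w. D $ i $ i * \<xi> i j w)"

definition E :: "enat ^ 'n ^ 'n \<Rightarrow> ('n \<Rightarrow> 'n \<Rightarrow> nat \<Rightarrow> complex) set" where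
  "E C = mat_module (\<lambda>i j. coords (C $ i $ j))"

text \<open>The internal tensor product over the diagonal algebra of two matrix modules \<open>X\<close>, \<open>Y\<close>
  has \<open>(i,j)\<close> entry $\bigoplus_m X_{im} \otimes Y_{mj}$. The words below index the standard
  orthonormal basis of this space when it is iterated: the word
  \<open>[(c\<^sub>1,m\<^sub>1), \<dots>, (c\<^sub>k,m\<^sub>k)]\<close> in \<open>tpow_index C k i j\<close> has \<open>m\<^sub>k = j\<close> and stands for
  $e_{c_1} \otimes \cdots \otimes e_{c_k}$ in
  $E_{i m_1} \otimes E_{m_1 m_2} \otimes \cdots \otimes E_{m_{k-1} m_k}$. For \<open>k = 0\<close> one obtains
  the diagonal algebra itself. That these modules, complete as sums of $\ell_2$-spaces, are the
  internal tensor powers with elementary tensors \<open>tensor\<close> is checked in the lemmas \<open>tensor_balanced\<close>, \<open>tensor_in_tpow\<close>,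
  \<open>mod_ip_tensor\<close> and \<open>tensor_total\<close>.\<close>

fun tpow_index :: "enat ^ 'n ^ 'n \<Rightarrow> nat \<Rightarrow> 'n \<Rightarrow> 'n \<Rightarrow> (nat \<times> 'n) list set" where
  "tpow_index C 0 i j = (if i = j then {[]} else {})"
| "tpow_index C (Suc k) i j =
     {(c, m) # p | c m p. c \<in> coords (C $ i $ m) \<and> p \<in> tpow_index C k m j}"

definition tpow :: "enat ^ 'n ^ 'n \<Rightarrow> nat \<Rightarrow> ('n \<Rightarrow> 'n \<Rightarrow> (nat \<times> 'n) list \<Rightarrow> complex) set" where
  "tpow C k = mat_module (tpow_index C k)"

definition tensor ::
    "('n \<Rightarrow> 'n \<Rightarrow> nat \<Rightarrow> complex) \<Rightarrow> ('n \<Rightarrow> 'n \<Rightarrow> (nat \<times> 'n) list \<Rightarrow> complex) \<Rightarrow>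
     ('n \<Rightarrow> 'n \<Rightarrow> (nat \<times> 'n) list \<Rightarrow> complex)" where
  "tensor \<xi> \<eta> = (\<lambda>i j w. case w of [] \<Rightarrow> 0 | (c, m) # p \<Rightarrow> \<xi> i m c * \<eta> m j p)"

type_synonym 'n fock_vec = "nat \<Rightarrow> 'n \<Rightarrow> 'n \<Rightarrow> (nat \<times> 'n) list \<Rightarrow> complex"

definition fock :: "enat ^ 'n::finite ^ 'n \<Rightarrow> 'n fock_vec set" where
  "fock C = {x. (\<forall>k. x k \<in> tpow C k) \<and> summable (\<lambda>k. mod_ip (x k) (x k))}"

definition fock_ip :: "'n::finite fock_vec \<Rightarrow> 'n fock_vec \<Rightarrow> complex ^ 'n ^ 'n" where
  "fock_ip x y = (\<Sum>k. mod_ip (x k) (y k))"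

definition fock_norm :: "'n::finite fock_vec \<Rightarrow> real" where
  "fock_norm x = sqrt (mat_norm (fock_ip x x))"

text \<open>Operators on the Fock space are functions on the whole type that are \<open>0\<close> off \<open>fock C\<close>,
  so that each operator has only one representative and sums and compositions are those of
  functions.\<close>

type_synonym 'n fock_op = "'n fock_vec \<Rightarrow> 'n fock_vec"

text \<open>An adjointable map is automatically linear, a module map and bounded. Boundedness is
  repeated here because \<open>op_norm\<close> is a supremum of reals.\<close>

definition adjointable_ops :: "enat ^ 'n::finite ^ 'n \<Rightarrow> 'n fock_op set" where
  "adjointable_ops C = {S.
     (\<forall>x\<in>fock C. S x \<in> fock C) \<and> (\<forall>x. x \<notin> fock C \<longrightarrow> S x = 0) \<and>
     (\<exists>K. \<forall>x\<in>fock C. fock_norm (S x) \<le> K * fock_norm x) \<and>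
     (\<exists>S'. (\<forall>y\<in>fock C. S' y \<in> fock C) \<and>
           (\<forall>x\<in>fock C. \<forall>y\<in>fock C. fock_ip (S x) y = fock_ip x (S' y)))}"

definition op_norm :: "enat ^ 'n::finite ^ 'n \<Rightarrow> 'n fock_op \<Rightarrow> real" where
  "op_norm C S = (SUP x\<in>{x \<in> fock C. fock_norm x \<le> 1}. fock_norm (S x))"

definition op_scale :: "complex \<Rightarrow> 'n fock_op \<Rightarrow> 'n fock_op" where
  "op_scale a S = (\<lambda>x k i j w. a * S x k i j w)"

definition creation :: "enat ^ 'n::finite ^ 'n \<Rightarrow> ('n \<Rightarrow> 'n \<Rightarrow> nat \<Rightarrow> complex) \<Rightarrow> 'n fock_op" where
  "creation C \<xi> = (\<lambda>x. if x \<in> fock C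
     then (\<lambda>k. case k of 0 \<Rightarrow> 0 | Suc l \<Rightarrow> tensor \<xi> (x l)) else 0)"

definition phi_inf :: "enat ^ 'n::finite ^ 'n \<Rightarrow> complex ^ 'n ^ 'n \<Rightarrow> 'n fock_op" where
  "phi_inf C D = (\<lambda>x. if x \<in> fock C then (\<lambda>k. left_act D (x k)) else 0)"

definition closed_subalgebra :: "enat ^ 'n::finite ^ 'n \<Rightarrow> 'n fock_op set \<Rightarrow> bool" where
  "closed_subalgebra C B \<longleftrightarrow>
     B \<subseteq> adjointable_ops C \<and> 0 \<in> B \<and>
     (\<forall>S\<in>B. \<forall>T\<in>B. S + T \<in> B \<and> S \<circ> T \<in> B) \<and>
     (\<forall>a. \<forall>S\<in>B. op_scale a S \<in> B) \<and>
     (\<forall>S\<in>adjointable_ops C. (\<forall>\<epsilon>>0. \<exists>T\<in>B. op_norm C (S - T) < \<epsilon>) \<longrightarrow> S \<in> B)"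

definition tensor_algebra :: "enat ^ 'n::finite ^ 'n \<Rightarrow> 'n fock_op set" where
  "tensor_algebra C =
     closed_subalgebra C hull (creation C ` E C \<union> phi_inf C ` diag_algebra)"

text \<open>Maps defined on the tensor algebra are taken extensional, again for uniqueness of
  representatives.\<close>

definition contractive_rep ::
    "enat ^ 'n::finite ^ 'n \<Rightarrow> ('n fock_op \<Rightarrow> complex ^ 'm::finite ^ 'm) \<Rightarrow> bool" where
  "contractive_rep C \<rho> \<longleftrightarrow>
     \<rho> \<in> extensional (tensor_algebra C) \<and>
     (\<forall>S\<in>tensor_algebra C. \<forall>T\<in>tensor_algebra C.
        \<rho> (S + T) = \<rho> S + \<rho> T \<and> \<rho> (S \<circ> T) = \<rho> S ** \<rho> T) \<and>
     (\<forall>a. \<forall>S\<in>tensor_algebra C. \<rho> (op_scale a S) = (\<chi> p q. a * \<rho> S $ p $ q)) \<and>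
     (\<forall>S\<in>tensor_algebra C. mat_norm (\<rho> S) \<le> op_norm C S)"

definition is_character :: "enat ^ 'n::finite ^ 'n \<Rightarrow> ('n fock_op \<Rightarrow> complex) \<Rightarrow> bool" where
  "is_character C f \<longleftrightarrow>
     f \<in> extensional (tensor_algebra C) \<and>
     (\<forall>S\<in>tensor_algebra C. \<forall>T\<in>tensor_algebra C.
        f (S + T) = f S + f T \<and> f (S \<circ> T) = f S * f T) \<and>
     (\<forall>a. \<forall>S\<in>tensor_algebra C. f (op_scale a S) = a * f S) \<and>
     (\<forall>S\<in>tensor_algebra C. cmod (f S) \<le> op_norm C S)"

definition char_at ::
    "enat ^ 'n::finite ^ 'n \<Rightarrow> 'n \<Rightarrow> (nat \<Rightarrow> complex) \<Rightarrow> ('n fock_op \<Rightarrow> complex)" where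
  "char_at C i l = (THE f. is_character C f \<and>
     (\<forall>D\<in>diag_algebra. f (phi_inf C D) = delta i D) \<and>
     (\<forall>\<xi>\<in>E C. f (creation C \<xi>) = ip l (\<xi> i i)))"

definition diag2 :: "complex \<Rightarrow> complex \<Rightarrow> complex ^ 2 ^ 2" where
  "diag2 a b = (\<chi> p q. if p = q then (if p = 1 then a else b) else 0)"

definition upper_triangular2 :: "(complex ^ 2 ^ 2) set" where
  "upper_triangular2 = {M. M $ 2 $ 1 = 0}"

definition G ::
    "enat ^ 'n::finite ^ 'n \<Rightarrow> (nat \<Rightarrow> complex) \<times> (nat \<Rightarrow> complex) \<Rightarrow> 'n \<Rightarrow> 'n \<Rightarrow>
     ('n fock_op \<Rightarrow> complex ^ 2 ^ 2) set" where
  "G C l i j = {\<rho>. contractive_rep C \<rho> \<and>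
     (\<forall>D\<in>diag_algebra. \<rho> (phi_inf C D) = diag2 (delta i D) (delta j D)) \<and>
     \<rho> ` tensor_algebra C \<subseteq> upper_triangular2 \<and>
     (\<forall>S\<in>tensor_algebra C. \<rho> S $ 1 $ 1 = char_at C i (fst l) S \<and>
                            \<rho> S $ 2 $ 2 = char_at C j (snd l) S)}"

definition pointwise_topology ::
    "enat ^ 'n::finite ^ 'n \<Rightarrow> ('n fock_op \<Rightarrow> complex ^ 2 ^ 2) topology" where
  "pointwise_topology C = product_topology (\<lambda>_. euclidean) (tensor_algebra C)"

(* Infinite_Sum uses the same notation, and it is the one meant below. *)
no_notation Infinite_Set_Sum.abs_summable_on (infix \<open>abs'_summable'_on\<close> 50)

lemma ell2_mult_abs_summable:
  assumes "x \<in> ell2 W" "y \<in> ell2 W'"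
  shows "(\<lambda>w. cnj (x w) * y w) abs_summable_on UNIV"
proof (rule Infinite_Sum.abs_summable_product)
  show "(\<lambda>w. cnj (x w) * cnj (x w)) abs_summable_on UNIV" "(\<lambda>w. y w * y w) abs_summable_on UNIV"
    using assms by (auto simp: ell2_def norm_mult power2_eq_square)
qed

lemma abs_summable_prod_mult:
  fixes f :: "'a \<Rightarrow> 'c::{real_normed_field,banach}"
  assumes "f abs_summable_on UNIV" "g abs_summable_on UNIV"
  shows "(\<lambda>(a, b). f a * g b) abs_summable_on UNIV"
    and "(\<Sum>\<^sub>\<infinity>(a, b). f a * g b) = (\<Sum>\<^sub>\<infinity>a. f a) * (\<Sum>\<^sub>\<infinity>b. g b)"
proof -
  have *: "(\<lambda>(a, b). f a * g b) abs_summable_on (UNIV \<times> UNIV)"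
    unfolding Infinite_Sum.abs_summable_on_Sigma_iff
  proof (intro conjI ballI)
    show "(\<lambda>b. case (a, b) of (a, b) \<Rightarrow> f a * g b) abs_summable_on UNIV" for a
      using summable_on_cmult_right[OF assms(2), of "norm (f a)"] by (simp add: norm_mult)
    have "(\<lambda>a. \<bar>norm (f a) * infsum (\<lambda>b. norm (g b)) UNIV\<bar>) summable_on UNIV"
      using summable_on_cmult_left[OF assms(1)] by (simp add: abs_mult infsum_nonneg)
    then show "(\<lambda>a. \<Sum>\<^sub>\<infinity>b. norm (case (a, b) of (a, b) \<Rightarrow> f a * g b)) abs_summable_on UNIV"
      by (simp add: norm_mult infsum_cmult_right')
  qed
  then show "(\<lambda>(a, b). f a * g b) abs_summable_on UNIV" by simp
  have "(\<Sum>\<^sub>\<infinity>a. \<Sum>\<^sub>\<infinity>b. f a * g b) = infsum (\<lambda>(a, b). f a * g b) (UNIV \<times> UNIV)"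
    using infsum_Sigma_banach[OF abs_summable_summable[OF *]] by simp
  then show "(\<Sum>\<^sub>\<infinity>(a, b). f a * g b) = (\<Sum>\<^sub>\<infinity>a. f a) * (\<Sum>\<^sub>\<infinity>b. g b)"
    by (simp add: infsum_cmult_right' infsum_cmult_left')
qed

lemma infsum_words:
  fixes f :: "(nat \<times> 'n::finite) list \<Rightarrow> 'b::banach"
  assumes "f [] = 0" "\<And>m. (\<lambda>(c, p). f ((c, m) # p)) abs_summable_on UNIV"
  shows "f abs_summable_on UNIV"
    and "(\<Sum>\<^sub>\<infinity>w. f w) = (\<Sum>m\<in>UNIV. \<Sum>\<^sub>\<infinity>(c, p). f ((c, m) # p))"
proof -
  define h :: "'n \<times> (nat \<times> (nat \<times> 'n) list) \<Rightarrow> (nat \<times> 'n) list"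
    where "h = (\<lambda>(m, c, p). (c, m) # p)"
  have inj: "inj_on h (UNIV \<times> UNIV)" by (auto simp: inj_on_def h_def)
  have h: "w \<in> range h" if "w \<noteq> []" for w
    using that by (cases w) (auto simp: h_def image_iff)
  have f0: "f w = 0" if "w \<notin> range h" for w
    by (metis assms(1) h that)
  have *: "(f \<circ> h) abs_summable_on (UNIV \<times> UNIV)"
    unfolding Infinite_Sum.abs_summable_on_Sigma_iff using assms(2)
    by (auto simp: h_def case_prod_unfold)
  have "(\<lambda>w. norm (f w)) summable_on h ` (UNIV \<times> UNIV)"
    using * inj by (subst summable_on_reindex) (auto simp: o_def)
  moreover have "(\<lambda>w. norm (f w)) summable_on h ` (UNIV \<times> UNIV) \<longleftrightarrow> f abs_summable_on UNIV"
    using f0 by (intro summable_on_cong_neutral) auto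
  ultimately show "f abs_summable_on UNIV" by simp
  have "(\<Sum>\<^sub>\<infinity>w. f w) = infsum f (h ` (UNIV \<times> UNIV))"
    using f0 by (intro infsum_cong_neutral) auto
  also have "\<dots> = infsum (f \<circ> h) (UNIV \<times> UNIV)"
    using inj by (rule infsum_reindex)
  also have "\<dots> = (\<Sum>\<^sub>\<infinity>m. \<Sum>\<^sub>\<infinity>cp. (f \<circ> h) (m, cp))"
    using infsum_Sigma_banach[OF abs_summable_summable[OF *]] by (simp only: UNIV_Times_UNIV)
  also have "\<dots> = (\<Sum>m\<in>UNIV. \<Sum>\<^sub>\<infinity>(c, p). f ((c, m) # p))"
    by (simp add: h_def case_prod_unfold)
  finally show "(\<Sum>\<^sub>\<infinity>w. f w) = (\<Sum>m\<in>UNIV. \<Sum>\<^sub>\<infinity>(c, p). f ((c, m) # p))" .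
qed

lemma tensor_balanced:
  "tensor (right_act \<xi> D) \<eta> = tensor \<xi> (left_act D \<eta>)"
  by (auto simp: tensor_def right_act_def left_act_def fun_eq_iff split: list.splits)

lemma left_act_tensor:
  "left_act D (tensor \<xi> \<eta>) = tensor (left_act D \<xi>) \<eta>"
  by (auto simp: tensor_def left_act_def fun_eq_iff split: list.splits)

lemma right_act_tensor:
  "right_act (tensor \<xi> \<eta>) D = tensor \<xi> (right_act \<eta> D)"
  by (auto simp: tensor_def right_act_def fun_eq_iff split: list.splits)

lemma tensor_in_tpow:
  fixes C :: "enat ^ 'n::finite ^ 'n"
  assumes "\<xi> \<in> E C" "\<eta> \<in> tpow C k"
  shows "tensor \<xi> \<eta> \<in> tpow C (Suc k)"
  unfolding tpow_def mat_module_def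
proof (intro CollectI allI)
  fix i j
  have \<xi>: "\<xi> i m \<in> ell2 (coords (C $ i $ m))" for m
    using assms(1) by (auto simp: E_def mat_module_def)
  have \<eta>: "\<eta> m j \<in> ell2 (tpow_index C k m j)" for m
    using assms(2) by (auto simp: tpow_def mat_module_def)
  have "(\<lambda>w. (cmod (tensor \<xi> \<eta> i j w))\<^sup>2) abs_summable_on UNIV"
  proof (rule infsum_words(1))
    fix m
    have "(\<lambda>(c, p). (cmod (\<xi> i m c))\<^sup>2 * (cmod (\<eta> m j p))\<^sup>2) abs_summable_on UNIV"
      by (rule abs_summable_prod_mult(1)) (use \<xi>[of m] \<eta>[of m] in \<open>auto simp: ell2_def\<close>)
    then show "(\<lambda>(c, p). (cmod (tensor \<xi> \<eta> i j ((c, m) # p)))\<^sup>2) abs_summable_on UNIV"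
      by (simp add: tensor_def norm_mult power_mult_distrib case_prod_unfold)
  qed (simp add: tensor_def)
  moreover have "tensor \<xi> \<eta> i j w = 0" if "w \<notin> tpow_index C (Suc k) i j" for w
  proof (cases w)
    case (Cons a p)
    obtain c m where a: "a = (c, m)" by (cases a)
    with that Cons have "c \<notin> coords (C $ i $ m) \<or> p \<notin> tpow_index C k m j" by auto
    then have "\<xi> i m c = 0 \<or> \<eta> m j p = 0"
      using \<xi>[of m] \<eta>[of m] by (auto simp: ell2_def)
    then show ?thesis by (auto simp: tensor_def Cons a)
  qed (simp add: tensor_def)
  ultimately show "tensor \<xi> \<eta> i j \<in> ell2 (tpow_index C (Suc k) i j)"
    by (simp add: ell2_def)
qed

lemma mod_ip_tensor:
  fixes C :: "enat ^ 'n::finite ^ 'n"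
  assumes "\<xi> \<in> E C" "\<xi>' \<in> E C" "\<eta> \<in> tpow C k" "\<eta>' \<in> tpow C k"
  shows "mod_ip (tensor \<xi> \<eta>) (tensor \<xi>' \<eta>') = mod_ip \<eta> (left_act (mod_ip \<xi> \<xi>') \<eta>')"
proof -
  have E: "\<zeta> i m \<in> ell2 (coords (C $ i $ m))" if "\<zeta> \<in> E C" for \<zeta> i m
    using that by (auto simp: E_def mat_module_def)
  have T: "\<zeta> m j \<in> ell2 (tpow_index C k m j)" if "\<zeta> \<in> tpow C k" for \<zeta> m j
    using that by (auto simp: tpow_def mat_module_def)
  have ent: "ip (tensor \<xi> \<eta> i b) (tensor \<xi>' \<eta>' i b) =
      (\<Sum>m\<in>UNIV. ip (\<xi> i m) (\<xi>' i m) * ip (\<eta> m b) (\<eta>' m b))" for i b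
  proof -
    define f where "f = (\<lambda>w. cnj (tensor \<xi> \<eta> i b w) * tensor \<xi>' \<eta>' i b w)"
    have f: "f ((c, m) # p) = (cnj (\<xi> i m c) * \<xi>' i m c) * (cnj (\<eta> m b p) * \<eta>' m b p)" for c m p
      by (simp add: f_def tensor_def)
    note s = ell2_mult_abs_summable[OF E[OF assms(1)] E[OF assms(2)]]
      ell2_mult_abs_summable[OF T[OF assms(3)] T[OF assms(4)]]
    have "(\<Sum>\<^sub>\<infinity>w. f w) = (\<Sum>m\<in>UNIV. \<Sum>\<^sub>\<infinity>(c, p). f ((c, m) # p))"
    proof (rule infsum_words(2))
      show "(\<lambda>(c, p). f ((c, m) # p)) abs_summable_on UNIV" for m
        unfolding f by (rule abs_summable_prod_mult(1)[OF s])
    qed (simp add: f_def tensor_def)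
    also have "\<dots> = (\<Sum>m\<in>UNIV. ip (\<xi> i m) (\<xi>' i m) * ip (\<eta> m b) (\<eta>' m b))"
      unfolding f ip_def by (intro sum.cong refl abs_summable_prod_mult(2)[OF s])
    finally show ?thesis by (simp add: f_def ip_def)
  qed
  have "(\<Sum>i\<in>UNIV. ip (tensor \<xi> \<eta> i b) (tensor \<xi>' \<eta>' i b)) =
      (\<Sum>m\<in>UNIV. ip (\<eta> m b) (left_act (mod_ip \<xi> \<xi>') \<eta>' m b))" for b
  proof -
    have "ip (\<eta> m b) (left_act (mod_ip \<xi> \<xi>') \<eta>' m b) =
        (\<Sum>i\<in>UNIV. ip (\<xi> i m) (\<xi>' i m)) * ip (\<eta> m b) (\<eta>' m b)" for m
      by (simp add: left_act_def mod_ip_def ip_def mult.left_commute[of "cnj _"] infsum_cmult_right')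
    then show ?thesis
      by (simp add: ent sum_distrib_right) (rule sum.swap)
  qed
  then show ?thesis by (simp add: mod_ip_def vec_eq_iff)
qed

lemma tensor_total:
  fixes C :: "enat ^ 'n::finite ^ 'n"
  assumes \<zeta>: "\<zeta> \<in> tpow C (Suc k)" and "\<epsilon> > 0"
  shows "\<exists>ps. set ps \<subseteq> E C \<times> tpow C k \<and>
    mod_norm (\<zeta> - (\<Sum>(\<xi>, \<eta>)\<leftarrow>ps. tensor \<xi> \<eta>)) < \<epsilon>"
proof -
  let ?W = "tpow_index C (Suc k)"
  have \<zeta>': "\<zeta> i j \<in> ell2 (?W i j)" for i j
    using \<zeta> by (auto simp: tpow_def mat_module_def)
  define d where "d = \<epsilon>\<^sup>2 / (4 * real CARD('n))"
  have "d > 0" using \<open>\<epsilon> > 0\<close> by (simp add: d_def)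
  have "\<exists>F. finite F \<and> dist (\<Sum>w\<in>F. (cmod (\<zeta> i j w))\<^sup>2) (\<Sum>\<^sub>\<infinity>w. (cmod (\<zeta> i j w))\<^sup>2) \<le> d" for i j
    using infsum_finite_approximation[of "\<lambda>w. (cmod (\<zeta> i j w))\<^sup>2" UNIV d] \<zeta>'[of i j] \<open>d > 0\<close>
    by (auto simp: ell2_def)
  then obtain F where F: "\<And>i j. finite (F i j)"
      "\<And>i j. dist (\<Sum>w\<in>F i j. (cmod (\<zeta> i j w))\<^sup>2) (\<Sum>\<^sub>\<infinity>w. (cmod (\<zeta> i j w))\<^sup>2) \<le> d"
    by metis
  define trunc where "trunc A = (\<lambda>i j w. if (i, j, w) \<in> A then \<zeta> i j w else 0)" for A
  have tr: "\<exists>ps. set ps \<subseteq> E C \<times> tpow C k \<and> trunc A = (\<Sum>(\<xi>, \<eta>)\<leftarrow>ps. tensor \<xi> \<eta>)"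
    if "finite A" for A
    using that
  proof induction
    case empty
    show ?case by (rule exI[of _ "[]"]) (auto simp: trunc_def fun_eq_iff)
  next
    case (insert t A)
    obtain i j w where t: "t = (i, j, w)" by (cases t)
    from insert obtain ps where ps: "set ps \<subseteq> E C \<times> tpow C k"
      "trunc A = (\<Sum>(\<xi>, \<eta>)\<leftarrow>ps. tensor \<xi> \<eta>)" by blast
    show ?case
    proof (cases "w \<in> ?W i j")
      case False
      then have "\<zeta> i j w = 0" using \<zeta>'[of i j] by (simp add: ell2_def)
      then have "trunc (insert t A) = trunc A"
        by (auto simp: trunc_def t fun_eq_iff)
      with ps show ?thesis by auto
    next
      case True
      then obtain c m p where w: "w = (c, m) # p" "c \<in> coords (C $ i $ m)" "p \<in> tpow_index C k m j"
        by auto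
      define \<xi> :: "'n \<Rightarrow> 'n \<Rightarrow> nat \<Rightarrow> complex"
        where "\<xi> = (\<lambda>i' m' c'. if i' = i \<and> m' = m \<and> c' = c then \<zeta> i j w else 0)"
      define \<eta> :: "'n \<Rightarrow> 'n \<Rightarrow> (nat \<times> 'n) list \<Rightarrow> complex"
        where "\<eta> = (\<lambda>m' j' p'. if m' = m \<and> j' = j \<and> p' = p then 1 else 0)"
      have fin: "(\<lambda>v. (cmod (if P \<and> Q \<and> v = u then z else 0))\<^sup>2) summable_on UNIV"
        for P Q and u :: 'u and z
        using summable_on_cong_neutral[of UNIV "{u}" "\<lambda>v. (cmod (if P \<and> Q \<and> v = u then z else 0))\<^sup>2"
            "\<lambda>v. (cmod (if P \<and> Q \<and> v = u then z else 0))\<^sup>2"] by auto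
      have "\<xi> \<in> E C" using w(2) fin
        by (auto simp: E_def mat_module_def ell2_def \<xi>_def)
      moreover have "\<eta> \<in> tpow C k" using w(3) fin
        by (auto simp: tpow_def mat_module_def ell2_def \<eta>_def)
      moreover have "trunc (insert t A) = tensor \<xi> \<eta> + trunc A"
        using insert.hyps(2)
        by (auto simp: trunc_def tensor_def fun_eq_iff \<xi>_def \<eta>_def t w(1) split: list.splits)
      ultimately show ?thesis using ps by (intro exI[of _ "(\<xi>, \<eta>) # ps"]) auto
    qed
  qed
  define A where "A = (SIGMA i:UNIV. SIGMA j:UNIV. F i j)"
  have "finite A" unfolding A_def using F(1) by (intro finite_SigmaI) auto
  define \<theta> where "\<theta> = \<zeta> - trunc A"
  have \<theta>: "\<theta> i j w = (if w \<in> F i j then 0 else \<zeta> i j w)" for i j w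
    by (simp add: \<theta>_def trunc_def A_def)
  define a where "a i j = (\<Sum>\<^sub>\<infinity>w. (cmod (\<theta> i j w))\<^sup>2)" for i j
  have a: "0 \<le> a i j" "a i j \<le> d" for i j
  proof -
    show "0 \<le> a i j" unfolding a_def by (intro infsum_nonneg) auto
    have s: "(\<lambda>w. (cmod (\<zeta> i j w))\<^sup>2) summable_on UNIV" using \<zeta>'[of i j] by (simp add: ell2_def)
    have "(\<Sum>\<^sub>\<infinity>w. (cmod (\<zeta> i j w))\<^sup>2) =
        (\<Sum>\<^sub>\<infinity>w\<in>F i j. (cmod (\<zeta> i j w))\<^sup>2) + (\<Sum>\<^sub>\<infinity>w\<in>- F i j. (cmod (\<zeta> i j w))\<^sup>2)"
      using infsum_Un_disjoint[of "\<lambda>w. (cmod (\<zeta> i j w))\<^sup>2" "F i j" "- F i j"] F(1)[of i j]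
        summable_on_subset_banach[OF s, of "- F i j"] by simp
    moreover have "(\<Sum>\<^sub>\<infinity>w\<in>- F i j. (cmod (\<zeta> i j w))\<^sup>2) = a i j"
      unfolding a_def by (intro infsum_cong_neutral) (auto simp: \<theta>)
    ultimately show "a i j \<le> d"
      using F(2)[of i j] F(1)[of i j] by (simp add: dist_real_def)
  qed
  have ip: "ip (\<theta> i j) (\<theta> i j) = complex_of_real (a i j)" for i j
  proof -
    have "(\<lambda>w. (cmod (\<theta> i j w))\<^sup>2) summable_on UNIV"
      by (rule summable_on_comparison_test[of "\<lambda>w. (cmod (\<zeta> i j w))\<^sup>2"])
         (use \<zeta>'[of i j] in \<open>auto simp: ell2_def \<theta>\<close>)
    then have "((\<lambda>w. complex_of_real ((cmod (\<theta> i j w))\<^sup>2)) has_sum complex_of_real (a i j)) UNIV"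
      unfolding a_def by (intro has_sum_of_real has_sum_infsum)
    moreover have "cnj (\<theta> i j w) * \<theta> i j w = complex_of_real ((cmod (\<theta> i j w))\<^sup>2)" for w
      by (metis complex_norm_square mult.commute)
    ultimately show ?thesis unfolding ip_def by (simp add: infsumI)
  qed
  define K where "K = real CARD('n) * d"
  have "K \<ge> 0" using \<open>d > 0\<close> by (simp add: K_def)
  have mn: "mat_norm (mod_ip \<theta> \<theta>) \<le> K"
    unfolding mat_norm_def
  proof (rule onorm_le)
    fix v :: "complex ^ 'n"
    have c: "(mod_ip \<theta> \<theta> *v v) $ b = complex_of_real (\<Sum>i\<in>UNIV. a i b) * v $ b" for b
    proof -
      have "(mod_ip \<theta> \<theta> *v v) $ b =
          (\<Sum>b'\<in>UNIV. (if b = b' then \<Sum>i\<in>UNIV. complex_of_real (a i b') else 0) * v $ b')"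
        unfolding matrix_vector_mult_def mod_ip_def ip by simp
      also have "\<dots> = (\<Sum>b'\<in>UNIV. if b = b' then (\<Sum>i\<in>UNIV. complex_of_real (a i b')) * v $ b' else 0)"
        by (rule sum.cong) simp_all
      finally show ?thesis by simp
    qed
    have "norm ((mod_ip \<theta> \<theta> *v v) $ b) \<le> norm ((K *\<^sub>R v) $ b)" for b
    proof -
      have "(\<Sum>i\<in>UNIV. a i b) \<le> K" using sum_mono[of UNIV "\<lambda>i. a i b" "\<lambda>_. d"] a by (simp add: K_def)
      moreover have "0 \<le> (\<Sum>i\<in>UNIV. a i b)" using a by (intro sum_nonneg) auto
      ultimately have "norm (complex_of_real (\<Sum>i\<in>UNIV. a i b)) \<le> K"
        by (simp only: norm_of_real abs_of_nonneg)
      then show ?thesis using \<open>K \<ge> 0\<close> unfolding c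
        by (simp only: norm_mult norm_scaleR vector_scaleR_component abs_of_nonneg)
           (intro mult_right_mono, auto)
    qed
    then have "norm (mod_ip \<theta> \<theta> *v v) \<le> norm (K *\<^sub>R v)"
      unfolding norm_vec_def by (intro L2_set_mono) auto
    then show "norm (mod_ip \<theta> \<theta> *v v) \<le> K * norm v" using \<open>K \<ge> 0\<close> by simp
  qed
  have "K = (\<epsilon> / 2)\<^sup>2" by (simp add: K_def d_def power_divide)
  then have "sqrt (mat_norm (mod_ip \<theta> \<theta>)) \<le> \<epsilon> / 2"
    using mn \<open>\<epsilon> > 0\<close> by (intro real_le_lsqrt) auto
  then have "mod_norm \<theta> < \<epsilon>" using \<open>\<epsilon> > 0\<close> by (simp add: mod_norm_def)
  with tr[OF \<open>finite A\<close>] show ?thesis by (auto simp: \<theta>_def)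
qed

end

theory Submission
  imports Defs
begin

text \<open>A representation in \<open>G\<close> is determined by its values on creation operators, and there only the
  \<open>(1,2)\<close> entry is free. Compressing by the matrix units of the diagonal algebra shows that this
  entry is a functional of \<open>\<xi> i j\<close> alone, hence equal to \<open>ip \<mu> (\<xi> i j)\<close> for some \<open>\<mu>\<close> by the Riesz
  theorem, and contractivity forces $\|\lambda_i\|^2 + \|\mu\|^2 \le 1$. Conversely, for every such
  \<open>\<mu>\<close> the vectors $\lambda_i, \mu, \lambda_j$ form a row contraction which is pure because
  $\|\lambda_i\|, \|\lambda_j\| < 1$. Its Poisson kernel embeds the representation space
  isometrically into the Fock space with a range that is invariant under the adjoints of the tensor
  algebra, so that the compression of the tensor algebra to this range is a contractive
  representation. The homeomorphism is \<open>\<mu> \<mapsto> \<rho>\<close>, from the ball with centre \<open>0\<close> and radius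
  $\sqrt{1 - \|\lambda_i\|^2}$.\<close>

section \<open>Square-summable families\<close>

text \<open>Two features of the setting shape the proof. The norms are those of a C*-module, and
  they are made accessible column by column: \<open>fock_ip\<close> is diagonal, its entry at b is
  the inner product of the b-th columns, and adjointable maps respect columns. The direct sum of the
  columns, i.e. the Fock module tensored with C^n over the diagonal algebra, is the Hilbert space
  that receives the Poisson kernel. Secondly, the tensor algebra is given only as a closed hull, so
  a statement about all its elements is proved on generators and carried through algebra operations
  and norm limits; contractivity makes the limit step uniform in \<mu>. The kernel is built for all
  n indices at once, with zero rows away from i and j. The 2x2 representation is then a corner of an
  n x n one, multiplicative because the other indices split off. The radius does not see \<lambda>_j
  because \<lambda>_i and \<mu> share a row while \<lambda>_j lies in another. The characters in
  (G3) are definite descriptions; their existence comes from the same construction, as diagonal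
  entries of the representations built.\<close>

lemma ell2_summable: "x \<in> ell2 W \<Longrightarrow> (\<lambda>w. (cmod (x w))\<^sup>2) summable_on UNIV"
  by (simp add: ell2_def)

lemma ell2_off: "x \<in> ell2 W \<Longrightarrow> w \<notin> W \<Longrightarrow> x w = 0"
  by (simp add: ell2_def)

lemma ell2_subset: "x \<in> ell2 W \<Longrightarrow> x \<in> ell2 UNIV"
  by (simp add: ell2_def)

lemma ell2_iff: "x \<in> ell2 W \<longleftrightarrow> (\<forall>w. w \<notin> W \<longrightarrow> x w = 0) \<and> x \<in> ell2 UNIV"
  by (auto simp: ell2_def)

lemma ell2_zero [simp]: "0 \<in> ell2 W" "(\<lambda>w. 0) \<in> ell2 W"
  by (auto simp: ell2_def)

lemma ell2_scale [intro]:
  assumes "x \<in> ell2 W"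
  shows "(\<lambda>w. a * x w) \<in> ell2 W"
  using assms by (auto simp: ell2_def norm_mult power_mult_distrib intro: summable_on_cmult_right)

lemma ell2_add [intro]:
  assumes "x \<in> ell2 W" "y \<in> ell2 W"
  shows "x + y \<in> ell2 W"
proof -
  have "(\<lambda>w. 2 * (cmod (x w))\<^sup>2 + 2 * (cmod (y w))\<^sup>2) summable_on UNIV"
    using assms by (intro summable_on_add summable_on_cmult_right) (auto simp: ell2_def)
  moreover have "(cmod ((x + y) w))\<^sup>2 \<le> 2 * (cmod (x w))\<^sup>2 + 2 * (cmod (y w))\<^sup>2" for w
  proof -
    have "(cmod (x w + y w))\<^sup>2 \<le> (cmod (x w) + cmod (y w))\<^sup>2"
      by (intro power_mono norm_triangle_ineq) auto
    also have "\<dots> \<le> 2 * (cmod (x w))\<^sup>2 + 2 * (cmod (y w))\<^sup>2"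
      using sum_squares_bound[of "cmod (x w)" "cmod (y w)"] by (simp add: power2_sum)
    finally show ?thesis by simp
  qed
  ultimately have "(\<lambda>w. (cmod ((x + y) w))\<^sup>2) summable_on UNIV"
    by (rule summable_on_comparison_test) auto
  then show ?thesis using assms by (auto simp: ell2_def)
qed

lemma ell2_diff [intro]:
  assumes "x \<in> ell2 W" "y \<in> ell2 W"
  shows "x - y \<in> ell2 W"
proof -
  have "x - y = x + (\<lambda>w. -1 * y w)" by (auto simp: fun_eq_iff)
  then show ?thesis using assms by (metis ell2_add ell2_scale)
qed

lemma ell2_finite_support:
  assumes "finite F" "\<And>w. w \<notin> F \<Longrightarrow> x w = 0" "\<And>w. w \<notin> W \<Longrightarrow> x w = 0"
  shows "x \<in> ell2 W"
proof -
  have "(\<lambda>w. (cmod (x w))\<^sup>2) summable_on F" using assms(1) by simp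
  then have "(\<lambda>w. (cmod (x w))\<^sup>2) summable_on UNIV"
    by (rule summable_on_cong_neutral[THEN iffD1, rotated -1]) (auto simp: assms(2))
  then show ?thesis using assms(3) by (simp add: ell2_def)
qed

lemma ip_summable: "x \<in> ell2 W \<Longrightarrow> y \<in> ell2 W' \<Longrightarrow> (\<lambda>w. cnj (x w) * y w) summable_on UNIV"
  by (rule abs_summable_summable) (rule ell2_mult_abs_summable)

lemma ip_add_right:
  assumes "x \<in> ell2 W" "y \<in> ell2 W'" "z \<in> ell2 W'"
  shows "ip x (y + z) = ip x y + ip x z"
  using infsum_add[OF ip_summable[OF assms(1,2)] ip_summable[OF assms(1,3)]]
  by (simp add: ip_def distrib_left)

lemma ip_cnj: "cnj (ip x y) = ip y x"
  by (simp add: ip_def flip: infsum_cnj) (simp add: mult.commute)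

lemma ip_add_left:
  assumes "x \<in> ell2 W" "y \<in> ell2 W" "z \<in> ell2 W'"
  shows "ip (x + y) z = ip x z + ip y z"
  using ip_add_right[OF assms(3,1,2)] by (metis ip_cnj complex_cnj_add)

lemma ip_scale_right: "ip x (\<lambda>w. a * y w) = a * ip x y"
  by (simp add: ip_def mult.left_commute[of _ a] infsum_cmult_right')

lemma ip_scale_left: "ip (\<lambda>w. a * x w) y = cnj a * ip x y"
  by (simp add: ip_def mult.assoc infsum_cmult_right')

lemma ip_zero [simp]: "ip 0 y = 0" "ip x 0 = 0" "ip (\<lambda>w. 0) y = 0" "ip x (\<lambda>w. 0) = 0"
  by (simp_all add: ip_def)

lemma ip_diff_right:
  assumes "x \<in> ell2 W" "y \<in> ell2 W'" "z \<in> ell2 W'"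
  shows "ip x (y - z) = ip x y - ip x z"
proof -
  have "y - z = y + (\<lambda>w. -1 * z w)" by (auto simp: fun_eq_iff)
  then show ?thesis
    by (simp only: ip_add_right[OF assms(1,2) ell2_scale[OF assms(3)]] ip_scale_right) simp
qed

section \<open>Norms, finite sections and the Riesz theorem\<close>

lemma ell2_norm_nonneg [simp]: "0 \<le> ell2_norm x"
  by (simp add: ell2_norm_def infsum_nonneg)

lemma ell2_norm_zero [simp]: "ell2_norm 0 = 0" "ell2_norm (\<lambda>w. 0) = 0"
  by (simp_all add: ell2_norm_def)

lemma ell2_norm_sq: "(ell2_norm x)\<^sup>2 = (\<Sum>\<^sub>\<infinity>w. (cmod (x w))\<^sup>2)"
  by (simp add: ell2_norm_def infsum_nonneg)

lemma ip_self:
  assumes "x \<in> ell2 W"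
  shows "ip x x = complex_of_real ((ell2_norm x)\<^sup>2)"
proof -
  have "((\<lambda>w. complex_of_real ((cmod (x w))\<^sup>2)) has_sum complex_of_real ((ell2_norm x)\<^sup>2)) UNIV"
    unfolding ell2_norm_sq using assms by (intro has_sum_of_real has_sum_infsum ell2_summable)
  moreover have "cnj (x w) * x w = complex_of_real ((cmod (x w))\<^sup>2)" for w
    by (metis complex_norm_square mult.commute)
  ultimately show ?thesis unfolding ip_def by (simp add: infsumI)
qed

lemma ell2_norm_scale: "ell2_norm (\<lambda>w. a * x w) = cmod a * ell2_norm x"
  by (simp add: ell2_norm_def norm_mult power_mult_distrib infsum_cmult_right' real_sqrt_mult)

text \<open>With \<open>ell2_norm_le\<close> and \<open>ell2_boundedI\<close> this moves norm
  questions to finite sections, where the triangle and product inequalities for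
  \<open>L2_set\<close> apply.\<close>

lemma L2_set_le_ell2_norm:
  assumes "x \<in> ell2 W" "finite F"
  shows "L2_set (\<lambda>w. cmod (x w)) F \<le> ell2_norm x"
  unfolding L2_set_def ell2_norm_def
  using finite_sum_le_infsum[OF ell2_summable[OF assms(1)] assms(2)] by auto

lemma ell2_norm_le:
  assumes "x \<in> ell2 W" "\<And>F. finite F \<Longrightarrow> L2_set (\<lambda>w. cmod (x w)) F \<le> K"
  shows "ell2_norm x \<le> K"
proof -
  have K: "K \<ge> 0" using assms(2)[of "{}"] by simp
  have "(\<Sum>\<^sub>\<infinity>w. (cmod (x w))\<^sup>2) \<le> K\<^sup>2"
  proof (rule infsum_le_finite_sums[OF ell2_summable[OF assms(1)]])
    fix F :: "'a set" assume "finite F"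
    from assms(2)[OF this] show "(\<Sum>w\<in>F. (cmod (x w))\<^sup>2) \<le> K\<^sup>2"
      unfolding L2_set_def by (rule sqrt_le_D)
  qed
  then show ?thesis using K by (simp add: ell2_norm_def real_le_lsqrt infsum_nonneg)
qed

lemma ell2_boundedI:
  assumes "\<And>w. w \<notin> W \<Longrightarrow> x w = 0" "\<And>F. finite F \<Longrightarrow> L2_set (\<lambda>w. cmod (x w)) F \<le> K"
  shows "x \<in> ell2 W"
proof -
  have "(\<lambda>w. (cmod (x w))\<^sup>2) summable_on UNIV"
  proof (rule nonneg_bdd_above_summable_on)
    show "bdd_above (sum (\<lambda>w. (cmod (x w))\<^sup>2) ` {F. F \<subseteq> UNIV \<and> finite F})"
    proof (rule bdd_aboveI2)
      fix F :: "'a set" assume "F \<in> {F. F \<subseteq> UNIV \<and> finite F}"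
      then have "L2_set (\<lambda>w. cmod (x w)) F \<le> K" using assms(2) by blast
      then show "sum (\<lambda>w. (cmod (x w))\<^sup>2) F \<le> K\<^sup>2"
        unfolding L2_set_def by (rule sqrt_le_D)
    qed
  qed auto
  with assms(1) show ?thesis by (simp add: ell2_def)
qed

lemma ell2_norm_coord_le:
  assumes "x \<in> ell2 W"
  shows "cmod (x w) \<le> ell2_norm x"
  using L2_set_le_ell2_norm[OF assms, of "{w}"] by simp

lemma ell2_norm_eq_0:
  assumes "x \<in> ell2 W" "ell2_norm x = 0"
  shows "x = 0"
  using ell2_norm_coord_le[OF assms(1)] assms(2) by (auto simp: fun_eq_iff)

lemma ell2_norm_triangle:
  assumes "x \<in> ell2 W" "y \<in> ell2 W"
  shows "ell2_norm (x + y) \<le> ell2_norm x + ell2_norm y"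
proof (rule ell2_norm_le[OF ell2_add[OF assms]])
  fix F :: "'a set" assume F: "finite F"
  have "L2_set (\<lambda>w. cmod ((x + y) w)) F \<le> L2_set (\<lambda>w. cmod (x w) + cmod (y w)) F"
    by (intro L2_set_mono) (auto intro: norm_triangle_ineq)
  also have "\<dots> \<le> L2_set (\<lambda>w. cmod (x w)) F + L2_set (\<lambda>w. cmod (y w)) F"
    by (rule L2_set_triangle_ineq)
  also have "\<dots> \<le> ell2_norm x + ell2_norm y"
    using L2_set_le_ell2_norm[OF assms(1) F] L2_set_le_ell2_norm[OF assms(2) F] by simp
  finally show "L2_set (\<lambda>w. cmod ((x + y) w)) F \<le> ell2_norm x + ell2_norm y" .
qed

lemma ip_Cauchy_Schwarz:
  assumes "x \<in> ell2 W" "y \<in> ell2 W'"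
  shows "cmod (ip x y) \<le> ell2_norm x * ell2_norm y"
proof -
  have s: "(\<lambda>w. cnj (x w) * y w) abs_summable_on UNIV"
    using assms by (rule ell2_mult_abs_summable)
  have "cmod (ip x y) \<le> (\<Sum>\<^sub>\<infinity>w. cmod (cnj (x w) * y w))"
    unfolding ip_def by (rule norm_infsum_bound[OF s])
  also have "\<dots> \<le> ell2_norm x * ell2_norm y"
  proof (rule infsum_le_finite_sums[OF s])
    fix F :: "'a set" assume F: "finite F"
    have "(\<Sum>w\<in>F. cmod (cnj (x w) * y w)) \<le> L2_set (\<lambda>w. cmod (x w)) F * L2_set (\<lambda>w. cmod (y w)) F"
      using L2_set_mult_ineq[of "\<lambda>w. cmod (x w)" "\<lambda>w. cmod (y w)" F] by (simp add: norm_mult)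
    also have "\<dots> \<le> ell2_norm x * ell2_norm y"
      by (intro mult_mono L2_set_le_ell2_norm[OF assms(1) F] L2_set_le_ell2_norm[OF assms(2) F]) auto
    finally show "(\<Sum>w\<in>F. cmod (cnj (x w) * y w)) \<le> ell2_norm x * ell2_norm y" .
  qed
  finally show ?thesis .
qed

text \<open>Finitely supported vectors are dense. The discarded tail is kept as a vector, so that
  functionals can be applied to it.\<close>

lemma ell2_truncation:
  assumes "x \<in> ell2 W" "\<epsilon> > 0"
  obtains F where "finite F" "ell2_norm (\<lambda>w. if w \<in> F then 0 else x w) < \<epsilon>"
proof -
  have s: "(\<lambda>w. (cmod (x w))\<^sup>2) summable_on UNIV" using assms by (auto simp: ell2_def)
  obtain F where F: "finite F" "dist (\<Sum>w\<in>F. (cmod (x w))\<^sup>2) (\<Sum>\<^sub>\<infinity>w. (cmod (x w))\<^sup>2) \<le> \<epsilon>\<^sup>2 / 2"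
    using infsum_finite_approximation[OF s, of "\<epsilon>\<^sup>2/2"] assms(2) by auto
  have "(\<Sum>\<^sub>\<infinity>w. (cmod (x w))\<^sup>2) = (\<Sum>\<^sub>\<infinity>w\<in>F. (cmod (x w))\<^sup>2) + (\<Sum>\<^sub>\<infinity>w\<in>- F. (cmod (x w))\<^sup>2)"
    using infsum_Un_disjoint[of "\<lambda>w. (cmod (x w))\<^sup>2" "F" "- F"] F(1)
      summable_on_subset_banach[OF s, of "- F"] by simp
  moreover have "(\<Sum>\<^sub>\<infinity>w\<in>- F. (cmod (x w))\<^sup>2) = (\<Sum>\<^sub>\<infinity>w. (cmod (if w \<in> F then 0 else x w))\<^sup>2)"
    by (intro infsum_cong_neutral) auto
  ultimately have "(\<Sum>\<^sub>\<infinity>w. (cmod (if w \<in> F then 0 else x w))\<^sup>2) \<le> \<epsilon>\<^sup>2 / 2"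
    using F by (simp add: dist_real_def)
  also have "\<dots> < \<epsilon>\<^sup>2" using assms(2) by simp
  finally have "ell2_norm (\<lambda>w. if w \<in> F then 0 else x w) < \<epsilon>"
    unfolding ell2_norm_def using assms(2) by (intro real_less_lsqrt) (auto intro: infsum_nonneg)
  with F(1) that show thesis by blast
qed

text \<open>The representing vector is forced: its coordinate at \<open>w\<close> is the conjugate
  of \<open>f (e w)\<close>. The bound on \<open>f\<close> makes these coordinates square-summable,
  and density of the finitely supported vectors extends the formula to all of
  \<open>ell2 W\<close>.\<close>

theorem ell2_Riesz:
  fixes f :: "('w \<Rightarrow> complex) \<Rightarrow> complex"
  assumes add: "\<And>x y. x \<in> ell2 W \<Longrightarrow> y \<in> ell2 W \<Longrightarrow> f (x + y) = f x + f y"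
    and scale: "\<And>a x. x \<in> ell2 W \<Longrightarrow> f (\<lambda>w. a * x w) = a * f x"
    and bound: "\<And>x. x \<in> ell2 W \<Longrightarrow> cmod (f x) \<le> K * ell2_norm x"
  shows "\<exists>z\<in>ell2 W. \<forall>x\<in>ell2 W. f x = ip z x"
proof -
  define e :: "'w \<Rightarrow> 'w \<Rightarrow> complex" where "e v = (\<lambda>w. if w = v then 1 else 0)" for v
  define z where "z w = (if w \<in> W then cnj (f (e w)) else 0)" for w
  have fin: "f (\<lambda>w. if w \<in> F then x w else 0) = (\<Sum>w\<in>F. cnj (z w) * x w)"
    if "finite F" "x \<in> ell2 W" for F x
    using that(1)
  proof induction
    case empty
    show ?case using scale[of 0 0] by simp
  next
    case (insert v F)
    have 1: "(\<lambda>w. if w \<in> F then x w else 0) \<in> ell2 W"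
      using insert.hyps(1) ell2_off[OF that(2)] by (intro ell2_finite_support[of F]) auto
    have 2: "(\<lambda>w. x v * e v w) \<in> ell2 W"
      using ell2_off[OF that(2)] by (intro ell2_finite_support[of "{v}"]) (auto simp: e_def)
    have 3: "f (\<lambda>w. x v * e v w) = cnj (z v) * x v"
    proof (cases "v \<in> W")
      case True
      then have "e v \<in> ell2 W" by (intro ell2_finite_support[of "{v}"]) (auto simp: e_def)
      from scale[OF this, of "x v"] True show ?thesis by (simp add: z_def)
    next
      case False
      then have "x v = 0" using ell2_off[OF that(2)] by blast
      then show ?thesis using scale[of 0 0] by simp
    qed
    have "(\<lambda>w. if w \<in> insert v F then x w else 0) =
        (\<lambda>w. x v * e v w) + (\<lambda>w. if w \<in> F then x w else 0)"
      using insert.hyps(2) by (auto simp: fun_eq_iff e_def)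
    then show ?case using add[OF 2 1] insert 3 by simp
  qed
  have z: "z \<in> ell2 W"
  proof (rule ell2_boundedI)
    fix F :: "'w set" assume F: "finite F"
    \<comment> \<open>On the truncation of \<open>z\<close> to \<open>F\<close> the functional
      returns the squared norm of that section, while the hypothesis allows at most \<open>K\<close>
      times the norm; cancelling one factor bounds the section by \<open>K\<close>.\<close>
    define x where "x w = (if w \<in> F then z w else 0)" for w
    have x: "x \<in> ell2 W"
      using F by (intro ell2_finite_support[of F]) (auto simp: x_def z_def)
    have "f (\<lambda>w. if w \<in> F then x w else 0) = (\<Sum>w\<in>F. cnj (z w) * x w)" by (rule fin[OF F x])
    moreover have "(\<lambda>w. if w \<in> F then x w else 0) = x" by (auto simp: x_def)
    moreover have "(\<Sum>w\<in>F. cnj (z w) * x w) = complex_of_real (\<Sum>w\<in>F. (cmod (z w))\<^sup>2)"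
      unfolding of_real_sum by (intro sum.cong) (auto simp: x_def mult.commute complex_norm_square[unfolded of_real_power])
    moreover have nx: "ell2_norm x = L2_set (\<lambda>w. cmod (z w)) F"
    proof -
      have "(\<Sum>\<^sub>\<infinity>w. (cmod (x w))\<^sup>2) = (\<Sum>\<^sub>\<infinity>w\<in>F. (cmod (z w))\<^sup>2)"
        by (intro infsum_cong_neutral) (auto simp: x_def)
      then show ?thesis using F by (simp add: ell2_norm_def L2_set_def)
    qed
    ultimately have "cmod (complex_of_real (\<Sum>w\<in>F. (cmod (z w))\<^sup>2)) \<le> K * L2_set (\<lambda>w. cmod (z w)) F"
      using bound[OF x] by simp
    moreover have "(\<Sum>w\<in>F. (cmod (z w))\<^sup>2) = (L2_set (\<lambda>w. cmod (z w)) F)\<^sup>2"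
      by (simp add: L2_set_def sum_nonneg)
    ultimately have *: "(L2_set (\<lambda>w. cmod (z w)) F)\<^sup>2 \<le> K * L2_set (\<lambda>w. cmod (z w)) F"
      by (simp add: norm_power)
    \<comment> \<open>The sign of \<open>K\<close> is not known; a vanishing section is bounded by 0
      instead.\<close>
    then show "L2_set (\<lambda>w. cmod (z w)) F \<le> max K 0"
    proof (cases "L2_set (\<lambda>w. cmod (z w)) F = 0")
      case False
      then have "L2_set (\<lambda>w. cmod (z w)) F > 0" using L2_set_nonneg[of "\<lambda>w. cmod (z w)" F] by linarith
      with * show ?thesis by (simp add: power2_eq_square)
    qed simp
  qed (simp add: z_def)
  have "f x = ip z x" if x: "x \<in> ell2 W" for x
  proof -
    have "cmod (f x - ip z x) \<le> 0 + \<delta>" if "\<delta> > 0" for \<delta>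
    proof -
      define \<epsilon> where "\<epsilon> = \<delta> / (\<bar>K\<bar> + ell2_norm z + 1)"
      have pos: "\<bar>K\<bar> + ell2_norm z + 1 > 0" using ell2_norm_nonneg[of z] by linarith
      then have "\<epsilon> > 0" using that by (simp add: \<epsilon>_def)
      obtain F where F: "finite F" "ell2_norm (\<lambda>w. if w \<in> F then 0 else x w) < \<epsilon>"
        using ell2_truncation[OF x \<open>\<epsilon> > 0\<close>] .
      define u where "u = (\<lambda>w. if w \<in> F then x w else 0)"
      define v where "v = (\<lambda>w. if w \<in> F then 0 else x w)"
      have u: "u \<in> ell2 W"
        using F ell2_off[OF x] by (intro ell2_finite_support[of F]) (auto simp: u_def)
      have "v = x - u" by (auto simp: u_def v_def)
      then have v: "v \<in> ell2 W" using x u by auto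
      have xuv: "x = u + v" by (auto simp: u_def v_def)
      have "ip z u = (\<Sum>\<^sub>\<infinity>w\<in>F. cnj (z w) * x w)"
        unfolding ip_def by (intro infsum_cong_neutral) (auto simp: u_def)
      then have "f u = ip z u" using fin[OF F(1) x] F(1) by (simp add: u_def)
      then have "f x - ip z x = f v - ip z v"
        unfolding xuv using add[OF u v] ip_add_right[OF z u v] by simp
      also have "cmod \<dots> \<le> cmod (f v) + cmod (ip z v)" by (rule norm_triangle_ineq4)
      also have "\<dots> \<le> K * ell2_norm v + ell2_norm z * ell2_norm v"
        by (intro add_mono bound[OF v] ip_Cauchy_Schwarz[OF z v])
      also have "\<dots> \<le> (\<bar>K\<bar> + ell2_norm z + 1) * ell2_norm v"
        using mult_right_mono[OF abs_ge_self[of K] ell2_norm_nonneg[of v]] ell2_norm_nonneg[of v]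
        by (simp add: distrib_right del: ell2_norm_nonneg)
      also have "\<dots> \<le> (\<bar>K\<bar> + ell2_norm z + 1) * \<epsilon>"
        using F(2) pos by (intro mult_left_mono) (auto simp: v_def)
      also have "\<dots> = \<delta>" using pos by (simp add: \<epsilon>_def)
      finally show ?thesis by simp
    qed
    then have "cmod (f x - ip z x) \<le> 0" by (rule field_le_epsilon)
    then show ?thesis by simp
  qed
  with z show ?thesis by blast
qed

section \<open>The Fock module by columns\<close>

lemma ell2_finite_slices:
  fixes z :: "'a::finite \<times> 'w \<Rightarrow> complex"
  shows "z \<in> ell2 UNIV \<longleftrightarrow> (\<forall>a. (\<lambda>w. z (a, w)) \<in> ell2 UNIV)"
proof -
  have "(\<lambda>t. (cmod (z t))\<^sup>2) abs_summable_on (UNIV \<times> UNIV) \<longleftrightarrow>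
      (\<forall>a. (\<lambda>w. (cmod (z (a, w)))\<^sup>2) abs_summable_on UNIV)"
    unfolding Infinite_Sum.abs_summable_on_Sigma_iff by simp
  then show ?thesis by (simp add: ell2_def)
qed

lemma ip_finite_slices:
  fixes x y :: "'a::finite \<times> 'w \<Rightarrow> complex"
  assumes "x \<in> ell2 UNIV" "y \<in> ell2 UNIV"
  shows "ip x y = (\<Sum>a\<in>UNIV. ip (\<lambda>w. x (a, w)) (\<lambda>w. y (a, w)))"
  using infsum_Sigma_banach[of "\<lambda>t. cnj (x t) * y t" UNIV "\<lambda>_. UNIV"] ip_summable[OF assms]
  by (simp add: ip_def)

text \<open>For nonnegative terms, summability over a product is iterated summability, and unordered
  summability over the naturals is ordinary convergence. This links \<open>ell2\<close> with the
  series used in \<open>fock\<close>.\<close>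

lemma ell2_nat_slices:
  fixes z :: "nat \<times> 'w \<Rightarrow> complex"
  shows "z \<in> ell2 UNIV \<longleftrightarrow> (\<forall>k. (\<lambda>w. z (k, w)) \<in> ell2 UNIV) \<and>
    summable (\<lambda>k. (ell2_norm (\<lambda>w. z (k, w)))\<^sup>2)"
proof -
  have "(\<lambda>t. (cmod (z t))\<^sup>2) abs_summable_on (UNIV \<times> UNIV) \<longleftrightarrow>
      (\<forall>k. (\<lambda>w. (cmod (z (k, w)))\<^sup>2) abs_summable_on UNIV) \<and>
      (\<lambda>k. (ell2_norm (\<lambda>w. z (k, w)))\<^sup>2) summable_on UNIV"
    unfolding Infinite_Sum.abs_summable_on_Sigma_iff by (simp add: ell2_norm_sq infsum_nonneg)
  then show ?thesis
    by (simp add: ell2_def summable_on_UNIV_nonneg_real_iff)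
qed

lemma ip_nat_slices:
  fixes x y :: "nat \<times> 'w \<Rightarrow> complex"
  assumes "x \<in> ell2 UNIV" "y \<in> ell2 UNIV"
  shows "(\<lambda>k. ip (\<lambda>w. x (k, w)) (\<lambda>w. y (k, w))) sums ip x y"
proof -
  have s: "(\<lambda>t. cnj (x t) * y t) summable_on (UNIV \<times> UNIV)"
    using ip_summable[OF assms] by simp
  have "(\<lambda>k. \<Sum>\<^sub>\<infinity>w. cnj (x (k, w)) * y (k, w)) summable_on UNIV"
    using s by (intro summable_on_Sigma_banach) (simp add: cond_case_prod_eta)
  moreover have "(\<Sum>\<^sub>\<infinity>k. \<Sum>\<^sub>\<infinity>w. cnj (x (k, w)) * y (k, w)) = (\<Sum>\<^sub>\<infinity>t. cnj (x t) * y t)"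
    using infsum_Sigma_banach[OF s] by simp
  ultimately have "((\<lambda>k. \<Sum>\<^sub>\<infinity>w. cnj (x (k, w)) * y (k, w)) has_sum (\<Sum>\<^sub>\<infinity>t. cnj (x t) * y t)) UNIV"
    by (simp add: has_sum_iff)
  then show ?thesis unfolding ip_def by (rule has_sum_imp_sums)
qed

lemma ell2_norm_nat_slices:
  fixes x :: "nat \<times> 'w \<Rightarrow> complex"
  assumes "x \<in> ell2 UNIV"
  shows "(\<lambda>k. (ell2_norm (\<lambda>w. x (k, w)))\<^sup>2) sums (ell2_norm x)\<^sup>2"
proof -
  have "(\<lambda>k. ip (\<lambda>w. x (k, w)) (\<lambda>w. x (k, w))) sums ip x x"
    by (rule ip_nat_slices[OF assms assms])
  moreover have "(\<lambda>w. x (k, w)) \<in> ell2 UNIV" for k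
    using assms ell2_nat_slices by blast
  ultimately show ?thesis
    by (simp only: ip_self[where W = UNIV] assms sums_of_real_iff)
qed

lemma ell2_bounded_mult:
  assumes "x \<in> ell2 W" "\<And>w. cmod (c w) \<le> K"
  shows "(\<lambda>w. c w * x w) \<in> ell2 W" "ell2_norm (\<lambda>w. c w * x w) \<le> K * ell2_norm x"
proof -
  have K: "K \<ge> 0" using assms(2) norm_ge_zero order_trans by blast
  have *: "L2_set (\<lambda>w. cmod (c w * x w)) F \<le> K * ell2_norm x" if "finite F" for F
  proof -
    have "L2_set (\<lambda>w. cmod (c w * x w)) F \<le> L2_set (\<lambda>w. K * cmod (x w)) F"
      by (intro L2_set_mono) (auto simp: norm_mult assms(2) mult_right_mono)
    also have "\<dots> \<le> K * ell2_norm x"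
      using K L2_set_le_ell2_norm[OF assms(1) that]
      by (simp add: L2_set_right_distrib[symmetric] mult_left_mono)
    finally show ?thesis .
  qed
  show "(\<lambda>w. c w * x w) \<in> ell2 W"
    by (rule ell2_boundedI[OF _ *]) (use ell2_off[OF assms(1)] in auto)
  then show "ell2_norm (\<lambda>w. c w * x w) \<le> K * ell2_norm x"
    using * by (rule ell2_norm_le)
qed

section \<open>Operator norms of matrices and entrywise series\<close>

lemma mat_norm_bound: "norm (M *v v) \<le> mat_norm M * norm (v :: complex ^ 'm::finite)"
  unfolding mat_norm_def by (rule onorm) (rule matrix_vector_mul_bounded_linear)

lemma mat_norm_le: "(\<And>v. norm (M *v v) \<le> K * norm v) \<Longrightarrow> mat_norm M \<le> K"
  unfolding mat_norm_def by (rule onorm_le)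

lemma mat_entry_le: "cmod (M $ p $ q) \<le> mat_norm M"
proof -
  have "M $ p $ q = (M *v axis q 1) $ p"
    by (simp add: matrix_vector_mult_def axis_def if_distrib cong: if_cong)
  also have "cmod \<dots> \<le> norm (M *v axis q 1)" by (rule Finite_Cartesian_Product.norm_nth_le)
  also have "\<dots> \<le> mat_norm M" using mat_norm_bound[of M "axis q 1"] by simp
  finally show ?thesis .
qed

text \<open>The Euclidean norm is monotone in each coordinate, so scaling every coordinate by at
  most \<open>K\<close> costs at most a factor \<open>K\<close>. Applied to the diagonal matrix
  \<open>fock_ip x x\<close>, this bounds \<open>fock_norm\<close> by the largest column
  norm.\<close>

lemma mat_norm_diag_le:
  assumes "\<And>p q. p \<noteq> q \<Longrightarrow> M $ p $ q = 0" "\<And>p. cmod (M $ p $ p) \<le> K"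
  shows "mat_norm M \<le> K"
proof (rule mat_norm_le)
  fix v :: "complex ^ 'a"
  have K: "K \<ge> 0" using assms(2) norm_ge_zero order_trans by blast
  have c: "(M *v v) $ p = M $ p $ p * v $ p" for p
  proof -
    have "(M *v v) $ p = (\<Sum>q\<in>UNIV. if q = p then M $ p $ p * v $ p else 0)"
      unfolding matrix_vector_mult_def vec_lambda_beta using assms(1)[of p] by (intro sum.cong) auto
    then show ?thesis by simp
  qed
  have "norm ((M *v v) $ p) \<le> norm ((K *\<^sub>R v) $ p)" for p
    unfolding c using assms(2)[of p] K by (simp add: norm_mult mult_right_mono)
  then have "norm (M *v v) \<le> norm (K *\<^sub>R v)"
    unfolding norm_vec_def by (intro L2_set_mono) auto
  then show "norm (M *v v) \<le> K * norm v" using K by simp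
qed

lemma sums_vecI:
  assumes "\<And>i. (\<lambda>k. f k $ i) sums s $ i"
  shows "f sums (s :: 'a::real_normed_vector ^ 'i)"
  using assms unfolding sums_def by (intro vec_tendstoI) simp

lemma summable_vecI:
  assumes "\<And>i. summable (\<lambda>k. f k $ i)"
  shows "summable (f :: nat \<Rightarrow> 'a::real_normed_vector ^ 'i)"
proof -
  have "f sums (\<chi> i. \<Sum>k. f k $ i)"
    using assms by (intro sums_vecI) (simp add: summable_sums)
  then show ?thesis by (rule sums_summable)
qed

section \<open>Columns as vectors of Hilbert spaces\<close>

definition mod_col :: "('n \<Rightarrow> 'n \<Rightarrow> 'w \<Rightarrow> complex) \<Rightarrow> 'n \<Rightarrow> 'n \<times> 'w \<Rightarrow> complex" where
  "mod_col x b = (\<lambda>(a, w). x a b w)"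

lemma mod_col_ell2:
  fixes x :: "'n::finite \<Rightarrow> 'n \<Rightarrow> 'w \<Rightarrow> complex"
  assumes "x \<in> mat_module W"
  shows "mod_col x b \<in> ell2 UNIV"
  unfolding ell2_finite_slices using assms by (auto simp: mod_col_def mat_module_def intro: ell2_subset)

lemma mod_ip_col:
  assumes "x \<in> mat_module W" "y \<in> mat_module W'"
  shows "mod_ip x y $ a $ b = (if a = b then ip (mod_col x b) (mod_col y b) else 0)"
  using ip_finite_slices[OF mod_col_ell2[OF assms(1), of b] mod_col_ell2[OF assms(2), of b]]
  by (simp add: mod_ip_def mod_col_def)

text \<open>A column is a vector of an ordinary Hilbert space, with one coordinate for each degree,
  row and word. By \<open>fock_ip_col\<close> the inner products of the columns are the diagonal
  entries of \<open>fock_ip\<close>.\<close>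

definition fock_col :: "'n fock_vec \<Rightarrow> 'n \<Rightarrow> nat \<times> 'n \<times> (nat \<times> 'n) list \<Rightarrow> complex" where
  "fock_col x b = (\<lambda>(k, a, w). x k a b w)"

definition fock_index :: "enat ^ 'n ^ 'n \<Rightarrow> 'n \<Rightarrow> (nat \<times> 'n \<times> (nat \<times> 'n) list) set" where
  "fock_index C b = {(k, a, w). w \<in> tpow_index C k a b}"

lemma fock_col_slice: "(\<lambda>t. fock_col x b (k, t)) = mod_col (x k) b"
  by (auto simp: fock_col_def mod_col_def)

lemma fock_col_add: "fock_col (x + y) b = fock_col x b + fock_col y b"
  by (auto simp: fock_col_def fun_eq_iff)

lemma fock_col_diff: "fock_col (x - y) b = fock_col x b - fock_col y b"
  by (auto simp: fock_col_def fun_eq_iff)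

lemma fock_col_zero [simp]: "fock_col 0 b = 0"
  by (auto simp: fock_col_def fun_eq_iff)

lemma fock_col_right_act: "fock_col (\<lambda>k. right_act (x k) D) b = (\<lambda>t. D $ b $ b * fock_col x b t)"
  by (auto simp: fock_col_def right_act_def)

lemma fock_col_scale: "fock_col (\<lambda>k i j w. a * x k i j w) b = (\<lambda>t. a * fock_col x b t)"
  by (auto simp: fock_col_def)

lemma fock_col_left_act:
  "fock_col (\<lambda>k. left_act D (x k)) b = (\<lambda>t. D $ fst (snd t) $ fst (snd t) * fock_col x b t)"
  by (auto simp: fock_col_def left_act_def)

lemma fock_col_inject: "(\<And>b. fock_col x b = fock_col y b) \<Longrightarrow> x = y"
  unfolding fock_col_def by (auto simp: fun_eq_iff)

text \<open>The series in \<open>fock\<close> has matrix terms that vanish off the diagonal and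
  carry the squared column norms on it, so it converges exactly when each column is square-summable
  over all degrees.\<close>

lemma fock_alt: "x \<in> fock C \<longleftrightarrow> (\<forall>k. x k \<in> tpow C k) \<and> (\<forall>b. fock_col x b \<in> ell2 UNIV)"
proof -
  have "summable (\<lambda>k. mod_ip (x k) (x k)) \<longleftrightarrow> (\<forall>b. fock_col x b \<in> ell2 UNIV)"
    if t: "\<forall>k. x k \<in> tpow C k"
  proof -
    have m: "mod_ip (x k) (x k) $ a $ b =
        (if a = b then complex_of_real ((ell2_norm (mod_col (x k) b))\<^sup>2) else 0)" for k a b
    proof -
      have "x k \<in> mat_module (tpow_index C k)" using t by (simp add: tpow_def)
      then show ?thesis
        using mod_ip_col[of "x k" "tpow_index C k" "x k" "tpow_index C k" a b]
          ip_self[OF mod_col_ell2[of "x k" "tpow_index C k" b]] by simp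
    qed
    have "summable (\<lambda>k. mod_ip (x k) (x k)) \<longleftrightarrow> (\<forall>a b. summable (\<lambda>k. mod_ip (x k) (x k) $ a $ b))"
    proof
      show "summable (\<lambda>k. mod_ip (x k) (x k))"
        if "\<forall>a b. summable (\<lambda>k. mod_ip (x k) (x k) $ a $ b)"
        using that by (intro summable_vecI) blast
    qed (intro allI summable_vec_nth)
    also have "\<dots> \<longleftrightarrow> (\<forall>b. summable (\<lambda>k. (ell2_norm (mod_col (x k) b))\<^sup>2))"
    proof -
      have "summable (\<lambda>k. mod_ip (x k) (x k) $ a $ b) \<longleftrightarrow>
          (a = b \<longrightarrow> summable (\<lambda>k. (ell2_norm (mod_col (x k) b))\<^sup>2))" for a b
        unfolding m by (cases "a = b") (simp_all add: summable_of_real_iff del: of_real_power)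
      then show ?thesis by blast
    qed
    also have "\<dots> \<longleftrightarrow> (\<forall>b. fock_col x b \<in> ell2 UNIV)"
      unfolding ell2_nat_slices fock_col_slice using t mod_col_ell2 by (auto simp: tpow_def)
    finally show ?thesis .
  qed
  then show ?thesis by (auto simp: fock_def)
qed

text \<open>The support condition moves into the index set. Membership then depends on the columns
  alone, and the closure properties of \<open>fock\<close> are those of \<open>ell2\<close>.\<close>

lemma fock_iff: "x \<in> fock C \<longleftrightarrow> (\<forall>b. fock_col x b \<in> ell2 (fock_index C b))"
proof
  assume x: "x \<in> fock C"
  show "\<forall>b. fock_col x b \<in> ell2 (fock_index C b)"
    unfolding ell2_iff[of _ "fock_index C _"]
  proof safe
    fix b k a w assume "(k, a, w) \<notin> fock_index C b"
    moreover have "x k a b \<in> ell2 (tpow_index C k a b)"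
      using x by (auto simp: fock_def tpow_def mat_module_def)
    ultimately show "fock_col x b (k, a, w) = 0"
      using ell2_off by (fastforce simp: fock_col_def fock_index_def)
  qed (use x in \<open>auto simp: fock_alt\<close>)
next
  assume *: "\<forall>b. fock_col x b \<in> ell2 (fock_index C b)"
  have "x k a b \<in> ell2 (tpow_index C k a b)" for k a b
  proof -
    have "fock_col x b \<in> ell2 UNIV" using * ell2_subset by blast
    then have "(\<lambda>t. fock_col x b (k, t)) \<in> ell2 UNIV"
      using ell2_nat_slices[of "fock_col x b"] by blast
    then have "(\<lambda>w. fock_col x b (k, a, w)) \<in> ell2 UNIV"
      using ell2_finite_slices[of "\<lambda>t. fock_col x b (k, t)"] by blast
    then have "x k a b \<in> ell2 UNIV" by (simp add: fock_col_def)
    moreover have "x k a b w = 0" if "w \<notin> tpow_index C k a b" for w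
      using *[rule_format, of b, THEN ell2_off, of "(k, a, w)"] that
      by (simp add: fock_col_def fock_index_def)
    ultimately show ?thesis using ell2_iff by blast
  qed
  then show "x \<in> fock C"
    unfolding fock_alt using ell2_subset[OF *[rule_format]] by (auto simp: tpow_def mat_module_def)
qed

lemma fock_col_ell2: "x \<in> fock C \<Longrightarrow> fock_col x b \<in> ell2 (fock_index C b)"
  by (simp add: fock_iff)

lemma fock_tpow: "x \<in> fock C \<Longrightarrow> x k \<in> tpow C k"
  by (simp add: fock_def)

lemma fock_of_columns:
  assumes "\<And>b. v b \<in> ell2 (fock_index C b)"
  obtains x where "x \<in> fock C" "\<And>b. fock_col x b = v b"
proof -
  define x where "x = (\<lambda>k a b w. v b (k, a, w))"
  have c: "fock_col x b = v b" for b by (auto simp: x_def fock_col_def)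
  then have "x \<in> fock C" using assms by (simp add: fock_iff)
  with c that show thesis by blast
qed

lemma fock_ip_sums:
  assumes "x \<in> fock C" "y \<in> fock C"
  shows "(\<lambda>k. ip (mod_col (x k) b) (mod_col (y k) b)) sums ip (fock_col x b) (fock_col y b)"
  using ip_nat_slices[of "fock_col x b" "fock_col y b"] fock_col_ell2[OF assms(1)]
    fock_col_ell2[OF assms(2)] ell2_subset unfolding fock_col_slice by blast

lemma fock_ip_col:
  assumes "x \<in> fock C" "y \<in> fock C"
  shows "fock_ip x y $ a $ b = (if a = b then ip (fock_col x b) (fock_col y b) else 0)"
proof -
  have "(\<lambda>k. mod_ip (x k) (y k)) sums
      (\<chi> a b. if a = b then ip (fock_col x b) (fock_col y b) else 0)"
  proof (intro sums_vecI)
    fix a b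
    have "mod_ip (x k) (y k) $ a $ b = (if a = b then ip (mod_col (x k) b) (mod_col (y k) b) else 0)" for k
      using fock_tpow[OF assms(1)] fock_tpow[OF assms(2)] by (intro mod_ip_col) (auto simp: tpow_def)
    then show "(\<lambda>k. mod_ip (x k) (y k) $ a $ b) sums
        (\<chi> a b. if a = b then ip (fock_col x b) (fock_col y b) else 0) $ a $ b"
      using fock_ip_sums[OF assms, of b] by simp
  qed
  then show ?thesis by (simp add: fock_ip_def sums_iff)
qed

lemma fock_ip_eq_iff:
  assumes "x \<in> fock C" "y \<in> fock C" "x' \<in> fock C" "y' \<in> fock C"
  shows "fock_ip x y = fock_ip x' y' \<longleftrightarrow>
    (\<forall>b. ip (fock_col x b) (fock_col y b) = ip (fock_col x' b) (fock_col y' b))"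
  by (auto simp: vec_eq_iff fock_ip_col[OF assms(1,2)] fock_ip_col[OF assms(3,4)])

lemma fock_zero [simp]: "0 \<in> fock C"
  by (simp add: fock_iff)

lemma fock_add: "x \<in> fock C \<Longrightarrow> y \<in> fock C \<Longrightarrow> x + y \<in> fock C"
  by (simp add: fock_iff fock_col_add ell2_add)

lemma fock_diff: "x \<in> fock C \<Longrightarrow> y \<in> fock C \<Longrightarrow> x - y \<in> fock C"
  by (simp add: fock_iff fock_col_diff ell2_diff)

lemma fock_right_act: "x \<in> fock C \<Longrightarrow> (\<lambda>k. right_act (x k) D) \<in> fock C"
  by (simp add: fock_iff fock_col_right_act ell2_scale)

lemma fock_scale: "x \<in> fock C \<Longrightarrow> (\<lambda>k i j w. a * x k i j w) \<in> fock C"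
  by (simp add: fock_iff fock_col_scale ell2_scale)

lemma fock_left_act:
  assumes "x \<in> fock C"
  shows "(\<lambda>k. left_act D (x k)) \<in> fock C"
    and "ell2_norm (fock_col (\<lambda>k. left_act D (x k)) b) \<le> (\<Sum>i\<in>UNIV. cmod (D $ i $ i)) * ell2_norm (fock_col x b)"
proof -
  have *: "cmod (D $ fst (snd t) $ fst (snd t)) \<le> (\<Sum>i\<in>UNIV. cmod (D $ i $ i))"
    for t :: "nat \<times> 'a \<times> (nat \<times> 'a) list"
    by (intro member_le_sum[where f = "\<lambda>i. cmod (D $ i $ i)"]) auto
  note b = ell2_bounded_mult[OF fock_col_ell2[OF assms],
      where c = "\<lambda>t. D $ fst (snd t) $ fst (snd t)", OF *]
  show "(\<lambda>k. left_act D (x k)) \<in> fock C"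
    unfolding fock_iff fock_col_left_act using b(1) by blast
  show "ell2_norm (fock_col (\<lambda>k. left_act D (x k)) b) \<le> (\<Sum>i\<in>UNIV. cmod (D $ i $ i)) * ell2_norm (fock_col x b)"
    unfolding fock_col_left_act by (rule b(2))
qed

lemma fock_norm_col_le:
  assumes "x \<in> fock C"
  shows "ell2_norm (fock_col x b) \<le> fock_norm x"
proof -
  have "(ell2_norm (fock_col x b))\<^sup>2 = cmod (fock_ip x x $ b $ b)"
    by (simp add: fock_ip_col[OF assms assms] ip_self[OF fock_col_ell2[OF assms]] norm_power)
  also have "\<dots> \<le> mat_norm (fock_ip x x)" by (rule mat_entry_le)
  finally show ?thesis unfolding fock_norm_def by (rule real_le_rsqrt)
qed

text \<open>Together with \<open>fock_norm_col_le\<close> this identifies \<open>fock_norm\<close>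
  with the maximum of the column norms.\<close>

lemma fock_norm_le:
  assumes "x \<in> fock C" "\<And>b. ell2_norm (fock_col x b) \<le> K"
  shows "fock_norm x \<le> K"
proof -
  have K: "K \<ge> 0" using assms(2) ell2_norm_nonneg order_trans by blast
  have "mat_norm (fock_ip x x) \<le> K\<^sup>2"
  proof (rule mat_norm_diag_le)
    show "cmod (fock_ip x x $ b $ b) \<le> K\<^sup>2" for b
      using power_mono[OF assms(2)[of b] ell2_norm_nonneg, of 2]
      by (simp add: fock_ip_col[OF assms(1,1)] ip_self[OF fock_col_ell2[OF assms(1)]] norm_power)
  qed (simp add: fock_ip_col[OF assms(1,1)])
  then show ?thesis unfolding fock_norm_def using K by (simp add: real_le_lsqrt)
qed

lemma fock_norm_nonneg: "x \<in> fock C \<Longrightarrow> 0 \<le> fock_norm x"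
  using fock_norm_col_le ell2_norm_nonneg order_trans by blast

lemma fock_norm_eq_0:
  assumes "x \<in> fock C" "fock_norm x = 0"
  shows "x = 0"
proof (rule fock_col_inject)
  fix b
  have "ell2_norm (fock_col x b) = 0"
    using fock_norm_col_le[OF assms(1), of b] assms(2) ell2_norm_nonneg[of "fock_col x b"] by linarith
  then show "fock_col x b = fock_col 0 b"
    using ell2_norm_eq_0[OF fock_col_ell2[OF assms(1)]] by simp
qed

lemma fock_norm_triangle:
  assumes "x \<in> fock C" "y \<in> fock C"
  shows "fock_norm (x + y) \<le> fock_norm x + fock_norm y"
proof (rule fock_norm_le[OF fock_add[OF assms]])
  fix b
  have "ell2_norm (fock_col (x + y) b) \<le> ell2_norm (fock_col x b) + ell2_norm (fock_col y b)"
    unfolding fock_col_add by (rule ell2_norm_triangle[OF fock_col_ell2[OF assms(1)] fock_col_ell2[OF assms(2)]])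
  then show "ell2_norm (fock_col (x + y) b) \<le> fock_norm x + fock_norm y"
    using fock_norm_col_le[OF assms(1), of b] fock_norm_col_le[OF assms(2), of b] by linarith
qed

lemma fock_norm_scale_le:
  assumes "x \<in> fock C"
  shows "fock_norm (\<lambda>k i j w. a * x k i j w) \<le> cmod a * fock_norm x"
  using fock_norm_col_le[OF assms]
  by (intro fock_norm_le[OF fock_scale[OF assms]])
     (auto simp: fock_col_scale ell2_norm_scale mult_left_mono)

lemma fock_eqI:
  assumes "x \<in> fock C" "y \<in> fock C"
    and "\<And>z b. z \<in> fock C \<Longrightarrow> ip (fock_col x b) (fock_col z b) = ip (fock_col y b) (fock_col z b)"
  shows "x = y"
proof (rule fock_col_inject)
  fix b
  note c = fock_col_ell2[OF assms(1), of b] fock_col_ell2[OF assms(2), of b]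
  let ?z = "fock_col x b - fock_col y b"
  have z: "?z \<in> ell2 (fock_index C b)" using c by blast
  \<comment> \<open>The difference itself serves as the test vector.\<close>
  have "ip (fock_col x b) ?z = ip (fock_col y b) ?z"
    using assms(3)[OF fock_diff[OF assms(1,2)], of b] by (simp add: fock_col_diff)
  then have "ip ?z (fock_col x b) = ip ?z (fock_col y b)" by (metis ip_cnj)
  then have "ip ?z ?z = 0" using ip_diff_right[OF z c] by simp
  then have "ell2_norm ?z = 0" by (simp add: ip_self[OF z])
  then have "?z = 0" using ell2_norm_eq_0[OF z] by blast
  then show "fock_col x b = fock_col y b" by (simp add: fun_eq_iff)
qed

section \<open>Adjointable operators and the tensor algebra\<close>

lemma adjointable_fock: "S \<in> adjointable_ops C \<Longrightarrow> x \<in> fock C \<Longrightarrow> S x \<in> fock C"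
  by (simp add: adjointable_ops_def)

lemma adjointable_off: "S \<in> adjointable_ops C \<Longrightarrow> x \<notin> fock C \<Longrightarrow> S x = 0"
  by (simp add: adjointable_ops_def)

lemma adjointable_adjoint:
  assumes "S \<in> adjointable_ops C"
  obtains S' where "\<And>y. y \<in> fock C \<Longrightarrow> S' y \<in> fock C"
    "\<And>x y b. x \<in> fock C \<Longrightarrow> y \<in> fock C \<Longrightarrow>
      ip (fock_col (S x) b) (fock_col y b) = ip (fock_col x b) (fock_col (S' y) b)"
proof -
  obtain S' where S': "\<forall>y\<in>fock C. S' y \<in> fock C"
      "\<forall>x\<in>fock C. \<forall>y\<in>fock C. fock_ip (S x) y = fock_ip x (S' y)"
    using assms by (auto simp: adjointable_ops_def)
  show thesis
  proof (rule that)
    show "S' y \<in> fock C" if "y \<in> fock C" for y using S' that by blast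
    show "ip (fock_col (S x) b) (fock_col y b) = ip (fock_col x b) (fock_col (S' y) b)"
      if "x \<in> fock C" "y \<in> fock C" for x y b
      using S' that fock_ip_eq_iff[of "S x" C y x "S' y"] adjointable_fock[OF assms that(1)] by blast
  qed
qed

text \<open>Additivity comes from the adjoint: both sides have the same inner product with every
  \<open>z\<close>. Right linearity is obtained in the same way.\<close>

lemma adjointable_add:
  assumes "S \<in> adjointable_ops C" "x \<in> fock C" "y \<in> fock C"
  shows "S (x + y) = S x + S y"
proof -
  obtain S' where S': "\<And>y. y \<in> fock C \<Longrightarrow> S' y \<in> fock C"
    "\<And>x y b. x \<in> fock C \<Longrightarrow> y \<in> fock C \<Longrightarrow>
      ip (fock_col (S x) b) (fock_col y b) = ip (fock_col x b) (fock_col (S' y) b)"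
    using adjointable_adjoint[OF assms(1)] by blast
  note fS = adjointable_fock[OF assms(1)]
  show ?thesis
  proof (rule fock_eqI)
    fix z b assume z: "z \<in> fock C"
    show "ip (fock_col (S (x + y)) b) (fock_col z b) = ip (fock_col (S x + S y) b) (fock_col z b)"
      using ip_add_left[OF fock_col_ell2[OF fS[OF assms(2)]] fock_col_ell2[OF fS[OF assms(3)]] fock_col_ell2[OF z]]
        ip_add_left[OF fock_col_ell2[OF assms(2)] fock_col_ell2[OF assms(3)] fock_col_ell2[OF S'(1)[OF z]]]
      by (simp add: fock_col_add S'(2)[OF fock_add[OF assms(2,3)] z] S'(2)[OF assms(2) z] S'(2)[OF assms(3) z])
  qed (use assms fS in \<open>auto intro: fock_add\<close>)
qed

lemma adjointable_right_act:
  assumes "S \<in> adjointable_ops C" "x \<in> fock C"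
  shows "S (\<lambda>k. right_act (x k) D) = (\<lambda>k. right_act (S x k) D)"
proof -
  obtain S' where S': "\<And>y. y \<in> fock C \<Longrightarrow> S' y \<in> fock C"
    "\<And>x y b. x \<in> fock C \<Longrightarrow> y \<in> fock C \<Longrightarrow>
      ip (fock_col (S x) b) (fock_col y b) = ip (fock_col x b) (fock_col (S' y) b)"
    using adjointable_adjoint[OF assms(1)] by blast
  show ?thesis
  proof (rule fock_eqI)
    fix z b assume z: "z \<in> fock C"
    show "ip (fock_col (S (\<lambda>k. right_act (x k) D)) b) (fock_col z b) =
        ip (fock_col (\<lambda>k. right_act (S x k) D) b) (fock_col z b)"
      by (simp only: S'(2)[OF fock_right_act[OF assms(2)] z] fock_col_right_act ip_scale_left
          S'(2)[OF assms(2) z])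
  qed (use adjointable_fock[OF assms(1)] assms(2) in \<open>auto intro: fock_right_act\<close>)
qed

lemma adjointable_scale:
  assumes "S \<in> adjointable_ops C" "x \<in> fock C"
  shows "S (\<lambda>k i j w. a * x k i j w) = (\<lambda>k i j w. a * S x k i j w)"
  \<comment> \<open>\<open>right_act\<close> reads only diagonal entries, so the constant matrix
    acts as multiplication by \<open>a\<close>.\<close>
  using adjointable_right_act[OF assms, of "\<chi> p q. a"] by (simp add: right_act_def mult.commute)

lemma adjointable_zero:
  assumes "S \<in> adjointable_ops C"
  shows "S 0 = 0"
proof -
  have "(\<lambda>k i j w. 0 * (0::'a fock_vec) k i j w) = 0" by (auto simp: fun_eq_iff)
  moreover have "(\<lambda>k i j w. 0 * S 0 k i j w) = 0" by (auto simp: fun_eq_iff)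
  ultimately show ?thesis using adjointable_scale[OF assms fock_zero, of 0] by simp
qed

lemma op_norm_bdd:
  assumes "S \<in> adjointable_ops C"
  shows "bdd_above ((\<lambda>x. fock_norm (S x)) ` {x \<in> fock C. fock_norm x \<le> 1})"
proof -
  obtain K where K: "\<forall>x\<in>fock C. fock_norm (S x) \<le> K * fock_norm x"
    using assms by (auto simp: adjointable_ops_def)
  show ?thesis
  proof (rule bdd_aboveI2)
    fix x assume x: "x \<in> {x \<in> fock C. fock_norm x \<le> 1}"
    have "K * fock_norm x \<le> \<bar>K\<bar> * 1"
      using x by (intro mult_mono) (auto intro: fock_norm_nonneg)
    then show "fock_norm (S x) \<le> \<bar>K\<bar>" using K x by fastforce
  qed
qed

lemma op_norm_bound:
  assumes "S \<in> adjointable_ops C" "x \<in> fock C"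
  shows "fock_norm (S x) \<le> op_norm C S * fock_norm x"
proof (cases "fock_norm x = 0")
  case True
  then have "x = 0" using fock_norm_eq_0 assms(2) by blast
  then show ?thesis using adjointable_zero[OF assms(1)] True by simp
next
  case False
  then have pos: "fock_norm x > 0" using fock_norm_nonneg[OF assms(2)] by simp
  define r where "r = fock_norm x"
  define y :: "'a fock_vec" where "y = (\<lambda>k i j w. complex_of_real (1 / r) * x k i j w)"
  have y: "y \<in> fock C" unfolding y_def by (rule fock_scale[OF assms(2)])
  have "fock_norm y \<le> 1"
    using fock_norm_scale_le[OF assms(2), of "complex_of_real (1 / r)"] pos
    by (simp add: y_def r_def norm_divide)
  then have le: "fock_norm (S y) \<le> op_norm C S"
    unfolding op_norm_def using y by (intro cSUP_upper op_norm_bdd[OF assms(1)]) auto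
  have "(\<lambda>k i j w. complex_of_real r * y k i j w) = x"
    using pos by (auto simp: y_def r_def fun_eq_iff)
  then have "S x = (\<lambda>k i j w. complex_of_real r * S y k i j w)"
    using adjointable_scale[OF assms(1) y, of "complex_of_real r"] by simp
  then have "fock_norm (S x) \<le> r * fock_norm (S y)"
    using fock_norm_scale_le[OF adjointable_fock[OF assms(1) y], of "complex_of_real r"] pos
    by (simp add: r_def)
  also have "\<dots> \<le> r * op_norm C S" using le pos by (intro mult_left_mono) (auto simp: r_def)
  finally show ?thesis by (simp add: r_def mult.commute)
qed

lemma op_norm_nonneg:
  assumes "S \<in> adjointable_ops C"
  shows "0 \<le> op_norm C S"
proof -
  have "fock_norm (S 0) \<le> op_norm C S"
  proof -
    have "fock_norm (0::'a fock_vec) \<le> 0" by (rule fock_norm_le[OF fock_zero[of C]]) simp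
    then have "fock_norm (0::'a fock_vec) \<le> 1" by linarith
    with fock_zero[of C] have "0 \<in> {x \<in> fock C. fock_norm x \<le> 1}" by blast
    then show ?thesis
      unfolding op_norm_def by (rule cSUP_upper) (rule op_norm_bdd[OF assms])
  qed
  then show ?thesis using fock_norm_nonneg[OF adjointable_fock[OF assms fock_zero]] by simp
qed

lemma op_norm_le:
  assumes "\<And>x. x \<in> fock C \<Longrightarrow> fock_norm (S x) \<le> K * fock_norm x" "K \<ge> 0"
  shows "op_norm C S \<le> K"
  unfolding op_norm_def
proof (rule cSUP_least)
  have "fock_norm (0::'a fock_vec) \<le> 0" by (rule fock_norm_le[OF fock_zero[of C]]) simp
  then have "fock_norm (0::'a fock_vec) \<le> 1" by linarith
  with fock_zero[of C] show "{x \<in> fock C. fock_norm x \<le> 1} \<noteq> {}" by blast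
  fix x assume x: "x \<in> {x \<in> fock C. fock_norm x \<le> 1}"
  then have "fock_norm (S x) \<le> K * fock_norm x" using assms(1) by blast
  also have "\<dots> \<le> K * 1" using x assms(2) by (intro mult_left_mono) auto
  finally show "fock_norm (S x) \<le> K" by simp
qed

text \<open>By right linearity an adjointable operator acts on each column separately.\<close>

lemma op_norm_col_bound:
  assumes "S \<in> adjointable_ops C" "x \<in> fock C"
  shows "ell2_norm (fock_col (S x) b) \<le> op_norm C S * ell2_norm (fock_col x b)"
proof -
  define D :: "complex ^ 'a ^ 'a" where "D = (\<chi> p q. if q = b then 1 else 0)"
  define y where "y = (\<lambda>k. right_act (x k) D)"
  have y: "y \<in> fock C" unfolding y_def by (rule fock_right_act[OF assms(2)])
  have col: "fock_col y c = (if c = b then fock_col x b else 0)" for c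
    by (auto simp: y_def fock_col_right_act D_def fun_eq_iff)
  have ny: "fock_norm y \<le> ell2_norm (fock_col x b)"
    by (rule fock_norm_le[OF y]) (simp add: col)
  have "fock_col (S y) b = fock_col (S x) b"
    unfolding y_def adjointable_right_act[OF assms] fock_col_right_act by (simp add: D_def)
  then have "ell2_norm (fock_col (S x) b) \<le> fock_norm (S y)"
    using fock_norm_col_le[OF adjointable_fock[OF assms(1) y], of b] by simp
  also have "\<dots> \<le> op_norm C S * fock_norm y" by (rule op_norm_bound[OF assms(1) y])
  also have "\<dots> \<le> op_norm C S * ell2_norm (fock_col x b)"
    using ny op_norm_nonneg[OF assms(1)] by (rule mult_left_mono)
  finally show ?thesis .
qed

text \<open>Self-duality of the Fock module: the adjoint is obtained column by column from the Riesz
  representation theorem.\<close>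

lemma adjointableI:
  assumes fock: "\<And>x. x \<in> fock C \<Longrightarrow> S x \<in> fock C"
    and off: "\<And>x. x \<notin> fock C \<Longrightarrow> S x = 0"
    and add: "\<And>x y. x \<in> fock C \<Longrightarrow> y \<in> fock C \<Longrightarrow> S (x + y) = S x + S y"
    and act: "\<And>x D. x \<in> fock C \<Longrightarrow> S (\<lambda>k. right_act (x k) D) = (\<lambda>k. right_act (S x k) D)"
    and bound: "\<And>x. x \<in> fock C \<Longrightarrow> fock_norm (S x) \<le> K * fock_norm x"
  shows "S \<in> adjointable_ops C"
proof -
  define inj :: "'a \<Rightarrow> (nat \<times> 'a \<times> (nat \<times> 'a) list \<Rightarrow> complex) \<Rightarrow> 'a fock_vec"
    where "inj b v = (\<lambda>k a c w. if c = b then v (k, a, w) else 0)" for b v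
  have col: "fock_col (inj b v) c = (if c = b then v else 0)" for b c v
    by (auto simp: inj_def fock_col_def fun_eq_iff)
  have inj: "inj b v \<in> fock C" if "v \<in> ell2 (fock_index C b)" for b v
    using that by (simp add: fock_iff col)
  have inj_norm: "fock_norm (inj b v) \<le> ell2_norm v" if "v \<in> ell2 (fock_index C b)" for b v
    by (rule fock_norm_le[OF inj[OF that]]) (simp add: col)
  have inj_add: "inj b (v + w) = inj b v + inj b w" for b v w
    by (auto simp: inj_def fun_eq_iff)
  have inj_scale: "inj b (\<lambda>t. a * v t) = (\<lambda>k. right_act (inj b v k) (\<chi> p q. a))" for a b v
    by (auto simp: inj_def right_act_def fun_eq_iff)
  have inj_col: "inj b (fock_col x b) = (\<lambda>k. right_act (x k) (\<chi> p q. if q = b then 1 else 0))" for b x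
    by (auto simp: inj_def right_act_def fock_col_def fun_eq_iff)
  have "\<exists>z\<in>ell2 (fock_index C b). \<forall>v\<in>ell2 (fock_index C b).
      ip (fock_col y b) (fock_col (S (inj b v)) b) = ip z v" if y: "y \<in> fock C" for y b
  proof (rule ell2_Riesz[where K = "ell2_norm (fock_col y b) * \<bar>K\<bar>"])
    let ?f = "\<lambda>v. ip (fock_col y b) (fock_col (S (inj b v)) b)"
    note cy = fock_col_ell2[OF y, of b]
    have cS: "fock_col (S (inj b v)) b \<in> ell2 (fock_index C b)" if "v \<in> ell2 (fock_index C b)" for v
      by (rule fock_col_ell2[OF fock[OF inj[OF that]]])
    show "?f (v + w) = ?f v + ?f w" if "v \<in> ell2 (fock_index C b)" "w \<in> ell2 (fock_index C b)" for v w
      using ip_add_right[OF cy cS[OF that(1)] cS[OF that(2)]]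
      by (simp only: inj_add add[OF inj[OF that(1)] inj[OF that(2)]] fock_col_add)
    show "?f (\<lambda>t. a * v t) = a * ?f v" if "v \<in> ell2 (fock_index C b)" for a v
      by (simp only: inj_scale act[OF inj[OF that]] fock_col_right_act ip_scale_right vec_lambda_beta)
    show "cmod (?f v) \<le> ell2_norm (fock_col y b) * \<bar>K\<bar> * ell2_norm v"
      if v: "v \<in> ell2 (fock_index C b)" for v
    proof -
      have "ell2_norm (fock_col (S (inj b v)) b) \<le> fock_norm (S (inj b v))"
        by (rule fock_norm_col_le[OF fock[OF inj[OF v]]])
      also have "\<dots> \<le> K * fock_norm (inj b v)" by (rule bound[OF inj[OF v]])
      also have "\<dots> \<le> \<bar>K\<bar> * ell2_norm v"
        using inj_norm[OF v] fock_norm_nonneg[OF inj[OF v]] by (intro mult_mono) auto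
      finally have "ell2_norm (fock_col y b) * ell2_norm (fock_col (S (inj b v)) b) \<le>
          ell2_norm (fock_col y b) * (\<bar>K\<bar> * ell2_norm v)"
        by (rule mult_left_mono) simp
      then show ?thesis using ip_Cauchy_Schwarz[OF cy cS[OF v]] by (simp add: mult.assoc)
    qed
  qed
  then obtain Z where Z: "\<And>y b. y \<in> fock C \<Longrightarrow> Z y b \<in> ell2 (fock_index C b)"
    "\<And>y b v. y \<in> fock C \<Longrightarrow> v \<in> ell2 (fock_index C b) \<Longrightarrow>
      ip (fock_col y b) (fock_col (S (inj b v)) b) = ip (Z y b) v"
    by metis
  have "\<forall>y. \<exists>u. y \<in> fock C \<longrightarrow> u \<in> fock C \<and> (\<forall>b. fock_col u b = Z y b)"
  proof
    fix y show "\<exists>u. y \<in> fock C \<longrightarrow> u \<in> fock C \<and> (\<forall>b. fock_col u b = Z y b)"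
    proof (cases "y \<in> fock C")
      case True
      show ?thesis using fock_of_columns[OF Z(1)[OF True]] by metis
    qed simp
  qed
  from choice[OF this] obtain S' where
    S'': "\<forall>y. y \<in> fock C \<longrightarrow> S' y \<in> fock C \<and> (\<forall>b. fock_col (S' y) b = Z y b)" ..
  then have S': "\<And>y. y \<in> fock C \<Longrightarrow> S' y \<in> fock C"
    "\<And>y b. y \<in> fock C \<Longrightarrow> fock_col (S' y) b = Z y b"
    by simp_all
  have "fock_ip (S x) y = fock_ip x (S' y)" if x: "x \<in> fock C" and y: "y \<in> fock C" for x y
  proof -
    have "ip (fock_col (S x) b) (fock_col y b) = ip (fock_col x b) (fock_col (S' y) b)" for b
    proof -
      have "fock_col (S (inj b (fock_col x b))) b = fock_col (S x) b"
        unfolding inj_col act[OF x] fock_col_right_act by simp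
      then have "ip (fock_col y b) (fock_col (S x) b) = ip (fock_col (S' y) b) (fock_col x b)"
        using Z(2)[OF y fock_col_ell2[OF x], of b] S'(2)[OF y, of b] by simp
      then show ?thesis by (metis ip_cnj)
    qed
    then show ?thesis using fock_ip_eq_iff[OF fock[OF x] y x S'(1)[OF y]] by blast
  qed
  then show ?thesis
    unfolding adjointable_ops_def
    by (intro CollectI conjI ballI allI impI exI[of _ K] exI[of _ S']) (auto intro: fock off bound S'(1))
qed

text \<open>This bounds the hull from above and thus places \<open>tensor_algebra C\<close> inside
  \<open>adjointable_ops C\<close>. The closure clause speaks only of limits that are adjointable
  already, so the work lies in the adjoints: the sum, the reversed composition and the conjugate
  multiple.\<close>

lemma adjointable_ops_closed_subalgebra: "closed_subalgebra C (adjointable_ops C)"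
  unfolding closed_subalgebra_def
proof (intro conjI ballI allI impI)
  show "(0 :: 'a fock_op) \<in> adjointable_ops C"
  proof -
    have "fock_norm (0::'a fock_vec) = 0"
      using fock_norm_le[OF fock_zero[of C], of 0] fock_norm_nonneg[OF fock_zero[of C]] by simp
    moreover have "fock_ip 0 x = 0" "fock_ip x 0 = 0" if "x \<in> fock C" for x
      using fock_ip_col[OF fock_zero that] fock_ip_col[OF that fock_zero] by (auto simp: vec_eq_iff)
    ultimately show ?thesis unfolding adjointable_ops_def
      by (intro CollectI conjI exI[of _ 0] exI[of _ "\<lambda>_. 0"]) auto
  qed
next
  fix S T assume S: "S \<in> adjointable_ops C" and T: "T \<in> adjointable_ops C"
  obtain S' where S': "\<And>y. y \<in> fock C \<Longrightarrow> S' y \<in> fock C"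
    "\<And>x y b. x \<in> fock C \<Longrightarrow> y \<in> fock C \<Longrightarrow>
      ip (fock_col (S x) b) (fock_col y b) = ip (fock_col x b) (fock_col (S' y) b)"
    using adjointable_adjoint[OF S] by blast
  obtain T' where T': "\<And>y. y \<in> fock C \<Longrightarrow> T' y \<in> fock C"
    "\<And>x y b. x \<in> fock C \<Longrightarrow> y \<in> fock C \<Longrightarrow>
      ip (fock_col (T x) b) (fock_col y b) = ip (fock_col x b) (fock_col (T' y) b)"
    using adjointable_adjoint[OF T] by blast
  note fS = adjointable_fock[OF S] and fT = adjointable_fock[OF T]
  show "S + T \<in> adjointable_ops C"
    unfolding adjointable_ops_def
  proof (intro CollectI conjI ballI allI impI exI[of _ "op_norm C S + op_norm C T"] exI[of _ "\<lambda>y. S' y + T' y"])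
    fix x assume x: "x \<in> fock C"
    show "(S + T) x \<in> fock C" using fock_add[OF fS[OF x] fT[OF x]] by simp
    show "fock_norm ((S + T) x) \<le> (op_norm C S + op_norm C T) * fock_norm x"
      using fock_norm_triangle[OF fS[OF x] fT[OF x]] op_norm_bound[OF S x] op_norm_bound[OF T x]
      by (simp add: distrib_right)
    show "S' x + T' x \<in> fock C" by (intro fock_add S' T' x)
    fix y assume y: "y \<in> fock C"
    have "ip (fock_col ((S + T) x) b) (fock_col y b) = ip (fock_col x b) (fock_col (S' y + T' y) b)" for b
      using ip_add_left[OF fock_col_ell2[OF fS[OF x]] fock_col_ell2[OF fT[OF x]] fock_col_ell2[OF y]]
        ip_add_right[OF fock_col_ell2[OF x] fock_col_ell2[OF S'(1)[OF y]] fock_col_ell2[OF T'(1)[OF y]]]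
      by (simp add: fock_col_add S'(2)[OF x y] T'(2)[OF x y])
    then show "fock_ip ((S + T) x) y = fock_ip x (S' y + T' y)"
      using fock_ip_eq_iff[of "(S + T) x" C y x "S' y + T' y"] x y
        fock_add[OF fS[OF x] fT[OF x]] fock_add[OF S'(1)[OF y] T'(1)[OF y]] by simp
  qed (simp add: adjointable_off[OF S] adjointable_off[OF T])
  show "S \<circ> T \<in> adjointable_ops C"
    unfolding adjointable_ops_def
  proof (intro CollectI conjI ballI allI impI exI[of _ "op_norm C S * op_norm C T"] exI[of _ "\<lambda>y. T' (S' y)"])
    fix x assume x: "x \<in> fock C"
    show "(S \<circ> T) x \<in> fock C" using fS[OF fT[OF x]] by simp
    show "fock_norm ((S \<circ> T) x) \<le> (op_norm C S * op_norm C T) * fock_norm x"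
      using op_norm_bound[OF S fT[OF x]]
        mult_left_mono[OF op_norm_bound[OF T x] op_norm_nonneg[OF S]] by (simp add: mult.assoc)
    show "T' (S' x) \<in> fock C" by (intro S' T' x)
    fix y assume y: "y \<in> fock C"
    have "ip (fock_col ((S \<circ> T) x) b) (fock_col y b) = ip (fock_col x b) (fock_col (T' (S' y)) b)" for b
      by (simp add: S'(2)[OF fT[OF x] y] T'(2)[OF x S'(1)[OF y]])
    then show "fock_ip ((S \<circ> T) x) y = fock_ip x (T' (S' y))"
      using fock_ip_eq_iff[of "(S \<circ> T) x" C y x "T' (S' y)"] x y S'(1) T'(1) fS[OF fT[OF x]] by auto
  \<comment> \<open>Outside \<open>fock C\<close> the inner operator returns 0, and \<open>S\<close>
    has to send that 0 to 0.\<close>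
  qed (simp add: adjointable_off[OF T] adjointable_zero[OF S])
next
  fix a S assume S: "S \<in> adjointable_ops C"
  obtain S' where S': "\<And>y. y \<in> fock C \<Longrightarrow> S' y \<in> fock C"
    "\<And>x y b. x \<in> fock C \<Longrightarrow> y \<in> fock C \<Longrightarrow>
      ip (fock_col (S x) b) (fock_col y b) = ip (fock_col x b) (fock_col (S' y) b)"
    using adjointable_adjoint[OF S] by blast
  note fS = adjointable_fock[OF S]
  show "op_scale a S \<in> adjointable_ops C"
    unfolding adjointable_ops_def
  proof (intro CollectI conjI ballI allI impI exI[of _ "cmod a * op_norm C S"]
      exI[of _ "\<lambda>y k i j w. cnj a * S' y k i j w"])
    fix x assume x: "x \<in> fock C"
    show "op_scale a S x \<in> fock C" unfolding op_scale_def using fock_scale[OF fS[OF x]] .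
    show "fock_norm (op_scale a S x) \<le> (cmod a * op_norm C S) * fock_norm x"
      unfolding op_scale_def
      using fock_norm_scale_le[OF fS[OF x], of a]
        mult_left_mono[OF op_norm_bound[OF S x] norm_ge_zero[of a]] by (simp add: mult.assoc)
    show "(\<lambda>k i j w. cnj a * S' x k i j w) \<in> fock C" by (intro fock_scale S' x)
    fix y assume y: "y \<in> fock C"
    have "ip (fock_col (op_scale a S x) b) (fock_col y b) =
        ip (fock_col x b) (fock_col (\<lambda>k i j w. cnj a * S' y k i j w) b)" for b
      by (simp add: op_scale_def fock_col_scale ip_scale_left ip_scale_right S'(2)[OF x y])
    then show "fock_ip (op_scale a S x) y = fock_ip x (\<lambda>k i j w. cnj a * S' y k i j w)"
      using fock_ip_eq_iff[of "op_scale a S x" C y x] x y fock_scale[OF S'(1)[OF y]]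
        fock_scale[OF fS[OF x]] unfolding op_scale_def by blast
  qed (simp add: op_scale_def adjointable_off[OF S] fun_eq_iff)
qed auto

section \<open>The generators: left action and creation operators\<close>

lemma phi_inf_adjointable: "phi_inf C D \<in> adjointable_ops C"
proof (rule adjointableI)
  fix x y assume x: "x \<in> fock C"
  show "phi_inf C D x \<in> fock C" using fock_left_act(1)[OF x] x by (simp add: phi_inf_def)
  show "phi_inf C D (\<lambda>k. right_act (x k) D') = (\<lambda>k. right_act (phi_inf C D x k) D')" for D'
    using x fock_right_act[OF x, of D'] by (simp add: phi_inf_def left_act_def right_act_def mult.assoc)
  show "phi_inf C D (x + y) = phi_inf C D x + phi_inf C D y" if "y \<in> fock C"
    using x that fock_add[OF x that] by (auto simp: phi_inf_def left_act_def fun_eq_iff distrib_left)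
  have "ell2_norm (fock_col (phi_inf C D x) b) \<le> (\<Sum>i\<in>UNIV. cmod (D $ i $ i)) * fock_norm x" for b
    using fock_left_act(2)[OF x, of D b] x
      mult_left_mono[OF fock_norm_col_le[OF x, of b] sum_nonneg[of UNIV "\<lambda>i. cmod (D $ i $ i)"]]
    by (simp add: phi_inf_def)
  then show "fock_norm (phi_inf C D x) \<le> (\<Sum>i\<in>UNIV. cmod (D $ i $ i)) * fock_norm x"
    by (rule fock_norm_le[OF \<open>phi_inf C D x \<in> fock C\<close>])
qed (simp add: phi_inf_def)

lemma E_ell2: "\<xi> \<in> E C \<Longrightarrow> \<xi> i j \<in> ell2 (coords (C $ i $ j))"
  by (simp add: E_def mat_module_def)

lemma tpow_ell2: "\<eta> \<in> tpow C k \<Longrightarrow> \<eta> i j \<in> ell2 (tpow_index C k i j)"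
  by (simp add: tpow_def mat_module_def)

lemma left_act_E:
  assumes "\<xi> \<in> E C"
  shows "left_act D \<xi> \<in> E C"
  using assms by (auto simp: E_def mat_module_def left_act_def)

text \<open>\<open>mod_ip_tensor\<close> sees only sums over all rows. Letting the projection onto
  row \<open>a\<close> act on \<xi>' from the left singles out one row.\<close>

lemma ip_tensor:
  fixes C :: "enat ^ 'n::finite ^ 'n"
  assumes "\<xi> \<in> E C" "\<xi>' \<in> E C" "\<eta> \<in> tpow C k" "\<eta>' \<in> tpow C k"
  shows "ip (tensor \<xi> \<eta> a b) (tensor \<xi>' \<eta>' a b) =
    (\<Sum>m\<in>UNIV. ip (\<xi> a m) (\<xi>' a m) * ip (\<eta> m b) (\<eta>' m b))"
proof -
  define D :: "complex ^ 'n ^ 'n" where "D = (\<chi> p q. if p = a then 1 else 0)"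
  have row: "ip u (left_act D x i b) = (if i = a then ip u (x i b) else 0)"
    for i b and x :: "'n \<Rightarrow> 'n \<Rightarrow> 'w \<Rightarrow> complex" and u
    by (simp add: left_act_def D_def)
  have "ip (tensor \<xi> \<eta> a b) (tensor \<xi>' \<eta>' a b) =
      mod_ip (tensor \<xi> \<eta>) (tensor (left_act D \<xi>') \<eta>') $ b $ b"
    unfolding left_act_tensor[symmetric] mod_ip_def by (simp add: row)
  also have "\<dots> = mod_ip \<eta> (left_act (mod_ip \<xi> (left_act D \<xi>')) \<eta>') $ b $ b"
    by (simp only: mod_ip_tensor[OF assms(1) left_act_E[OF assms(2)] assms(3,4)])
  also have "\<dots> = (\<Sum>m\<in>UNIV. ip (\<xi> a m) (\<xi>' a m) * ip (\<eta> m b) (\<eta>' m b))"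
  proof -
    have "mod_ip \<xi> (left_act D \<xi>') $ m $ m = ip (\<xi> a m) (\<xi>' a m)" for m
      by (simp add: mod_ip_def row)
    then show ?thesis by (simp add: mod_ip_def[of \<eta>] left_act_def[of "mod_ip _ _"] ip_scale_right)
  qed
  finally show ?thesis .
qed

lemma ell2_norm_tensor:
  fixes C :: "enat ^ 'n::finite ^ 'n"
  assumes "\<xi> \<in> E C" "\<eta> \<in> tpow C k"
  shows "(ell2_norm (tensor \<xi> \<eta> a b))\<^sup>2 = (\<Sum>m\<in>UNIV. (ell2_norm (\<xi> a m))\<^sup>2 * (ell2_norm (\<eta> m b))\<^sup>2)"
proof -
  have "complex_of_real ((ell2_norm (tensor \<xi> \<eta> a b))\<^sup>2) =
      complex_of_real (\<Sum>m\<in>UNIV. (ell2_norm (\<xi> a m))\<^sup>2 * (ell2_norm (\<eta> m b))\<^sup>2)"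
    using ip_tensor[OF assms(1,1,2,2), of a b]
    by (simp add: ip_self[OF tpow_ell2[OF tensor_in_tpow[OF assms]]] ip_self[OF E_ell2[OF assms(1)]]
        ip_self[OF tpow_ell2[OF assms(2)]])
  then show ?thesis by (simp only: of_real_eq_iff)
qed

lemma ell2_norm_mod_col:
  fixes x :: "'n::finite \<Rightarrow> 'n \<Rightarrow> 'w \<Rightarrow> complex"
  assumes "x \<in> mat_module W"
  shows "(ell2_norm (mod_col x b))\<^sup>2 = (\<Sum>a\<in>UNIV. (ell2_norm (x a b))\<^sup>2)"
proof -
  have "x a b \<in> ell2 UNIV" for a using assms ell2_subset by (auto simp: mat_module_def)
  moreover have "ip (mod_col x b) (mod_col x b) = (\<Sum>a\<in>UNIV. ip (x a b) (x a b))"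
    using ip_finite_slices[OF mod_col_ell2[OF assms] mod_col_ell2[OF assms], of b b]
    by (simp add: mod_col_def)
  ultimately have "complex_of_real ((ell2_norm (mod_col x b))\<^sup>2) = complex_of_real (\<Sum>a\<in>UNIV. (ell2_norm (x a b))\<^sup>2)"
    by (simp add: ip_self[OF mod_col_ell2[OF assms]] ip_self[where W = UNIV])
  then show ?thesis by (simp only: of_real_eq_iff)
qed

lemma tensor_add: "tensor \<xi> (x + y) = tensor \<xi> x + tensor \<xi> y"
  by (auto simp: tensor_def fun_eq_iff distrib_left split: list.splits)

text \<open>Interchanging the sums over \<open>a\<close> and \<open>m\<close> collects the squared
  norms of \<xi> by columns, so the mass of each single column is what enters the bound.\<close>

lemma ell2_norm_tensor_col:
  assumes "\<xi> \<in> E C" "x \<in> tpow C k" "\<And>m. (\<Sum>a\<in>UNIV. (ell2_norm (\<xi> a m))\<^sup>2) \<le> K"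
  shows "(ell2_norm (mod_col (tensor \<xi> x) b))\<^sup>2 \<le> K * (ell2_norm (mod_col x b))\<^sup>2"
proof -
  have "(ell2_norm (mod_col (tensor \<xi> x) b))\<^sup>2 =
      (\<Sum>a\<in>UNIV. \<Sum>m\<in>UNIV. (ell2_norm (\<xi> a m))\<^sup>2 * (ell2_norm (x m b))\<^sup>2)"
    using tensor_in_tpow[OF assms(1,2)]
    by (simp add: tpow_def ell2_norm_mod_col ell2_norm_tensor[OF assms(1,2)])
  also have "\<dots> = (\<Sum>m\<in>UNIV. (\<Sum>a\<in>UNIV. (ell2_norm (\<xi> a m))\<^sup>2) * (ell2_norm (x m b))\<^sup>2)"
    unfolding sum_distrib_right by (rule sum.swap)
  also have "\<dots> \<le> (\<Sum>m\<in>UNIV. K * (ell2_norm (x m b))\<^sup>2)"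
    by (intro sum_mono mult_right_mono assms(3)) auto
  also have "\<dots> = K * (ell2_norm (mod_col x b))\<^sup>2"
    using assms(2) by (simp add: tpow_def ell2_norm_mod_col sum_distrib_left)
  finally show ?thesis .
qed

lemma tpow_zero [simp]: "0 \<in> tpow C k"
  by (simp add: tpow_def mat_module_def)

lemma creation_fock:
  assumes "\<xi> \<in> E C" "\<And>m. (\<Sum>a\<in>UNIV. (ell2_norm (\<xi> a m))\<^sup>2) \<le> K\<^sup>2" "K \<ge> 0" "x \<in> fock C"
  shows "creation C \<xi> x \<in> fock C" "fock_norm (creation C \<xi> x) \<le> K * fock_norm x"
proof -
  let ?y = "creation C \<xi> x"
  have y0: "?y 0 = 0" and ys: "?y (Suc k) = tensor \<xi> (x k)" for k
    using assms(4) by (simp_all add: creation_def)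
  have t: "?y k \<in> tpow C k" for k
    using tensor_in_tpow[OF assms(1) fock_tpow[OF assms(4)]] y0 ys by (cases k) auto
  note xs = ell2_norm_nat_slices[OF fock_col_ell2[OF assms(4), THEN ell2_subset], unfolded fock_col_slice]
  have mc0: "mod_col 0 b = 0" for b :: 'a by (auto simp: mod_col_def fun_eq_iff)
  have le: "(ell2_norm (mod_col (?y (Suc k)) b))\<^sup>2 \<le> K\<^sup>2 * (ell2_norm (mod_col (x k) b))\<^sup>2" for k b
    unfolding ys by (rule ell2_norm_tensor_col[OF assms(1) fock_tpow[OF assms(4)] assms(2)])
  have s: "summable (\<lambda>k. (ell2_norm (mod_col (?y (Suc k)) b))\<^sup>2)" for b
    by (rule summable_comparison_test'[OF summable_mult[OF sums_summable[OF xs[of b]], of "K\<^sup>2"], of 0])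
       (use le in auto)
  then have s': "summable (\<lambda>k. (ell2_norm (mod_col (?y k) b))\<^sup>2)" for b
    using s[of b] summable_Suc_iff[of "\<lambda>k. (ell2_norm (mod_col (?y k) b))\<^sup>2"] by blast
  have "fock_col ?y b \<in> ell2 UNIV" for b
    unfolding ell2_nat_slices fock_col_slice using s' t by (auto simp: tpow_def intro: mod_col_ell2)
  with t show y: "?y \<in> fock C" by (simp add: fock_alt)
  show "fock_norm ?y \<le> K * fock_norm x"
  proof (rule fock_norm_le[OF y])
    fix b
    have "(\<lambda>k. (ell2_norm (mod_col (?y k) b))\<^sup>2) sums (ell2_norm (fock_col ?y b))\<^sup>2"
      using ell2_norm_nat_slices[OF fock_col_ell2[OF y, THEN ell2_subset]] unfolding fock_col_slice .
    \<comment> \<open>The image has no component in degree 0, so the shifted series has the same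
      sum.\<close>
    then have "(\<lambda>k. (ell2_norm (mod_col (?y (Suc k)) b))\<^sup>2) sums (ell2_norm (fock_col ?y b))\<^sup>2"
      by (subst sums_Suc_iff) (simp add: y0 mc0)
    then have "(ell2_norm (fock_col ?y b))\<^sup>2 \<le> K\<^sup>2 * (ell2_norm (fock_col x b))\<^sup>2"
      by (rule sums_le[OF le _ sums_mult[OF xs[of b], of "K\<^sup>2"]])
    then have "ell2_norm (fock_col ?y b) \<le> K * ell2_norm (fock_col x b)"
      by (rule power2_le_imp_le[OF _ mult_nonneg_nonneg[OF assms(3) ell2_norm_nonneg], unfolded power_mult_distrib])
    also have "\<dots> \<le> K * fock_norm x"
      using fock_norm_col_le[OF assms(4)] assms(3) by (rule mult_left_mono)
    finally show "ell2_norm (fock_col ?y b) \<le> K * fock_norm x" .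
  qed
qed

text \<open>\<open>K\<close> has to dominate each column separately, not the sum over the columns.
  This sharp form later makes an operator with normalized vectors in two different columns a
  contraction.\<close>

lemma creation_op_norm:
  assumes "\<xi> \<in> E C" "\<And>m. (\<Sum>a\<in>UNIV. (ell2_norm (\<xi> a m))\<^sup>2) \<le> K\<^sup>2" "K \<ge> 0"
  shows "op_norm C (creation C \<xi>) \<le> K"
  using creation_fock(2)[OF assms] assms(3) by (rule op_norm_le)

text \<open>The adjoint comes from \<open>adjointableI\<close>, which leaves right linearity and a
  bound. Any finite bound will do here, so \<open>K\<close> is the root of the total mass of
  \<xi>.\<close>

lemma creation_adjointable:
  assumes "\<xi> \<in> E C"
  shows "creation C \<xi> \<in> adjointable_ops C"
proof -
  define K where "K = sqrt (\<Sum>m\<in>UNIV. \<Sum>a\<in>UNIV. (ell2_norm (\<xi> a m))\<^sup>2)"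
  have "(\<Sum>a\<in>UNIV. (ell2_norm (\<xi> a m))\<^sup>2) \<le> K\<^sup>2" for m
    using member_le_sum[of m UNIV "\<lambda>m. \<Sum>a\<in>UNIV. (ell2_norm (\<xi> a m))\<^sup>2"]
    by (simp add: K_def sum_nonneg)
  note cf = creation_fock[OF assms this]
  have K: "K \<ge> 0" by (simp add: K_def sum_nonneg)
  show ?thesis
  proof (rule adjointableI[where K = K])
    fix x y assume x: "x \<in> fock C"
    show "creation C \<xi> x \<in> fock C" "fock_norm (creation C \<xi> x) \<le> K * fock_norm x"
      using cf[OF K x] by auto
    show "creation C \<xi> (\<lambda>k. right_act (x k) D) = (\<lambda>k. right_act (creation C \<xi> x k) D)" for D
      using x fock_right_act[OF x, of D]
      by (auto simp: creation_def right_act_tensor[symmetric] fun_eq_iff split: nat.split)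
         (simp add: right_act_def)
    show "creation C \<xi> (x + y) = creation C \<xi> x + creation C \<xi> y" if "y \<in> fock C"
      using x that fock_add[OF x that]
      by (auto simp: creation_def tensor_add fun_eq_iff split: nat.split)
  qed (simp add: creation_def)
qed

lemma creation_add: "creation C (\<xi> + \<zeta>) = creation C \<xi> + creation C \<zeta>"
  by (auto simp: creation_def tensor_def fun_eq_iff distrib_right split: nat.split list.splits)

lemma creation_scale: "creation C (\<lambda>a b w. c * \<xi> a b w) = op_scale c (creation C \<xi>)"
  by (auto simp: creation_def op_scale_def tensor_def fun_eq_iff mult.assoc split: nat.split list.splits)

section \<open>The tensor algebra as a closed hull\<close>

lemma closed_subalgebraD:
  assumes "closed_subalgebra C B"
  shows "B \<subseteq> adjointable_ops C" "0 \<in> B"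
    and "S \<in> B \<Longrightarrow> T \<in> B \<Longrightarrow> S + T \<in> B" "S \<in> B \<Longrightarrow> T \<in> B \<Longrightarrow> S \<circ> T \<in> B"
    and "S \<in> B \<Longrightarrow> op_scale a S \<in> B"
    and "S \<in> adjointable_ops C \<Longrightarrow> \<forall>\<epsilon>>0. \<exists>T\<in>B. op_norm C (S - T) < \<epsilon> \<Longrightarrow> S \<in> B"
proof -
  note cs = assms[unfolded closed_subalgebra_def]
  show "B \<subseteq> adjointable_ops C" by (rule cs[THEN conjunct1])
  show "0 \<in> B" by (rule cs[THEN conjunct2, THEN conjunct1])
  note st = cs[THEN conjunct2, THEN conjunct2, THEN conjunct1, rule_format]
  show "S + T \<in> B" if "S \<in> B" "T \<in> B" by (rule st[OF that, THEN conjunct1])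
  show "S \<circ> T \<in> B" if "S \<in> B" "T \<in> B" by (rule st[OF that, THEN conjunct2])
  show "op_scale a S \<in> B" if "S \<in> B"
    by (rule cs[THEN conjunct2, THEN conjunct2, THEN conjunct2, THEN conjunct1, rule_format, OF that])
  show "S \<in> B" if "S \<in> adjointable_ops C" "\<forall>\<epsilon>>0. \<exists>T\<in>B. op_norm C (S - T) < \<epsilon>"
    by (rule cs[THEN conjunct2, THEN conjunct2, THEN conjunct2, THEN conjunct2, THEN bspec, THEN mp, OF that])
qed

lemma tensor_algebra_closed: "closed_subalgebra C (tensor_algebra C)"
  and tensor_algebra_adjointable: "tensor_algebra C \<subseteq> adjointable_ops C"
  and creation_tensor_algebra: "\<xi> \<in> E C \<Longrightarrow> creation C \<xi> \<in> tensor_algebra C"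
  and phi_inf_tensor_algebra: "D \<in> diag_algebra \<Longrightarrow> phi_inf C D \<in> tensor_algebra C"
proof -
  let ?g = "creation C ` E C \<union> phi_inf C ` diag_algebra"
  show sub: "tensor_algebra C \<subseteq> adjointable_ops C"
    unfolding tensor_algebra_def
    by (rule hull_minimal) (auto intro: creation_adjointable phi_inf_adjointable adjointable_ops_closed_subalgebra)
  \<comment> \<open>A closed subalgebra containing the generators contains their hull. Membership is
    therefore tested only against closed subalgebras \<open>B\<close> above
    \<open>tensor_algebra C\<close>, in which sums, products and limits of its elements are
    available.\<close>
  have memI: "S \<in> tensor_algebra C"
    if "\<And>B. closed_subalgebra C B \<Longrightarrow> tensor_algebra C \<subseteq> B \<Longrightarrow> S \<in> B" for S
  proof -
    have "S \<in> B" if B: "closed_subalgebra C B" "?g \<subseteq> B" for B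
    proof -
      have "tensor_algebra C \<subseteq> B"
        unfolding tensor_algebra_def using B(2,1) by (rule hull_minimal)
      with B(1) show ?thesis using \<open>\<And>B. closed_subalgebra C B \<Longrightarrow> tensor_algebra C \<subseteq> B \<Longrightarrow> S \<in> B\<close> by blast
    qed
    then show ?thesis unfolding tensor_algebra_def hull_def by blast
  qed
  show "closed_subalgebra C (tensor_algebra C)"
    unfolding closed_subalgebra_def[of C "tensor_algebra C"]
  proof (intro conjI ballI allI impI)
    show "0 \<in> tensor_algebra C"
      by (rule memI) (rule closed_subalgebraD(2))
    fix S T assume ST: "S \<in> tensor_algebra C" "T \<in> tensor_algebra C"
    show "S + T \<in> tensor_algebra C"
      by (rule memI) (use ST in \<open>auto intro: closed_subalgebraD(3)\<close>)
    show "S \<circ> T \<in> tensor_algebra C"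
      by (rule memI) (use ST in \<open>auto intro: closed_subalgebraD(4)\<close>)
  next
    fix a S assume "S \<in> tensor_algebra C"
    then show "op_scale a S \<in> tensor_algebra C"
      by (intro memI) (auto intro: closed_subalgebraD(5))
  next
    fix S assume S: "S \<in> adjointable_ops C" "\<forall>\<epsilon>>0. \<exists>T\<in>tensor_algebra C. op_norm C (S - T) < \<epsilon>"
    show "S \<in> tensor_algebra C"
    proof (rule memI)
      fix B assume B: "closed_subalgebra C B" "tensor_algebra C \<subseteq> B"
      then have "\<forall>\<epsilon>>0. \<exists>T\<in>B. op_norm C (S - T) < \<epsilon>" using S(2) by blast
      with B(1) S(1) show "S \<in> B" by (rule closed_subalgebraD(6))
    qed
  qed (rule sub)
  show "\<xi> \<in> E C \<Longrightarrow> creation C \<xi> \<in> tensor_algebra C"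
    unfolding tensor_algebra_def by (rule hull_inc) simp
  show "D \<in> diag_algebra \<Longrightarrow> phi_inf C D \<in> tensor_algebra C"
    unfolding tensor_algebra_def by (rule hull_inc) simp
qed

section \<open>The Poisson kernel of a pure row contraction\<close>

lemma phi_inf_zero: "phi_inf C 0 = 0"
  by (auto simp: phi_inf_def left_act_def fun_eq_iff)

lemma tensor_algebra_diff:
  assumes "S \<in> tensor_algebra C" "T \<in> tensor_algebra C"
  shows "S - T \<in> tensor_algebra C" and "S - T = S + op_scale (-1) T"
proof -
  show *: "S - T = S + op_scale (-1) T" by (auto simp: op_scale_def fun_eq_iff)
  note cs = tensor_algebra_closed[of C]
  show "S - T \<in> tensor_algebra C"
    unfolding * by (intro closed_subalgebraD(3)[OF cs] closed_subalgebraD(5)[OF cs] assms)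
qed

text \<open>The elements with property \<open>P\<close> form a closed subalgebra around the
  generators. In the limit rule the approximants stay in the algebra, so that estimates on
  \<open>S - T\<close> can be used.\<close>

lemma tensor_algebra_induct [consumes 1, case_names creation phi_inf add comp scale limit]:
  assumes "S \<in> tensor_algebra C"
    and creation: "\<And>\<xi>. \<xi> \<in> E C \<Longrightarrow> P (creation C \<xi>)"
    and phi: "\<And>D. D \<in> diag_algebra \<Longrightarrow> P (phi_inf C D)"
    and add: "\<And>S T. S \<in> tensor_algebra C \<Longrightarrow> T \<in> tensor_algebra C \<Longrightarrow> P S \<Longrightarrow> P T \<Longrightarrow> P (S + T)"
    and comp: "\<And>S T. S \<in> tensor_algebra C \<Longrightarrow> T \<in> tensor_algebra C \<Longrightarrow> P S \<Longrightarrow> P T \<Longrightarrow> P (S \<circ> T)"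
    and scale: "\<And>a S. S \<in> tensor_algebra C \<Longrightarrow> P S \<Longrightarrow> P (op_scale a S)"
    and limit: "\<And>S. S \<in> tensor_algebra C \<Longrightarrow>
      (\<And>\<epsilon>. \<epsilon> > 0 \<Longrightarrow> \<exists>T\<in>tensor_algebra C. P T \<and> op_norm C (S - T) < \<epsilon>) \<Longrightarrow> P S"
  shows "P S"
proof -
  let ?B = "{S \<in> tensor_algebra C. P S}"
  note cs = tensor_algebra_closed[of C]
  \<comment> \<open>Zero gets no case of its own: it is \<open>phi_inf C 0\<close>.\<close>
  have 0: "0 \<in> ?B"
    using phi[of 0] closed_subalgebraD(2)[OF cs] by (simp add: phi_inf_zero diag_algebra_def)
  have "closed_subalgebra C ?B"
    unfolding closed_subalgebra_def
  proof (intro conjI ballI allI impI)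
    show "?B \<subseteq> adjointable_ops C" using tensor_algebra_adjointable by blast
    show "0 \<in> ?B" by (rule 0)
    show "S + T \<in> ?B" "S \<circ> T \<in> ?B" if "S \<in> ?B" "T \<in> ?B" for S T
      using that add comp closed_subalgebraD(3,4)[OF cs] by simp_all
    show "op_scale a S \<in> ?B" if "S \<in> ?B" for a S
      using that scale closed_subalgebraD(5)[OF cs] by simp
    fix S assume S: "S \<in> adjointable_ops C" "\<forall>\<epsilon>>0. \<exists>T\<in>?B. op_norm C (S - T) < \<epsilon>"
    have "S \<in> tensor_algebra C"
      by (rule closed_subalgebraD(6)[OF cs S(1)]) (use S(2) in blast)
    then show "S \<in> ?B" using limit[of S] S(2) by blast
  qed
  moreover have "creation C ` E C \<union> phi_inf C ` diag_algebra \<subseteq> ?B"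
    using creation phi creation_tensor_algebra phi_inf_tensor_algebra by auto
  ultimately have "tensor_algebra C \<subseteq> ?B"
    unfolding tensor_algebra_def by (intro hull_minimal)
  with assms(1) show ?thesis by blast
qed

section \<open>The Hilbert space of all columns\<close>

text \<open>The trace of \<open>fock_ip\<close>: the scalar product of the Fock module tensored with
  C^n over the diagonal algebra. \<open>fock_hs\<close> is the corresponding norm.\<close>

definition fock_pair :: "'n::finite fock_vec \<Rightarrow> 'n fock_vec \<Rightarrow> complex" where
  "fock_pair x y = (\<Sum>b\<in>UNIV. ip (fock_col x b) (fock_col y b))"

definition fock_hs :: "'n::finite fock_vec \<Rightarrow> real" where
  "fock_hs x = L2_set (\<lambda>b. ell2_norm (fock_col x b)) UNIV"

lemma fock_pair_bound:
  assumes "x \<in> fock C" "y \<in> fock C"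
  shows "cmod (fock_pair x y) \<le> fock_hs x * fock_hs y"
proof -
  have "cmod (fock_pair x y) \<le> (\<Sum>b\<in>UNIV. ell2_norm (fock_col x b) * ell2_norm (fock_col y b))"
    unfolding fock_pair_def
    by (intro sum_norm_le ip_Cauchy_Schwarz[OF fock_col_ell2[OF assms(1)] fock_col_ell2[OF assms(2)]])
  also have "\<dots> \<le> fock_hs x * fock_hs y"
    using L2_set_mult_ineq[of "\<lambda>b. ell2_norm (fock_col x b)" "\<lambda>b. ell2_norm (fock_col y b)" UNIV]
    by (simp add: fock_hs_def)
  finally show ?thesis .
qed

text \<open>An adjointable operator respects columns, so its norm on the module also bounds it on
  the Hilbert space of all columns.\<close>

lemma fock_hs_op_bound:
  assumes "S \<in> adjointable_ops C" "x \<in> fock C"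
  shows "fock_hs (S x) \<le> op_norm C S * fock_hs x"
proof -
  have "fock_hs (S x) \<le> L2_set (\<lambda>b. op_norm C S * ell2_norm (fock_col x b)) UNIV"
    unfolding fock_hs_def by (intro L2_set_mono op_norm_col_bound[OF assms]) auto
  then show ?thesis
    using op_norm_nonneg[OF assms(1)] by (simp add: fock_hs_def L2_set_right_distrib)
qed

lemma fock_pair_sums:
  assumes "x \<in> fock C" "y \<in> fock C"
  shows "(\<lambda>k. \<Sum>a\<in>UNIV. \<Sum>b\<in>UNIV. ip (x k a b) (y k a b)) sums fock_pair x y"
proof -
  have "(\<lambda>k. \<Sum>b\<in>UNIV. ip (mod_col (x k) b) (mod_col (y k) b)) sums fock_pair x y"
    unfolding fock_pair_def by (intro sums_sum fock_ip_sums[OF assms])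
  moreover have "(\<Sum>b\<in>UNIV. ip (mod_col (x k) b) (mod_col (y k) b)) =
      (\<Sum>a\<in>UNIV. \<Sum>b\<in>UNIV. ip (x k a b) (y k a b))" for k
  proof -
    have "ip (mod_col (x k) b) (mod_col (y k) b) = (\<Sum>a\<in>UNIV. ip (x k a b) (y k a b))" for b
      using ip_finite_slices[OF mod_col_ell2[OF fock_tpow[OF assms(1), unfolded tpow_def]]
          mod_col_ell2[OF fock_tpow[OF assms(2), unfolded tpow_def]]]
      by (simp add: mod_col_def)
    then show ?thesis by simp (rule sum.swap)
  qed
  ultimately show ?thesis by simp
qed

text \<open>Let T_k be the k-th power of the row contraction \<nu>. This is the diagonal entry at
  \<open>a\<close> of T_k times its adjoint, expanded over the paths of length \<open>k\<close> from
  \<open>a\<close>. The bound by 1 for \<open>k = 1\<close> is contractivity, and convergence to 0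
  is purity.\<close>

primrec path_mass :: "('n::finite \<Rightarrow> 'n \<Rightarrow> nat \<Rightarrow> complex) \<Rightarrow> nat \<Rightarrow> 'n \<Rightarrow> real" where
  "path_mass \<nu> 0 a = 1"
| "path_mass \<nu> (Suc k) a = (\<Sum>m\<in>UNIV. (ell2_norm (\<nu> a m))\<^sup>2 * path_mass \<nu> k m)"

text \<open>Row \<open>a\<close> of \<open>poisson \<nu>\<close> is the image of the \<open>a\<close>-th basis vector under the Poisson kernel of the
  row contraction \<open>\<nu>\<close>; the factor at \<open>k = 0\<close> is the defect of \<open>\<nu>\<close> at the end point of a path.\<close>

primrec poisson :: "('n::finite \<Rightarrow> 'n \<Rightarrow> nat \<Rightarrow> complex) \<Rightarrow> 'n fock_vec" where
  "poisson \<nu> 0 = (\<lambda>a b w. if a = b \<and> w = []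
     then complex_of_real (sqrt (1 - path_mass \<nu> 1 a)) else 0)"
| "poisson \<nu> (Suc k) = tensor \<nu> (poisson \<nu> k)"

lemma sum_cnj_self:
  fixes u :: "complex ^ 'n::finite"
  shows "(\<Sum>a\<in>UNIV. cnj (u $ a) * u $ a) = complex_of_real ((norm u)\<^sup>2)"
proof -
  have "(norm u)\<^sup>2 = (\<Sum>a\<in>UNIV. (cmod (u $ a))\<^sup>2)"
    by (simp add: norm_vec_def L2_set_def sum_nonneg)
  then show ?thesis
    by (simp add: complex_norm_square[unfolded of_real_power] mult.commute)
qed

locale pure_row_contraction =
  fixes C :: "enat ^ 'n::finite ^ 'n" and \<nu> :: "'n \<Rightarrow> 'n \<Rightarrow> nat \<Rightarrow> complex"
  assumes \<nu>: "\<nu> \<in> E C"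
    and row: "path_mass \<nu> 1 a \<le> 1"
    and pure: "(\<lambda>k. path_mass \<nu> k a) \<longlonglongrightarrow> 0"
begin

abbreviation "Z \<equiv> poisson \<nu>"

lemma Z_tpow: "Z k \<in> tpow C k"
proof (induction k)
  case 0
  show ?case
    unfolding tpow_def mat_module_def
    by (auto intro!: ell2_finite_support[of "{[]}"] split: if_splits)
next
  case (Suc k)
  then show ?case using tensor_in_tpow[OF \<nu>] by simp
qed

text \<open>Each path of length \<open>k\<close> is weighted by the defect at its end point, that
  is, by 1 minus the mass of one further step. Hence the difference of consecutive masses.\<close>

lemma Z_mass: "(\<Sum>b\<in>UNIV. (ell2_norm (Z k a b))\<^sup>2) = path_mass \<nu> k a - path_mass \<nu> (Suc k) a"
proof (induction k arbitrary: a)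
  case 0
  have "ell2_norm (Z 0 a b) = (if b = a then sqrt (1 - path_mass \<nu> 1 a) else 0)" for b
  proof -
    have "(\<Sum>\<^sub>\<infinity>w. (cmod (Z 0 a b w))\<^sup>2) = (\<Sum>\<^sub>\<infinity>w\<in>{[]}. (cmod (Z 0 a b w))\<^sup>2)"
      by (intro infsum_cong_neutral) auto
    then show ?thesis
      using row[of a] by (simp add: ell2_norm_def)
  qed
  moreover have "(if b = a then sqrt (1 - path_mass \<nu> 1 a) else 0)\<^sup>2 =
      (if b = a then 1 - path_mass \<nu> 1 a else 0)" for b
    using row[of a] by simp
  ultimately show ?case by simp
next
  case (Suc k)
  have "(\<Sum>b\<in>UNIV. (ell2_norm (Z (Suc k) a b))\<^sup>2) =
      (\<Sum>b\<in>UNIV. \<Sum>m\<in>UNIV. (ell2_norm (\<nu> a m))\<^sup>2 * (ell2_norm (Z k m b))\<^sup>2)"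
    by (simp add: ell2_norm_tensor[OF \<nu> Z_tpow])
  also have "\<dots> = (\<Sum>m\<in>UNIV. (ell2_norm (\<nu> a m))\<^sup>2 * (\<Sum>b\<in>UNIV. (ell2_norm (Z k m b))\<^sup>2))"
    unfolding sum_distrib_left by (rule sum.swap)
  also have "\<dots> = path_mass \<nu> (Suc k) a - path_mass \<nu> (Suc (Suc k)) a"
    unfolding Suc.IH by (simp add: right_diff_distrib sum_subtractf)
  finally show ?case .
qed

text \<open>The telescoping sum starts at \<open>path_mass \<nu> 0 a\<close>, which is 1, and purity
  removes the other end. Each row of \<open>Z\<close> is thus a unit vector.\<close>

lemma Z_mass_sums: "(\<lambda>k. \<Sum>b\<in>UNIV. (ell2_norm (Z k a b))\<^sup>2) sums 1"
  unfolding Z_mass using telescope_sums'[OF pure[of a]] by simp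

lemma Z_fock: "Z \<in> fock C"
proof -
  have "fock_col Z b \<in> ell2 UNIV" for b
    unfolding ell2_nat_slices fock_col_slice
  proof (intro conjI allI)
    show "mod_col (Z k) b \<in> ell2 UNIV" for k
      using Z_tpow[of k] unfolding tpow_def by (rule mod_col_ell2)
    have s: "summable (\<lambda>k. \<Sum>a\<in>UNIV. \<Sum>b\<in>UNIV. (ell2_norm (Z k a b))\<^sup>2)"
      by (intro summable_sum sums_summable[OF Z_mass_sums])
    show "summable (\<lambda>k. (ell2_norm (mod_col (Z k) b))\<^sup>2)"
    proof (rule summable_comparison_test'[OF s, of 0])
      fix k
      have "(\<Sum>a\<in>UNIV. (ell2_norm (Z k a b))\<^sup>2) \<le> (\<Sum>a\<in>UNIV. \<Sum>b\<in>UNIV. (ell2_norm (Z k a b))\<^sup>2)"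
        by (intro sum_mono member_le_sum) auto
      then show "norm ((ell2_norm (mod_col (Z k) b))\<^sup>2) \<le>
          (\<Sum>a\<in>UNIV. \<Sum>b\<in>UNIV. (ell2_norm (Z k a b))\<^sup>2)"
        using Z_tpow[of k] by (simp add: ell2_norm_mod_col tpow_def abs_of_nonneg sum_nonneg)
    qed
  qed
  then show ?thesis using Z_tpow by (simp add: fock_alt)
qed

text \<open>\<open>X\<close> is the Poisson kernel, \<open>L\<close> its adjoint with respect to
  \<open>fock_pair\<close>, and \<open>R S\<close> the compression of \<open>S\<close> by
  \<open>X\<close>. Scaling row \<open>a\<close> of \<open>Z\<close> by \<open>u $ a\<close> is
  isometric because the rows are mutually orthogonal unit vectors.\<close>

definition X :: "complex ^ 'n \<Rightarrow> 'n fock_vec" where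
  "X u = (\<lambda>k. left_act (\<chi> p q. u $ p) (Z k))"

definition L :: "'n fock_vec \<Rightarrow> complex ^ 'n" where
  "L y = (\<chi> a. fock_pair (X (axis a 1)) y)"

definition R :: "'n fock_op \<Rightarrow> complex ^ 'n ^ 'n" where
  "R S = matrix (\<lambda>v. L (S (X v)))"

lemma X_fock: "X u \<in> fock C"
  unfolding X_def by (rule fock_left_act(1)[OF Z_fock])

lemma X_entry: "X u k a b = (\<lambda>w. u $ a * Z k a b w)"
  by (simp add: X_def left_act_def)

lemma L_sums:
  assumes "y \<in> fock C"
  shows "(\<lambda>k. \<Sum>b\<in>UNIV. ip (Z k a b) (y k a b)) sums L y $ a"
proof -
  have "(\<Sum>b\<in>UNIV. ip (X (axis a 1) k c b) (y k c b)) =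
      (if c = a then \<Sum>b\<in>UNIV. ip (Z k a b) (y k a b) else 0)" for k c
    by (simp add: X_entry axis_def)
  then show ?thesis
    using fock_pair_sums[OF X_fock assms, of "axis a 1"] by (simp add: L_def)
qed

text \<open>The adjoint relation between \<open>X\<close> and \<open>L\<close> for all vectors; the
  definition of \<open>L\<close> pairs with basis vectors only.\<close>

lemma fock_pair_X:
  assumes "y \<in> fock C"
  shows "fock_pair (X u) y = (\<Sum>a\<in>UNIV. cnj (u $ a) * L y $ a)"
proof -
  have "(\<lambda>k. \<Sum>a\<in>UNIV. cnj (u $ a) * (\<Sum>b\<in>UNIV. ip (Z k a b) (y k a b))) sums
      (\<Sum>a\<in>UNIV. cnj (u $ a) * L y $ a)"
    by (intro sums_sum sums_mult L_sums[OF assms])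
  moreover have "(\<lambda>k. \<Sum>a\<in>UNIV. cnj (u $ a) * (\<Sum>b\<in>UNIV. ip (Z k a b) (y k a b))) sums fock_pair (X u) y"
    using fock_pair_sums[OF X_fock assms, of u] by (simp add: X_entry ip_scale_left sum_distrib_left)
  ultimately show ?thesis by (simp add: sums_unique2)
qed

lemma L_X: "L (X u) = u"
proof -
  have "L (X u) $ a = u $ a" for a
  proof -
    have "(\<Sum>b\<in>UNIV. ip (Z k a b) (X u k a b)) =
        u $ a * complex_of_real (\<Sum>b\<in>UNIV. (ell2_norm (Z k a b))\<^sup>2)" for k
      by (simp add: X_entry ip_scale_right ip_self[OF tpow_ell2[OF Z_tpow]] sum_distrib_left)
    then have "(\<lambda>k. u $ a * complex_of_real (\<Sum>b\<in>UNIV. (ell2_norm (Z k a b))\<^sup>2)) sums L (X u) $ a"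
      using L_sums[OF X_fock, of a u] by simp
    moreover have "(\<lambda>k. u $ a * complex_of_real (\<Sum>b\<in>UNIV. (ell2_norm (Z k a b))\<^sup>2)) sums
        (u $ a * complex_of_real 1)"
      by (intro sums_mult sums_of_real Z_mass_sums)
    ultimately show ?thesis by (simp add: sums_unique2)
  qed
  then show ?thesis by (simp add: vec_eq_iff)
qed

lemma fock_hs_X: "fock_hs (X u) = norm u"
proof -
  have "fock_pair (X u) (X u) = complex_of_real ((fock_hs (X u))\<^sup>2)"
    by (simp add: fock_pair_def fock_hs_def L2_set_def sum_nonneg ip_self[OF fock_col_ell2[OF X_fock]])
  moreover have "fock_pair (X u) (X u) = complex_of_real ((norm u)\<^sup>2)"
    by (simp only: fock_pair_X[OF X_fock] L_X sum_cnj_self)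
  ultimately have "(fock_hs (X u))\<^sup>2 = (norm u)\<^sup>2" by (simp only: of_real_eq_iff)
  then show ?thesis by (simp add: fock_hs_def)
qed

text \<open>The adjoint of an isometry is a contraction: pair \<open>y\<close> with
  \<open>X (L y)\<close>, use Cauchy-Schwarz and cancel one factor
  \<open>norm (L y)\<close>.\<close>

lemma L_bound:
  assumes "y \<in> fock C"
  shows "norm (L y) \<le> fock_hs y"
proof -
  have "(norm (L y))\<^sup>2 = cmod (fock_pair (X (L y)) y)"
    by (simp add: fock_pair_X[OF assms] sum_cnj_self norm_power)
  also have "\<dots> \<le> norm (L y) * fock_hs y"
    using fock_pair_bound[OF X_fock assms] by (simp add: fock_hs_X)
  finally show ?thesis
    by (cases "norm (L y) = 0") (simp_all add: power2_eq_square fock_hs_def)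
qed

lemma L_add:
  assumes "x \<in> fock C" "y \<in> fock C"
  shows "L (x + y) = L x + L y"
  by (simp add: vec_eq_iff L_def fock_pair_def fock_col_add sum.distrib
      ip_add_right[OF fock_col_ell2[OF X_fock] fock_col_ell2[OF assms(1)] fock_col_ell2[OF assms(2)]])

lemma L_scale: "L (\<lambda>k i j w. a * x k i j w) = a *s L x"
  by (simp add: vec_eq_iff L_def fock_pair_def fock_col_scale ip_scale_right sum_distrib_left)

lemma X_add: "X (u + v) = X u + X v"
  by (simp add: X_def left_act_def fun_eq_iff distrib_right)

lemma X_scale: "X (a *s u) = (\<lambda>k i j w. a * X u k i j w)"
  by (simp add: X_def left_act_def fun_eq_iff mult.assoc)

lemma R_works:
  assumes "S \<in> adjointable_ops C"
  shows "R S *v v = L (S (X v))"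
proof -
  have "Vector_Spaces.linear (*s) (*s) (\<lambda>v. L (S (X v)))"
  proof (unfold_locales, goal_cases)
    case (1 u v)
    show ?case
      by (simp add: X_add adjointable_add[OF assms X_fock X_fock]
          L_add[OF adjointable_fock[OF assms X_fock] adjointable_fock[OF assms X_fock]])
  next
    case (2 a v)
    show ?case by (simp add: X_scale adjointable_scale[OF assms X_fock] L_scale)
  qed
  then show ?thesis unfolding R_def by (rule matrix_works)
qed

lemma R_norm: 
  assumes "S \<in> adjointable_ops C"
  shows "norm (R S *v v) \<le> op_norm C S * norm v"
proof -
  have "norm (R S *v v) \<le> fock_hs (S (X v))"
    unfolding R_works[OF assms] by (rule L_bound[OF adjointable_fock[OF assms X_fock]])
  also have "\<dots> \<le> op_norm C S * norm v"
    using fock_hs_op_bound[OF assms X_fock] by (simp add: fock_hs_X)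
  finally show ?thesis .
qed

text \<open>Since \<open>Z (Suc k) = tensor \<nu> (Z k)\<close>, pairing it with
  \<open>tensor \<xi> (y k)\<close> splits off the numbers \<open>ip (\<nu> a m) (\<xi> a m)\<close>
  and leaves the pairing in degree \<open>k\<close>. The identity holds for every \<open>y\<close>
  in the Fock module and not just on the range of \<open>X\<close>; this is the invariance of that
  range under the adjoint of the creation operator.\<close>

lemma L_creation:
  assumes "\<xi> \<in> E C" "y \<in> fock C"
  shows "L (creation C \<xi> y) = (\<chi> a m. ip (\<nu> a m) (\<xi> a m)) *v L y"
proof -
  have y': "creation C \<xi> y \<in> fock C"
    using adjointable_fock[OF creation_adjointable[OF assms(1)] assms(2)] .
  have "L (creation C \<xi> y) $ a = (\<Sum>m\<in>UNIV. ip (\<nu> a m) (\<xi> a m) * L y $ m)" for a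
  proof -
    have "(\<lambda>k. \<Sum>b\<in>UNIV. ip (Z (Suc k) a b) (creation C \<xi> y (Suc k) a b)) sums L (creation C \<xi> y) $ a"
      using L_sums[OF y', of a] assms(2) by (subst sums_Suc_iff) (simp add: creation_def)
    moreover have "(\<Sum>b\<in>UNIV. ip (Z (Suc k) a b) (creation C \<xi> y (Suc k) a b)) =
        (\<Sum>m\<in>UNIV. ip (\<nu> a m) (\<xi> a m) * (\<Sum>b\<in>UNIV. ip (Z k m b) (y k m b)))" for k
    proof -
      have "(\<Sum>b\<in>UNIV. ip (Z (Suc k) a b) (creation C \<xi> y (Suc k) a b)) =
          (\<Sum>b\<in>UNIV. \<Sum>m\<in>UNIV. ip (\<nu> a m) (\<xi> a m) * ip (Z k m b) (y k m b))"
        using assms(2) ip_tensor[OF \<nu> assms(1) Z_tpow fock_tpow[OF assms(2)]]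
        by (simp add: creation_def)
      then show ?thesis unfolding sum_distrib_left by simp (rule sum.swap)
    qed
    moreover have "(\<lambda>k. \<Sum>m\<in>UNIV. ip (\<nu> a m) (\<xi> a m) * (\<Sum>b\<in>UNIV. ip (Z k m b) (y k m b))) sums
        (\<Sum>m\<in>UNIV. ip (\<nu> a m) (\<xi> a m) * L y $ m)"
      by (intro sums_sum sums_mult L_sums[OF assms(2)])
    ultimately show ?thesis by (simp add: sums_unique2)
  qed
  then show ?thesis by (simp add: vec_eq_iff matrix_vector_mult_def)
qed

lemma L_phi_inf:
  assumes "D \<in> diag_algebra" "y \<in> fock C"
  shows "L (phi_inf C D y) = D *v L y"
proof -
  have y': "phi_inf C D y \<in> fock C"
    using adjointable_fock[OF phi_inf_adjointable assms(2)] .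
  have "L (phi_inf C D y) $ a = D $ a $ a * L y $ a" for a
  proof -
    have "(\<lambda>k. D $ a $ a * (\<Sum>b\<in>UNIV. ip (Z k a b) (y k a b))) sums L (phi_inf C D y) $ a"
      using L_sums[OF y', of a] assms(2)
      by (simp add: phi_inf_def left_act_def ip_scale_right sum_distrib_left)
    moreover have "(\<lambda>k. D $ a $ a * (\<Sum>b\<in>UNIV. ip (Z k a b) (y k a b))) sums (D $ a $ a * L y $ a)"
      by (intro sums_mult L_sums[OF assms(2)])
    ultimately show ?thesis by (simp add: sums_unique2)
  qed
  moreover have "(\<Sum>m\<in>UNIV. D $ a $ m * L y $ m) = D $ a $ a * L y $ a" for a
  proof -
    have "(\<Sum>m\<in>UNIV. D $ a $ m * L y $ m) = (\<Sum>m\<in>UNIV. if m = a then D $ a $ a * L y $ a else 0)"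
      using assms(1) by (intro sum.cong) (auto simp: diag_algebra_def)
    then show ?thesis by simp
  qed
  ultimately show ?thesis by (simp add: vec_eq_iff matrix_vector_mult_def)
qed

text \<open>The span of the vectors \<open>X u\<close> is invariant under the adjoints of the tensor algebra, so the
  compression to it is multiplicative.\<close>

lemma L_tensor_algebra:
  assumes "S \<in> tensor_algebra C"
  shows "\<forall>y\<in>fock C. L (S y) = L (S (X (L y)))"
  using assms
proof (induction rule: tensor_algebra_induct)
  case (creation \<xi>)
  then show ?case by (simp add: L_creation X_fock L_X)
next
  case (phi_inf D)
  then show ?case by (simp add: L_phi_inf X_fock L_X)
next
  case (add S T)
  then have "S \<in> adjointable_ops C" "T \<in> adjointable_ops C" using tensor_algebra_adjointable by auto
  then have "L ((S + T) z) = L (S z) + L (T z)" if "z \<in> fock C" for z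
    using that by (simp only: plus_fun_apply L_add adjointable_fock)
  with add.IH X_fock show ?case by metis
next
  case (comp S T)
  then have "S \<in> adjointable_ops C" "T \<in> adjointable_ops C" using tensor_algebra_adjointable by auto
  note f = adjointable_fock[OF this(2)]
  show ?case
  proof
    fix y assume y: "y \<in> fock C"
    \<comment> \<open>The identity for \<open>S\<close> is used twice, first at \<open>T y\<close>
      and then backwards at \<open>T (X (L y))\<close>.\<close>
    have "L (S (T y)) = L (S (X (L (T y))))" using comp.IH(1) f[OF y] by blast
    also have "\<dots> = L (S (X (L (T (X (L y))))))" using comp.IH(2) y by metis
    also have "\<dots> = L (S (T (X (L y))))" using comp.IH(1) f[OF X_fock] by metis
    finally show "L ((S \<circ> T) y) = L ((S \<circ> T) (X (L y)))" by simp
  qed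
next
  case (scale a S)
  then show ?case by (simp add: op_scale_def L_scale)
next
  case (limit S)
  show ?case
  proof
    fix y assume y: "y \<in> fock C"
    \<comment> \<open>\<open>T\<close> satisfies the identity exactly, so the error comes from
      \<open>S - T\<close> acting on the two vectors \<open>y\<close> and \<open>X (L y)\<close>,
      whose norms add up to \<open>K\<close>.\<close>
    define K where "K = fock_hs y + fock_hs (X (L y))"
    have "norm (L (S y) - L (S (X (L y)))) \<le> 0 + \<delta>" if "\<delta> > 0" for \<delta>
    proof -
      have K: "K \<ge> 0" by (simp add: K_def fock_hs_def)
      then have "\<delta> / (K + 1) > 0" using that by simp
      then obtain T where T: "T \<in> tensor_algebra C" "\<forall>y\<in>fock C. L (T y) = L (T (X (L y)))"
        "op_norm C (S - T) < \<delta> / (K + 1)" using limit.IH by blast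
      have S': "S \<in> adjointable_ops C" and T': "T \<in> adjointable_ops C"
        and ST: "S - T \<in> adjointable_ops C"
        using limit.hyps T(1) tensor_algebra_diff(1) tensor_algebra_adjointable by blast+
      have d: "L (S z) = L (T z) + L ((S - T) z)" if z: "z \<in> fock C" for z
        using L_add[OF adjointable_fock[OF T' z] adjointable_fock[OF ST z]] by simp
      have b: "norm (L ((S - T) z)) \<le> op_norm C (S - T) * fock_hs z" if z: "z \<in> fock C" for z
        using L_bound[OF adjointable_fock[OF ST z]] fock_hs_op_bound[OF ST z] by linarith
      have "L (S y) - L (S (X (L y))) = L ((S - T) y) - L ((S - T) (X (L y)))"
        using d[OF y] d[OF X_fock] T(2) y by simp
      also have "norm \<dots> \<le> op_norm C (S - T) * K"
        using norm_triangle_ineq4[of "L ((S - T) y)" "L ((S - T) (X (L y)))"] b[OF y] b[OF X_fock]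
        unfolding K_def distrib_left by (meson add_mono order_trans)
      also have "\<dots> \<le> \<delta> / (K + 1) * (K + 1)"
        using T(3) K op_norm_nonneg[OF ST] by (intro mult_mono) auto
      also have "\<dots> = \<delta>" using K by simp
      finally show ?thesis by simp
    qed
    then have "norm (L (S y) - L (S (X (L y)))) \<le> 0" by (rule field_le_epsilon)
    then show "L (S y) = L (S (X (L y)))" by simp
  qed
qed

lemma R_add:
  assumes "S \<in> adjointable_ops C" "T \<in> adjointable_ops C"
  shows "R (S + T) = R S + R T"
  by (simp add: R_def matrix_def vec_eq_iff L_add adjointable_fock[OF assms(1)] adjointable_fock[OF assms(2)] X_fock)

lemma R_scale: "R (op_scale a S) $ p $ q = a * R S $ p $ q"
  by (simp add: R_def matrix_def op_scale_def L_scale)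

text \<open>\<open>L_tensor_algebra\<close> allows \<open>X\<close> after \<open>L\<close> to be
  inserted between the two factors.\<close>

lemma R_comp:
  assumes "S \<in> tensor_algebra C" "T \<in> tensor_algebra C"
  shows "R (S \<circ> T) = R S ** R T"
proof -
  have a: "S \<in> adjointable_ops C" "T \<in> adjointable_ops C" "S \<circ> T \<in> adjointable_ops C"
    using assms closed_subalgebraD(4)[OF tensor_algebra_closed assms] tensor_algebra_adjointable by auto
  have "R (S \<circ> T) *v v = (R S ** R T) *v v" for v
  proof -
    have "R (S \<circ> T) *v v = L (S (T (X v)))" using R_works[OF a(3)] by simp
    also have "\<dots> = L (S (X (L (T (X v)))))"
      using L_tensor_algebra[OF assms(1)] adjointable_fock[OF a(2) X_fock] by blast
    also have "\<dots> = R S *v (R T *v v)" by (simp add: R_works a)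
    finally show ?thesis by (simp add: matrix_vector_mul_assoc)
  qed
  then show ?thesis by (simp add: matrix_eq)
qed

lemma R_creation:
  assumes "\<xi> \<in> E C"
  shows "R (creation C \<xi>) = (\<chi> a m. ip (\<nu> a m) (\<xi> a m))"
  using R_works[OF creation_adjointable[OF assms]] by (simp add: matrix_eq L_creation[OF assms X_fock] L_X)

lemma R_phi_inf:
  assumes "D \<in> diag_algebra"
  shows "R (phi_inf C D) = D"
  using R_works[OF phi_inf_adjointable] by (simp add: matrix_eq L_phi_inf[OF assms X_fock] L_X)

lemma R_mat_norm: "S \<in> adjointable_ops C \<Longrightarrow> mat_norm (R S) \<le> op_norm C S"
  by (intro mat_norm_le R_norm)

lemma R_diff_entry:
  assumes "S \<in> tensor_algebra C" "T \<in> tensor_algebra C"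
  shows "cmod (R S $ p $ q - R T $ p $ q) \<le> op_norm C (S - T)"
proof -
  have a: "S \<in> adjointable_ops C" "T \<in> adjointable_ops C" "S - T \<in> adjointable_ops C"
    using assms tensor_algebra_diff(1)[OF assms] tensor_algebra_adjointable by auto
  have "R S = R T + R (S - T)" using R_add[OF a(2,3)] by simp
  then have "R S $ p $ q - R T $ p $ q = R (S - T) $ p $ q" by simp
  then show ?thesis
    using mat_entry_le[of "R (S - T)" p q] R_mat_norm[OF a(3)] by simp
qed

text \<open>Matrices supported on a preorder form a closed algebra: reflexivity admits the diagonal,
  transitivity the products, and the entries are continuous under norm limits.\<close>

lemma R_support:
  assumes "S \<in> tensor_algebra C" and "refl P" "trans P"
    and "\<And>a m. (a, m) \<notin> P \<Longrightarrow> \<nu> a m = 0"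
  shows "\<forall>a m. (a, m) \<notin> P \<longrightarrow> R S $ a $ m = 0"
  using assms(1)
proof (induction rule: tensor_algebra_induct)
  case (creation \<xi>)
  then show ?case by (auto simp: R_creation assms(4))
next
  case (phi_inf D)
  show ?case
  proof (intro allI impI)
    fix a m assume "(a, m) \<notin> P"
    then have "a \<noteq> m" using reflD[OF assms(2)] by blast
    with phi_inf show "R (phi_inf C D) $ a $ m = 0" by (simp add: R_phi_inf diag_algebra_def)
  qed
next
  case (add S T)
  then have "S \<in> adjointable_ops C" "T \<in> adjointable_ops C" using tensor_algebra_adjointable by blast+
  then have "R (S + T) $ a $ m = R S $ a $ m + R T $ a $ m" for a m
    by (simp only: R_add vector_add_component)
  with add.IH show ?case by (metis add_0)
next
  case (comp S T)
  show ?case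
  proof (intro allI impI)
    fix a m assume am: "(a, m) \<notin> P"
    have "R S $ a $ c * R T $ c $ m = 0" for c
      using am comp.IH transD[OF assms(3), of a c m] by auto
    then show "R (S \<circ> T) $ a $ m = 0"
      by (simp only: R_comp[OF comp.hyps] matrix_matrix_mult_def vec_lambda_beta sum.neutral_const)
  qed
next
  case (scale a S)
  then show ?case by (simp add: R_scale)
next
  case (limit S)
  show ?case
  proof (intro allI impI)
    fix a m assume am: "(a, m) \<notin> P"
    have "cmod (R S $ a $ m) \<le> 0 + \<epsilon>" if \<epsilon>: "\<epsilon> > 0" for \<epsilon>
    proof -
      obtain T where T: "T \<in> tensor_algebra C" "\<forall>a m. (a, m) \<notin> P \<longrightarrow> R T $ a $ m = 0"
        "op_norm C (S - T) < \<epsilon>" using limit.IH[OF \<epsilon>] by blast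
      then show ?thesis using R_diff_entry[OF limit.hyps T(1), of a m] am by simp
    qed
    then have "cmod (R S $ a $ m) \<le> 0" by (rule field_le_epsilon)
    then show "R S $ a $ m = 0" by simp
  qed
qed

end

section \<open>Representations over two points\<close>

text \<open>Distances between matrices are Euclidean while contractivity concerns the operator norm.
  Any fixed constant between the two serves the limit arguments.\<close>

lemma norm_matrix_le:
  fixes M :: "complex ^ 'm::finite ^ 'm"
  shows "norm M \<le> real CARD('m) * (real CARD('m) * mat_norm M)"
proof -
  have 1: "norm (M $ p) \<le> real CARD('m) * mat_norm M" for p
  proof -
    have "norm (M $ p) \<le> (\<Sum>q\<in>UNIV. cmod (M $ p $ q))"
      unfolding norm_vec_def by (rule L2_set_le_sum) simp
    also have "\<dots> \<le> (\<Sum>q\<in>(UNIV::'m set). mat_norm M)" by (intro sum_mono mat_entry_le)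
    finally show ?thesis by simp
  qed
  have "norm M \<le> (\<Sum>p\<in>UNIV. norm (M $ p))"
    unfolding norm_vec_def[of M] by (rule L2_set_le_sum) simp
  also have "\<dots> \<le> (\<Sum>p\<in>(UNIV::'m set). real CARD('m) * mat_norm M)" by (intro sum_mono 1)
  finally show ?thesis by simp
qed

text \<open>Agreement spreads from the generators through the operations, and a common Lipschitz
  bound carries it to limits. The target is a metric space in order to cover both characters and
  matrix representations.\<close>

lemma tensor_algebra_eqI:
  fixes f g :: "'n::finite fock_op \<Rightarrow> 'b::metric_space"
  assumes S: "S \<in> tensor_algebra C"
    and creation: "\<And>\<xi>. \<xi> \<in> E C \<Longrightarrow> f (creation C \<xi>) = g (creation C \<xi>)"
    and phi: "\<And>D. D \<in> diag_algebra \<Longrightarrow> f (phi_inf C D) = g (phi_inf C D)"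
    and add: "\<And>S T. S \<in> tensor_algebra C \<Longrightarrow> T \<in> tensor_algebra C \<Longrightarrow> f S = g S \<Longrightarrow> f T = g T \<Longrightarrow>
      f (S + T) = g (S + T)"
    and comp: "\<And>S T. S \<in> tensor_algebra C \<Longrightarrow> T \<in> tensor_algebra C \<Longrightarrow> f S = g S \<Longrightarrow> f T = g T \<Longrightarrow>
      f (S \<circ> T) = g (S \<circ> T)"
    and scale: "\<And>a S. S \<in> tensor_algebra C \<Longrightarrow> f S = g S \<Longrightarrow> f (op_scale a S) = g (op_scale a S)"
    and f: "\<And>S T. S \<in> tensor_algebra C \<Longrightarrow> T \<in> tensor_algebra C \<Longrightarrow> dist (f S) (f T) \<le> K * op_norm C (S - T)"
    and g: "\<And>S T. S \<in> tensor_algebra C \<Longrightarrow> T \<in> tensor_algebra C \<Longrightarrow> dist (g S) (g T) \<le> K * op_norm C (S - T)"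
  shows "f S = g S"
  using S
proof (induction rule: tensor_algebra_induct)
  case (limit S)
  have "dist (f S) (g S) \<le> 0 + \<delta>" if "\<delta> > 0" for \<delta>
  proof -
    have pos: "\<bar>K\<bar> + 1 > 0" by simp
    \<comment> \<open>The error enters once for \<open>f\<close> and once for \<open>g\<close>,
      hence the factor 2; adding 1 keeps the denominator positive for every
      \<open>K\<close>.\<close>
    then have "\<delta> / (2 * (\<bar>K\<bar> + 1)) > 0" using that by simp
    then obtain T where T: "T \<in> tensor_algebra C" "f T = g T" "op_norm C (S - T) < \<delta> / (2 * (\<bar>K\<bar> + 1))"
      using limit.IH by blast
    have n: "0 \<le> op_norm C (S - T)"
      using op_norm_nonneg tensor_algebra_diff(1)[OF limit.hyps T(1)] tensor_algebra_adjointable by blast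
    have "dist (f S) (g S) \<le> dist (f S) (f T) + dist (g S) (g T)"
      using dist_triangle[of "f S" "g S" "f T"] T(2) by (simp add: dist_commute)
    moreover have "K * op_norm C (S - T) \<le> (\<bar>K\<bar> + 1) * (\<delta> / (2 * (\<bar>K\<bar> + 1)))"
      using T(3) n by (intro mult_mono) auto
    moreover have "2 * ((\<bar>K\<bar> + 1) * (\<delta> / (2 * (\<bar>K\<bar> + 1)))) = \<delta>"
      using pos by (simp add: field_simps)
    ultimately show ?thesis
      using f[OF limit.hyps T(1)] g[OF limit.hyps T(1)] by linarith
  qed
  then have "dist (f S) (g S) \<le> 0" by (rule field_le_epsilon)
  then show ?case by simp
next
  case (creation \<xi>)
  then show ?case by (rule assms(2))
next
  case (phi_inf D)
  then show ?case by (rule assms(3))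
next
  case (add S T)
  then show ?case by (rule assms(4))
next
  case (comp S T)
  then show ?case by (rule assms(5))
next
  case (scale a S)
  then show ?case by (rule assms(6))
qed

section \<open>Uniqueness of characters and representations\<close>

lemma character_diff:
  assumes "is_character C f" "S \<in> tensor_algebra C" "T \<in> tensor_algebra C"
  shows "dist (f S) (f T) \<le> 1 * op_norm C (S - T)"
proof -
  have T: "op_scale (-1) T \<in> tensor_algebra C"
    by (rule closed_subalgebraD(5)[OF tensor_algebra_closed assms(3)])
  have "f (S - T) = f S + f (op_scale (-1) T)"
    using assms T unfolding tensor_algebra_diff(2)[OF assms(2,3)] is_character_def by blast
  also have "f (op_scale (-1) T) = -1 * f T"
    using assms unfolding is_character_def by blast
  also have "f S + -1 * f T = f S - f T" by simp
  finally have "f S - f T = f (S - T)" ..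
  moreover have "cmod (f (S - T)) \<le> op_norm C (S - T)"
    using assms tensor_algebra_diff(1) unfolding is_character_def by blast
  ultimately show ?thesis by (simp add: dist_norm)
qed

lemma character_eqI:
  assumes f: "is_character C f" and g: "is_character C g"
    and "\<And>\<xi>. \<xi> \<in> E C \<Longrightarrow> f (creation C \<xi>) = g (creation C \<xi>)"
    and "\<And>D. D \<in> diag_algebra \<Longrightarrow> f (phi_inf C D) = g (phi_inf C D)"
  shows "f = g"
proof (rule extensionalityI)
  show "f \<in> extensional (tensor_algebra C)" "g \<in> extensional (tensor_algebra C)"
    using f g by (auto simp: is_character_def)
  fix S assume "S \<in> tensor_algebra C"
  then show "f S = g S"
  proof (rule tensor_algebra_eqI[where K = 1])
    fix S T assume *: "S \<in> tensor_algebra C" "T \<in> tensor_algebra C"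
    show "dist (f S) (f T) \<le> 1 * op_norm C (S - T)" "dist (g S) (g T) \<le> 1 * op_norm C (S - T)"
      using character_diff[OF f *] character_diff[OF g *] .
    show "f S = g S \<Longrightarrow> f T = g T \<Longrightarrow> f (S + T) = g (S + T)"
      "f S = g S \<Longrightarrow> f T = g T \<Longrightarrow> f (S \<circ> T) = g (S \<circ> T)"
      using f g * unfolding is_character_def by metis+
  next
    fix a S assume "S \<in> tensor_algebra C" "f S = g S"
    then show "f (op_scale a S) = g (op_scale a S)"
      using f g unfolding is_character_def by metis
  qed (use assms in auto)
qed

text \<open>This resolves the definite description: \<open>f\<close> is a witness, and
  \<open>character_eqI\<close> makes it the only one.\<close>

lemma char_at_eqI:
  assumes "is_character C f"
    and "\<And>D. D \<in> diag_algebra \<Longrightarrow> f (phi_inf C D) = delta i D"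
    and "\<And>\<xi>. \<xi> \<in> E C \<Longrightarrow> f (creation C \<xi>) = ip l (\<xi> i i)"
  shows "char_at C i l = f"
  unfolding char_at_def
proof (rule the_equality)
  fix g assume g: "is_character C g \<and> (\<forall>D\<in>diag_algebra. g (phi_inf C D) = delta i D) \<and>
    (\<forall>\<xi>\<in>E C. g (creation C \<xi>) = ip l (\<xi> i i))"
  show "g = f" by (rule character_eqI[of C]) (use assms g in auto)
qed (use assms in auto)

lemma contractive_rep_diff:
  fixes \<rho> :: "'n::finite fock_op \<Rightarrow> complex ^ 'm::finite ^ 'm"
  assumes "contractive_rep C \<rho>" "S \<in> tensor_algebra C" "T \<in> tensor_algebra C"
  shows "dist (\<rho> S) (\<rho> T) \<le> real CARD('m) * real CARD('m) * op_norm C (S - T)"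
proof -
  have T: "op_scale (-1) T \<in> tensor_algebra C"
    by (rule closed_subalgebraD(5)[OF tensor_algebra_closed assms(3)])
  have "\<rho> (S - T) = \<rho> S + \<rho> (op_scale (-1) T)"
    using assms T unfolding tensor_algebra_diff(2)[OF assms(2,3)] contractive_rep_def by blast
  also have "\<rho> (op_scale (-1) T) = (\<chi> p q. -1 * \<rho> T $ p $ q)"
    using assms unfolding contractive_rep_def by blast
  also have "\<rho> S + (\<chi> p q. -1 * \<rho> T $ p $ q) = \<rho> S - \<rho> T" by (simp add: vec_eq_iff)
  finally have "\<rho> S - \<rho> T = \<rho> (S - T)" ..
  moreover have "mat_norm (\<rho> (S - T)) \<le> op_norm C (S - T)"
    using assms tensor_algebra_diff(1) unfolding contractive_rep_def by blast
  ultimately show ?thesis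
    using norm_matrix_le[of "\<rho> (S - T)"]
    by (simp add: dist_norm mult.assoc) (meson mult_left_mono of_nat_0_le_iff order_trans)
qed

lemma contractive_rep_eqI:
  fixes \<rho> \<sigma> :: "'n::finite fock_op \<Rightarrow> complex ^ 'm::finite ^ 'm"
  assumes f: "contractive_rep C \<rho>" and g: "contractive_rep C \<sigma>"
    and "\<And>\<xi>. \<xi> \<in> E C \<Longrightarrow> \<rho> (creation C \<xi>) = \<sigma> (creation C \<xi>)"
    and "\<And>D. D \<in> diag_algebra \<Longrightarrow> \<rho> (phi_inf C D) = \<sigma> (phi_inf C D)"
  shows "\<rho> = \<sigma>"
proof (rule extensionalityI)
  show "\<rho> \<in> extensional (tensor_algebra C)" "\<sigma> \<in> extensional (tensor_algebra C)"
    using f g by (auto simp: contractive_rep_def)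
  fix S assume "S \<in> tensor_algebra C"
  then show "\<rho> S = \<sigma> S"
  proof (rule tensor_algebra_eqI[where K = "real CARD('m) * real CARD('m)"])
    fix S T assume *: "S \<in> tensor_algebra C" "T \<in> tensor_algebra C"
    show "dist (\<rho> S) (\<rho> T) \<le> real CARD('m) * real CARD('m) * op_norm C (S - T)"
      "dist (\<sigma> S) (\<sigma> T) \<le> real CARD('m) * real CARD('m) * op_norm C (S - T)"
      using contractive_rep_diff[OF f *] contractive_rep_diff[OF g *] .
    show "\<rho> S = \<sigma> S \<Longrightarrow> \<rho> T = \<sigma> T \<Longrightarrow> \<rho> (S + T) = \<sigma> (S + T)"
      "\<rho> S = \<sigma> S \<Longrightarrow> \<rho> T = \<sigma> T \<Longrightarrow> \<rho> (S \<circ> T) = \<sigma> (S \<circ> T)"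
      using f g * unfolding contractive_rep_def by metis+
  next
    fix a S assume "S \<in> tensor_algebra C" "\<rho> S = \<sigma> S"
    then show "\<rho> (op_scale a S) = \<sigma> (op_scale a S)"
      using f g unfolding contractive_rep_def by metis
  qed (use assms in auto)
qed

lemma continuous_map_complex_mult:
  fixes f g :: "'b \<Rightarrow> complex"
  shows "continuous_map X euclidean f \<Longrightarrow> continuous_map X euclidean g \<Longrightarrow>
    continuous_map X euclidean (\<lambda>x. f x * g x)"
  by (simp add: continuous_map_atin tendsto_mult)

section \<open>The representation attached to a point of the ball\<close>

locale two_points =
  fixes C :: "enat ^ 'n::finite ^ 'n" and i j :: 'n and li lj :: "nat \<Rightarrow> complex"
  assumes ij: "i \<noteq> j"
    and li: "li \<in> open_unit_ball (C $ i $ i)" and lj: "lj \<in> open_unit_ball (C $ j $ j)"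
begin

text \<open>The row contraction behind \<open>rep \<mu>\<close>. It is indexed by all of
  \<open>'n\<close> because the Poisson kernel works on the whole index type; the other indices are
  cut away in \<open>rep\<close>.\<close>

definition coef :: "(nat \<Rightarrow> complex) \<Rightarrow> 'n \<Rightarrow> 'n \<Rightarrow> nat \<Rightarrow> complex" where
  "coef \<mu> = (\<lambda>a b. if a = i \<and> b = i then li else if a = i \<and> b = j then \<mu>
    else if a = j \<and> b = j then lj else 0)"

text \<open>Row \<open>i\<close> of \<open>coef \<mu>\<close> holds both \<open>li\<close> and
  \<mu>, so \<mu> may use what \<open>li\<close> leaves of the total mass 1; \<open>lj\<close> is
  charged to row \<open>j\<close>.\<close>

definition radius :: real where
  "radius = sqrt (1 - (ell2_norm li)\<^sup>2)"

definition mu_ball :: "(nat \<Rightarrow> complex) set" where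
  "mu_ball = closed_ball (C $ i $ j) 0 radius"

definition s :: "2 \<Rightarrow> 'n" where
  "s p = (if p = 1 then i else j)"

definition rep :: "(nat \<Rightarrow> complex) \<Rightarrow> 'n fock_op \<Rightarrow> complex ^ 2 ^ 2" where
  "rep \<mu> = (\<lambda>S\<in>tensor_algebra C. \<chi> p q. pure_row_contraction.R (coef \<mu>) S $ s p $ s q)"

lemma li_norm: "li \<in> ell2 (coords (C $ i $ i))" "ell2_norm li < 1" "(ell2_norm li)\<^sup>2 < 1"
  using li by (auto simp: open_unit_ball_def Cspace_def power_less_one_iff)

lemma lj_norm: "lj \<in> ell2 (coords (C $ j $ j))" "ell2_norm lj < 1" "(ell2_norm lj)\<^sup>2 < 1"
  using lj by (auto simp: open_unit_ball_def Cspace_def power_less_one_iff)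

lemma radius_pos: "radius > 0"
  using li_norm by (simp add: radius_def)

lemma mu_ball_iff: "\<mu> \<in> mu_ball \<longleftrightarrow> \<mu> \<in> ell2 (coords (C $ i $ j)) \<and> (ell2_norm li)\<^sup>2 + (ell2_norm \<mu>)\<^sup>2 \<le> 1"
proof -
  have "ell2_norm \<mu> \<le> radius \<longleftrightarrow> (ell2_norm \<mu>)\<^sup>2 \<le> 1 - (ell2_norm li)\<^sup>2"
    unfolding radius_def by (metis ell2_norm_nonneg real_le_rsqrt real_sqrt_le_iff real_sqrt_abs abs_of_nonneg)
  then show ?thesis by (auto simp: mu_ball_def closed_ball_def Cspace_def)
qed

lemma zero_in_mu_ball: "0 \<in> mu_ball"
  using li_norm by (simp add: mu_ball_iff)

lemma coef_E: "\<mu> \<in> mu_ball \<Longrightarrow> coef \<mu> \<in> E C"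
  using li_norm lj_norm by (auto simp: E_def mat_module_def coef_def mu_ball_iff)

lemma path_mass_coef:
  "path_mass (coef \<mu>) (Suc k) a =
    (if a = i then (ell2_norm li)\<^sup>2 * path_mass (coef \<mu>) k i + (ell2_norm \<mu>)\<^sup>2 * path_mass (coef \<mu>) k j
     else if a = j then (ell2_norm lj)\<^sup>2 * path_mass (coef \<mu>) k j else 0)"
proof -
  have "path_mass (coef \<mu>) (Suc k) a =
      (\<Sum>m\<in>{i, j}. (ell2_norm (coef \<mu> a m))\<^sup>2 * path_mass (coef \<mu>) k m)"
    unfolding path_mass.simps by (rule sum.mono_neutral_right) (auto simp: coef_def)
  then show ?thesis using ij by (auto simp: coef_def)
qed

text \<open>The mass of the paths from \<open>j\<close> decays like the powers of the squared norm of \<open>lj\<close>, and that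
  of the paths from \<open>i\<close> like the powers of any larger number that also exceeds the squared norm of
  \<open>li\<close>. This is where both points have to be interior.\<close>

lemma pure_coef:
  assumes "\<mu> \<in> mu_ball"
  shows "pure_row_contraction C (coef \<mu>)"
proof
  show "coef \<mu> \<in> E C" by (rule coef_E[OF assms])
  show "path_mass (coef \<mu>) 1 a \<le> 1" for a
    using path_mass_coef[of \<mu> 0 a] assms lj_norm(3) by (auto simp: mu_ball_iff)
  define p q r where "p = (ell2_norm li)\<^sup>2" and "q = (ell2_norm \<mu>)\<^sup>2" and "r = (ell2_norm lj)\<^sup>2"
  have pqr: "0 \<le> p" "p < 1" "0 \<le> q" "p + q \<le> 1" "0 \<le> r" "r < 1"
    using assms li_norm(3) lj_norm(3) by (auto simp: p_def q_def r_def mu_ball_iff)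
  \<comment> \<open>A rate strictly between the larger of \<open>p\<close>, \<open>r\<close> and 1:
    it dominates the loops at both points, and \<open>t - p\<close> stays positive.\<close>
  define t where "t = (max p r + 1) / 2"
  have t: "t < 1" "p < t" "r \<le> t" "0 \<le> t" using pqr by (auto simp: t_def max_def)
  \<comment> \<open>Chosen so that \<open>p * A + 1 = t * A\<close>, which makes the bound
    \<open>A * t ^ k\<close> reproduce itself under the recursion at \<open>i\<close>.\<close>
  define A where "A = 1 / (t - p)"
  have A: "A * (t - p) = 1" "1 \<le> A" using t pqr by (auto simp: A_def field_simps)
  have mj: "path_mass (coef \<mu>) k j = r ^ k" for k
    using ij path_mass_coef[of \<mu> _ j] by (induction k) (simp_all add: r_def del: path_mass.simps(2))
  have mi: "0 \<le> path_mass (coef \<mu>) k i \<and> path_mass (coef \<mu>) k i \<le> A * t ^ k" for k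
  proof (induction k)
    case (Suc k)
    have "path_mass (coef \<mu>) (Suc k) i = p * path_mass (coef \<mu>) k i + q * r ^ k"
      unfolding path_mass_coef mj by (simp add: p_def q_def)
    moreover have "p * path_mass (coef \<mu>) k i \<le> p * (A * t ^ k)"
      using Suc pqr by (intro mult_left_mono) auto
    moreover have "q * r ^ k \<le> 1 * t ^ k"
      using pqr t by (intro mult_mono power_mono) auto
    moreover have "p * (A * t ^ k) + 1 * t ^ k = A * t ^ Suc k"
    proof -
      have "p * (A * t ^ k) + 1 * t ^ k = (A * p + A * (t - p)) * t ^ k"
        unfolding A(1) by (simp add: algebra_simps)
      then show ?thesis by (simp add: algebra_simps)
    qed
    ultimately show ?case using Suc pqr by auto
  qed (use A in auto)
  show "(\<lambda>k. path_mass (coef \<mu>) k a) \<longlonglongrightarrow> 0" for a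
  proof (cases "a = i")
    case True
    have "(\<lambda>k. A * t ^ k) \<longlonglongrightarrow> 0"
      using tendsto_mult[OF tendsto_const LIMSEQ_power_zero[of t], of A] t by simp
    then have "(\<lambda>k. path_mass (coef \<mu>) k i) \<longlonglongrightarrow> 0"
      by (rule tendsto_sandwich[where f = "\<lambda>_. 0", rotated -1]) (use mi in simp_all)
    then show ?thesis by (simp add: True)
  next
    case False
    show ?thesis
    proof (cases "a = j")
      case True
      then show ?thesis using mj pqr by (simp add: LIMSEQ_power_zero)
    next
      case False
      \<comment> \<open>This row of \<open>coef \<mu>\<close> is zero, so its mass vanishes from
        length 1 on; at length 0 it is 1 by definition, whence the shift.\<close>
      have "(\<lambda>k. path_mass (coef \<mu>) (Suc k) a) \<longlonglongrightarrow> 0"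
        unfolding path_mass_coef using False \<open>a \<noteq> i\<close> by simp
      then show ?thesis by (rule LIMSEQ_imp_Suc)
    qed
  qed
qed

lemma s_simps: "s 1 = i" "s 2 = j"
  by (simp_all add: s_def)

lemma range_s: "range s = {i, j}"
  by (auto simp: UNIV_2 s_simps)

lemma sum_over_s: "(\<Sum>p\<in>UNIV. f (s p)) = f i + f j"
  by (simp add: sum_2 s_simps)

context
  fixes \<mu> assumes \<mu>: "\<mu> \<in> mu_ball"
begin

interpretation pure_row_contraction C "coef \<mu>"
  by (rule pure_coef[OF \<mu>])

text \<open>\<open>R_support\<close> is applied to the preorder whose only pair off the diagonal is
  \<open>(i, j)\<close>. As a consequence the indices \<open>i\<close> and \<open>j\<close> carry a
  direct summand of \<open>R S\<close>.\<close>

lemma R_zero: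
  assumes "S \<in> tensor_algebra C"
    and "a \<noteq> m" "(a, m) \<noteq> (i, j)"
  shows "R S $ a $ m = 0"
proof -
  let ?P = "{(a, m). a = m \<or> a = i \<and> m = j}"
  have "refl ?P" "trans ?P" using ij by (auto simp: refl_on_def trans_def)
  moreover have "coef \<mu> a m = 0" if "(a, m) \<notin> ?P" for a m
    using that by (auto simp: coef_def)
  ultimately have "\<forall>a m. (a, m) \<notin> ?P \<longrightarrow> R S $ a $ m = 0" by (rule R_support[OF assms(1)])
  then show ?thesis using assms(2,3) by simp
qed

lemma rep_entry: "S \<in> tensor_algebra C \<Longrightarrow> rep \<mu> S $ p $ q = R S $ s p $ s q"
  by (simp add: rep_def)

lemma rep_add:
  assumes "S \<in> tensor_algebra C" "T \<in> tensor_algebra C"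
  shows "rep \<mu> (S + T) = rep \<mu> S + rep \<mu> T"
proof -
  have a: "S \<in> adjointable_ops C" "T \<in> adjointable_ops C" "S + T \<in> tensor_algebra C"
    using assms closed_subalgebraD(3)[OF tensor_algebra_closed assms] tensor_algebra_adjointable by blast+
  show ?thesis
    by (simp only: vec_eq_iff vector_add_component rep_entry[OF a(3)] rep_entry[OF assms(1)]
        rep_entry[OF assms(2)] R_add[OF a(1,2)]) simp
qed

lemma rep_scale:
  assumes "S \<in> tensor_algebra C"
  shows "rep \<mu> (op_scale c S) = (\<chi> p q. c * rep \<mu> S $ p $ q)"
  using closed_subalgebraD(5)[OF tensor_algebra_closed assms] assms
  by (simp add: vec_eq_iff rep_entry R_scale)

text \<open>Passing to a corner is not multiplicative in general. Here rows \<open>i\<close> and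
  \<open>j\<close> of \<open>R S\<close> vanish outside columns \<open>i\<close> and
  \<open>j\<close>, so the summands missing from the 2x2 product are zero.\<close>

lemma rep_comp:
  assumes "S \<in> tensor_algebra C" "T \<in> tensor_algebra C"
  shows "rep \<mu> (S \<circ> T) = rep \<mu> S ** rep \<mu> T"
proof -
  have "(\<Sum>c\<in>UNIV. R S $ s p $ c * R T $ c $ s q) =
      (\<Sum>r\<in>UNIV. R S $ s p $ s r * R T $ s r $ s q)" for p q
  proof -
    have "s p \<in> {i, j}" using range_s by blast
    then have "(\<Sum>c\<in>UNIV. R S $ s p $ c * R T $ c $ s q) = (\<Sum>c\<in>{i, j}. R S $ s p $ c * R T $ c $ s q)"
      by (intro sum.mono_neutral_right) (auto simp: R_zero[OF assms(1)])
    then show ?thesis using ij by (simp add: sum_over_s[of "\<lambda>c. R S $ s p $ c * R T $ c $ s q"])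
  qed
  then show ?thesis
    using closed_subalgebraD(4)[OF tensor_algebra_closed assms]
    by (simp add: vec_eq_iff rep_entry assms R_comp matrix_matrix_mult_def)
qed

text \<open>A corner has no larger operator norm: extend \<open>v\<close> by zeros to
  \<open>w\<close>, apply \<open>R S\<close> and drop coordinates.\<close>

lemma rep_norm:
  assumes "S \<in> tensor_algebra C"
  shows "mat_norm (rep \<mu> S) \<le> op_norm C S"
proof (rule mat_norm_le)
  have a: "S \<in> adjointable_ops C" using assms tensor_algebra_adjointable by blast
  fix v :: "complex ^ 2"
  define w :: "complex ^ 'n" where "w = (\<chi> a. if a = i then v $ 1 else if a = j then v $ 2 else 0)"
  have n2: "(norm u)\<^sup>2 = (cmod (u $ 1))\<^sup>2 + (cmod (u $ 2))\<^sup>2" for u :: "complex ^ 2"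
    by (simp add: norm_vec_def L2_set_def sum_2)
  have nn: "(norm u)\<^sup>2 = (\<Sum>a\<in>UNIV. (cmod (u $ a))\<^sup>2)" for u :: "complex ^ 'n"
    by (simp add: norm_vec_def L2_set_def sum_nonneg)
  have "(norm w)\<^sup>2 = (\<Sum>a\<in>{i, j}. (cmod (w $ a))\<^sup>2)"
    unfolding nn by (rule sum.mono_neutral_right) (auto simp: w_def)
  then have "(norm w)\<^sup>2 = (norm v)\<^sup>2" using ij by (simp add: n2 w_def)
  then have w: "norm w = norm v" by simp
  have e: "(rep \<mu> S *v v) $ p = (R S *v w) $ s p" for p
  proof -
    have "(\<Sum>c\<in>UNIV. R S $ s p $ c * w $ c) = (\<Sum>c\<in>{i, j}. R S $ s p $ c * w $ c)"
      by (rule sum.mono_neutral_right) (auto simp: w_def)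
    then show ?thesis
      using ij by (simp add: matrix_vector_mult_def sum_2 rep_entry[OF assms] s_simps w_def)
  qed
  have "(norm (rep \<mu> S *v v))\<^sup>2 = (\<Sum>a\<in>{i, j}. (cmod ((R S *v w) $ a))\<^sup>2)"
    using ij by (simp add: n2 e s_simps)
  also have "\<dots> \<le> (norm (R S *v w))\<^sup>2"
    unfolding nn by (rule sum_mono2) auto
  finally have "norm (rep \<mu> S *v v) \<le> norm (R S *v w)" by simp
  also have "\<dots> \<le> op_norm C S * norm v" using R_norm[OF a, of w] by (simp add: w)
  finally show "norm (rep \<mu> S *v v) \<le> op_norm C S * norm v" .
qed

lemma rep_creation:
  assumes "\<xi> \<in> E C"
  shows "rep \<mu> (creation C \<xi>) $ 1 $ 1 = ip li (\<xi> i i)"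
    and "rep \<mu> (creation C \<xi>) $ 1 $ 2 = ip \<mu> (\<xi> i j)"
    and "rep \<mu> (creation C \<xi>) $ 2 $ 1 = 0"
    and "rep \<mu> (creation C \<xi>) $ 2 $ 2 = ip lj (\<xi> j j)"
proof -
  have "rep \<mu> (creation C \<xi>) $ p $ q = ip (coef \<mu> (s p) (s q)) (\<xi> (s p) (s q))" for p q
    by (simp add: rep_entry creation_tensor_algebra[OF assms] R_creation[OF assms])
  then show "rep \<mu> (creation C \<xi>) $ 1 $ 1 = ip li (\<xi> i i)"
    "rep \<mu> (creation C \<xi>) $ 1 $ 2 = ip \<mu> (\<xi> i j)"
    "rep \<mu> (creation C \<xi>) $ 2 $ 1 = 0"
    "rep \<mu> (creation C \<xi>) $ 2 $ 2 = ip lj (\<xi> j j)"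
    using ij by (simp_all add: s_simps coef_def)
qed

lemma rep_phi_inf:
  assumes "D \<in> diag_algebra"
  shows "rep \<mu> (phi_inf C D) = diag2 (delta i D) (delta j D)"
proof -
  have "rep \<mu> (phi_inf C D) $ p $ q = diag2 (delta i D) (delta j D) $ p $ q" for p q
    using assms ij exhaust_2[of p] exhaust_2[of q]
    by (auto simp: rep_entry phi_inf_tensor_algebra R_phi_inf s_simps diag2_def delta_def diag_algebra_def)
  then show ?thesis by (simp add: vec_eq_iff)
qed

lemma rep_upper_triangular: "S \<in> tensor_algebra C \<Longrightarrow> rep \<mu> S $ 2 $ 1 = 0"
  using ij by (auto simp: rep_entry s_simps intro: R_zero)

lemma rep_contractive: "contractive_rep C (rep \<mu>)"
  unfolding contractive_rep_def
  by (intro conjI ballI allI rep_add rep_comp rep_scale rep_norm) (simp_all add: rep_def)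

text \<open>Diagonal entries of an upper triangular representation are multiplicative, which gives
  the existence of the two characters. The left sides are the same for every \<mu> in the ball, so a
  single choice of \<mu> later suffices to evaluate them.\<close>

lemma rep_character:
  shows "char_at C i li = (\<lambda>S\<in>tensor_algebra C. rep \<mu> S $ 1 $ 1)"
    and "char_at C j lj = (\<lambda>S\<in>tensor_algebra C. rep \<mu> S $ 2 $ 2)"
proof -
  have char: "is_character C (\<lambda>S\<in>tensor_algebra C. rep \<mu> S $ p $ p)" for p
    unfolding is_character_def
  proof (intro conjI ballI allI)
    fix S T assume ST: "S \<in> tensor_algebra C" "T \<in> tensor_algebra C"
    let ?f = "\<lambda>S\<in>tensor_algebra C. rep \<mu> S $ p $ p"
    have m: "S + T \<in> tensor_algebra C" "S \<circ> T \<in> tensor_algebra C"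
      using closed_subalgebraD(3,4)[OF tensor_algebra_closed ST] by auto
    show "?f (S + T) = ?f S + ?f T"
      by (simp only: restrict_apply' ST m rep_add vector_add_component)
    show "?f (S \<circ> T) = ?f S * ?f T"
      using exhaust_2[of p] rep_upper_triangular[OF ST(1)] rep_upper_triangular[OF ST(2)]
      by (auto simp: ST m rep_comp matrix_matrix_mult_def sum_2)
  next
    fix a S assume S: "S \<in> tensor_algebra C"
    show "restrict (\<lambda>S. rep \<mu> S $ p $ p) (tensor_algebra C) (op_scale a S) =
        a * restrict (\<lambda>S. rep \<mu> S $ p $ p) (tensor_algebra C) S"
      using closed_subalgebraD(5)[OF tensor_algebra_closed S] S by (simp add: rep_scale)
  next
    fix S assume S: "S \<in> tensor_algebra C"
    show "cmod (restrict (\<lambda>S. rep \<mu> S $ p $ p) (tensor_algebra C) S) \<le> op_norm C S"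
      using mat_entry_le[of "rep \<mu> S" p p] rep_norm[OF S] S by simp
  qed auto
  show "char_at C i li = (\<lambda>S\<in>tensor_algebra C. rep \<mu> S $ 1 $ 1)"
    by (rule char_at_eqI[OF char])
       (simp_all add: phi_inf_tensor_algebra creation_tensor_algebra rep_phi_inf rep_creation diag2_def)
  show "char_at C j lj = (\<lambda>S\<in>tensor_algebra C. rep \<mu> S $ 2 $ 2)"
    by (rule char_at_eqI[OF char])
       (simp_all add: phi_inf_tensor_algebra creation_tensor_algebra rep_phi_inf rep_creation diag2_def)
qed

lemma rep_in_G: "rep \<mu> \<in> G C (li, lj) i j"
  unfolding G_def upper_triangular2_def
  using rep_contractive rep_phi_inf rep_upper_triangular rep_character by auto

end

section \<open>From a representation in \<open>G\<close> to a point of the ball\<close>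

definition corner :: "(nat \<Rightarrow> complex) \<Rightarrow> 'n \<Rightarrow> 'n \<Rightarrow> nat \<Rightarrow> complex" where
  "corner v = (\<lambda>a b. if a = i \<and> b = j then v else 0)"

lemma corner_E: "v \<in> ell2 (coords (C $ i $ j)) \<Longrightarrow> corner v \<in> E C"
  by (auto simp: corner_def E_def mat_module_def)

text \<open>Matrix units on both sides cut \<xi> down to one entry: the outer one keeps row
  \<open>i\<close>, and the inner one, moved across the tensor product, keeps column
  \<open>j\<close>.\<close>

lemma creation_corner:
  assumes "\<xi> \<in> E C"
  shows "phi_inf C (\<chi> p q. if p = i \<and> q = i then 1 else 0) \<circ> (creation C \<xi> \<circ>
      phi_inf C (\<chi> p q. if p = j \<and> q = j then 1 else 0)) = creation C (corner (\<xi> i j))"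
proof
  fix x
  let ?P = "\<lambda>a. (\<chi> p q. if p = a \<and> q = a then 1 else 0) :: complex ^ 'n ^ 'n"
  show "(phi_inf C (?P i) \<circ> (creation C \<xi> \<circ> phi_inf C (?P j))) x = creation C (corner (\<xi> i j)) x"
  proof (cases "x \<in> fock C")
    case True
    define y where "y = phi_inf C (?P j) x"
    have y: "y \<in> fock C" "creation C \<xi> y \<in> fock C"
      unfolding y_def using True adjointable_fock[OF phi_inf_adjointable]
        adjointable_fock[OF creation_adjointable[OF assms]] by blast+
    have "left_act (?P i) (tensor \<xi> (left_act (?P j) \<eta>)) = tensor (corner (\<xi> i j)) \<eta>" for \<eta>
      by (auto simp: left_act_def tensor_def corner_def fun_eq_iff split: list.splits)
    moreover have "left_act (?P i) 0 = (0 :: 'n \<Rightarrow> 'n \<Rightarrow> (nat \<times> 'n) list \<Rightarrow> complex)"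
      by (auto simp: left_act_def fun_eq_iff)
    ultimately have "phi_inf C (?P i) (creation C \<xi> y) k = creation C (corner (\<xi> i j)) x k" for k
      using True y by (cases k) (simp_all add: phi_inf_def creation_def y_def)
    then show ?thesis by (simp add: y_def fun_eq_iff)
  next
    case False
    then have "phi_inf C (?P j) x = 0" "creation C (corner (\<xi> i j)) x = 0"
      by (simp_all add: phi_inf_def creation_def)
    then show ?thesis
      by (simp only: o_apply adjointable_zero[OF phi_inf_adjointable]
          adjointable_zero[OF creation_adjointable[OF assms]])
  qed
qed

lemma G_creation:
  assumes \<rho>: "\<rho> \<in> G C (li, lj) i j" and \<xi>: "\<xi> \<in> E C"
  shows "\<rho> (creation C \<xi>) $ 1 $ 1 = ip li (\<xi> i i)"
    and "\<rho> (creation C \<xi>) $ 1 $ 2 = \<rho> (creation C (corner (\<xi> i j))) $ 1 $ 2"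
    and "\<rho> (creation C \<xi>) $ 2 $ 1 = 0"
    and "\<rho> (creation C \<xi>) $ 2 $ 2 = ip lj (\<xi> j j)"
proof -
  note T = creation_tensor_algebra[OF \<xi>]
  show "\<rho> (creation C \<xi>) $ 2 $ 1 = 0"
    using \<rho> T by (auto simp: G_def upper_triangular2_def)
  \<comment> \<open>The characters prescribed by \<open>G\<close> are evaluated through
    \<open>rep 0\<close>.\<close>
  show "\<rho> (creation C \<xi>) $ 1 $ 1 = ip li (\<xi> i i)" "\<rho> (creation C \<xi>) $ 2 $ 2 = ip lj (\<xi> j j)"
    using \<rho> T rep_character[OF zero_in_mu_ball] rep_creation[OF zero_in_mu_ball \<xi>] by (simp_all add: G_def)
  let ?P = "\<lambda>a. (\<chi> p q. if p = a \<and> q = a then 1 else 0) :: complex ^ 'n ^ 'n"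
  have D: "?P a \<in> diag_algebra" for a by (auto simp: diag_algebra_def)
  note PT = phi_inf_tensor_algebra[OF D]
  have mult: "\<rho> (S \<circ> S') = \<rho> S ** \<rho> S'" if "S \<in> tensor_algebra C" "S' \<in> tensor_algebra C" for S S'
    using \<rho> that by (simp add: G_def contractive_rep_def)
  have PD: "\<rho> (phi_inf C (?P a)) = diag2 (if a = i then 1 else 0) (if a = j then 1 else 0)" for a
    using \<rho> D[of a] by (simp add: G_def delta_def eq_commute)
  \<comment> \<open>The images of the two units are the diagonal matrix units of 2x2 matrices, so
    the compression leaves the (1,2) entry unchanged.\<close>
  have "\<rho> (creation C (corner (\<xi> i j))) =
      \<rho> (phi_inf C (?P i)) ** (\<rho> (creation C \<xi>) ** \<rho> (phi_inf C (?P j)))"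
    unfolding creation_corner[OF \<xi>, symmetric]
    by (simp only: mult[OF PT closed_subalgebraD(4)[OF tensor_algebra_closed T PT]] mult[OF T PT])
  then show "\<rho> (creation C \<xi>) $ 1 $ 2 = \<rho> (creation C (corner (\<xi> i j))) $ 1 $ 2"
    using ij by (simp add: PD diag2_def matrix_matrix_mult_def sum_2)
qed

text \<open>By \<open>G_creation\<close> the entry depends on the corner alone. A corner has a
  single nonzero column, so its creation operator is bounded by the norm of \<open>v\<close>, and
  the Riesz theorem applies with \<open>K = 1\<close>.\<close>

lemma G_functional:
  assumes \<rho>: "\<rho> \<in> G C (li, lj) i j"
  shows "\<exists>\<mu>\<in>ell2 (coords (C $ i $ j)). \<forall>\<xi>\<in>E C. \<rho> (creation C \<xi>) $ 1 $ 2 = ip \<mu> (\<xi> i j)"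
proof -
  let ?W = "coords (C $ i $ j)"
  let ?f = "\<lambda>v. \<rho> (creation C (corner v)) $ 1 $ 2"
  have rep: "contractive_rep C \<rho>" using \<rho> by (simp add: G_def)
  have "\<exists>\<mu>\<in>ell2 ?W. \<forall>v\<in>ell2 ?W. ?f v = ip \<mu> v"
  proof (rule ell2_Riesz[where K = 1])
    fix v assume v: "v \<in> ell2 ?W"
    note cv = creation_tensor_algebra[OF corner_E[OF v]]
    show "?f (v + w) = ?f v + ?f w" if "w \<in> ell2 ?W" for w
    proof -
      have "corner (v + w) = corner v + corner w" by (auto simp: corner_def fun_eq_iff)
      moreover have "\<rho> (creation C (corner v) + creation C (corner w)) =
          \<rho> (creation C (corner v)) + \<rho> (creation C (corner w))"
        using rep cv creation_tensor_algebra[OF corner_E[OF that]] unfolding contractive_rep_def by blast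
      ultimately show ?thesis by (simp only: creation_add vector_add_component)
    qed
    show "?f (\<lambda>w. a * v w) = a * ?f v" for a
    proof -
      have "corner (\<lambda>w. a * v w) = (\<lambda>b c w. a * corner v b c w)" by (auto simp: corner_def fun_eq_iff)
      moreover have "\<rho> (op_scale a (creation C (corner v))) = (\<chi> p q. a * \<rho> (creation C (corner v)) $ p $ q)"
        using rep cv unfolding contractive_rep_def by blast
      ultimately show ?thesis by (simp only: creation_scale vec_lambda_beta)
    qed
    have "cmod (?f v) \<le> mat_norm (\<rho> (creation C (corner v)))" by (rule mat_entry_le)
    also have "\<dots> \<le> op_norm C (creation C (corner v))"
      using rep cv unfolding contractive_rep_def by blast
    also have "\<dots> \<le> ell2_norm v"
    proof (rule creation_op_norm[OF corner_E[OF v] _ ell2_norm_nonneg])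
      fix m
      have "(\<Sum>a\<in>UNIV. (ell2_norm (corner v a m))\<^sup>2) = (\<Sum>a\<in>{i}. (ell2_norm (corner v a m))\<^sup>2)"
        by (rule sum.mono_neutral_right) (auto simp: corner_def)
      then show "(\<Sum>a\<in>UNIV. (ell2_norm (corner v a m))\<^sup>2) \<le> (ell2_norm v)\<^sup>2"
        by (simp add: corner_def)
    qed
    finally show "cmod (?f v) \<le> 1 * ell2_norm v" by simp
  qed
  then obtain \<mu> where "\<mu> \<in> ell2 ?W" "\<forall>v\<in>ell2 ?W. ?f v = ip \<mu> v" by blast
  then show ?thesis using G_creation(2)[OF \<rho>] E_ell2 by metis
qed

text \<open>Testing \<open>\<rho>\<close> on the creation operator whose \<open>(i,i)\<close> and \<open>(i,j)\<close> entries are the normalized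
  vectors \<open>li\<close> and \<open>\<mu>\<close>: distinct columns do not add up in the module norm, so this operator is a
  contraction.\<close>

lemma G_mu_ball:
  assumes \<rho>: "\<rho> \<in> G C (li, lj) i j" and \<mu>: "\<mu> \<in> ell2 (coords (C $ i $ j))"
    and eq: "\<forall>\<xi>\<in>E C. \<rho> (creation C \<xi>) $ 1 $ 2 = ip \<mu> (\<xi> i j)"
  shows "\<mu> \<in> mu_ball"
proof -
  define p q where "p = ell2_norm li" and "q = ell2_norm \<mu>"
  \<comment> \<open>If \<open>p\<close> or \<open>q\<close> is 0, the quotient is 0 by convention
    and so is the entry; the values of \<open>?M\<close> computed from it remain correct.\<close>
  define \<xi> where "\<xi> = (\<lambda>a b. if a = i \<and> b = i then (\<lambda>w. complex_of_real (1 / p) * li w)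
    else if a = i \<and> b = j then (\<lambda>w. complex_of_real (1 / q) * \<mu> w) else 0)"
  have \<xi>: "\<xi> \<in> E C"
    unfolding E_def mat_module_def \<xi>_def
    using ell2_scale[OF \<mu>, of "complex_of_real (1 / q)"] ell2_scale[OF li_norm(1), of "complex_of_real (1 / p)"]
    by auto
  have entries: "\<xi> i i = (\<lambda>w. complex_of_real (1 / p) * li w)" "\<xi> i j = (\<lambda>w. complex_of_real (1 / q) * \<mu> w)"
    using ij by (simp_all add: \<xi>_def)
  let ?M = "\<rho> (creation C \<xi>)"
  have M: "?M $ 1 $ 1 = complex_of_real p" "?M $ 1 $ 2 = complex_of_real q"
    unfolding G_creation(1)[OF \<rho> \<xi>] eq[rule_format, OF \<xi>] entries ip_scale_right
      ip_self[OF li_norm(1)] ip_self[OF \<mu>]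
    by (simp_all add: p_def q_def power2_eq_square)
  have "op_norm C (creation C \<xi>) \<le> 1"
  proof (rule creation_op_norm[OF \<xi>])
    fix m
    have "(\<Sum>a\<in>UNIV. (ell2_norm (\<xi> a m))\<^sup>2) = (\<Sum>a\<in>{i}. (ell2_norm (\<xi> a m))\<^sup>2)"
      by (rule sum.mono_neutral_right) (auto simp: \<xi>_def)
    moreover have "ell2_norm (\<xi> i m) \<le> 1"
    proof -
      have "ell2_norm (\<lambda>w. complex_of_real (1 / ell2_norm x) * x w) \<le> 1" for x :: "nat \<Rightarrow> complex"
        unfolding ell2_norm_scale norm_of_real by simp
      then show ?thesis unfolding \<xi>_def p_def q_def by (auto simp del: of_real_divide)
    qed
    then have "(\<Sum>a\<in>{i}. (ell2_norm (\<xi> a m))\<^sup>2) \<le> 1\<^sup>2" by (simp add: power_le_one)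
    ultimately show "(\<Sum>a\<in>UNIV. (ell2_norm (\<xi> a m))\<^sup>2) \<le> 1\<^sup>2" by simp
  qed simp
  then have nM: "mat_norm ?M \<le> 1"
    using \<rho> creation_tensor_algebra[OF \<xi>] unfolding G_def contractive_rep_def by fastforce
  define t where "t = p\<^sup>2 + q\<^sup>2"
  \<comment> \<open>The first row of \<open>?M\<close> is \<open>(p, q)\<close>, which attains its
    norm on this vector: the first coordinate of the image is \<open>t\<close>, the squared norm of
    \<open>v\<close>.\<close>
  define v :: "complex ^ 2" where "v = (\<chi> r. if r = 1 then complex_of_real p else complex_of_real q)"
  have v: "(norm v)\<^sup>2 = t" by (simp add: norm_vec_def L2_set_def sum_2 v_def t_def)
  have "(?M *v v) $ 1 = complex_of_real t"
    by (simp add: matrix_vector_mult_def sum_2 M v_def t_def power2_eq_square)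
  then have "\<bar>t\<bar> \<le> norm (?M *v v)"
    using Finite_Cartesian_Product.norm_nth_le[of "?M *v v" 1] by simp
  also have "\<dots> \<le> mat_norm ?M * norm v" by (rule mat_norm_bound)
  also have "\<dots> \<le> 1 * norm v" using nM by (intro mult_right_mono) auto
  finally have "(norm v)\<^sup>2 \<le> norm v" using v by simp
  then have "norm v \<le> 1"
    by (cases "norm v = 0") (simp_all add: power2_eq_square)
  then have "t \<le> 1" using v by (simp add: power_le_one flip: v)
  then show ?thesis using \<mu> by (simp add: mu_ball_iff t_def p_def q_def)
qed

lemma G_eq_rep:
  assumes \<rho>: "\<rho> \<in> G C (li, lj) i j" and \<mu>: "\<mu> \<in> mu_ball"
    and eq: "\<forall>\<xi>\<in>E C. \<rho> (creation C \<xi>) $ 1 $ 2 = ip \<mu> (\<xi> i j)"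
  shows "\<rho> = rep \<mu>"
proof (rule contractive_rep_eqI[OF _ rep_contractive[OF \<mu>]])
  show "contractive_rep C \<rho>" using \<rho> by (simp add: G_def)
  fix \<xi> assume \<xi>: "\<xi> \<in> E C"
  show "\<rho> (creation C \<xi>) = rep \<mu> (creation C \<xi>)"
    using G_creation[OF \<rho> \<xi>] rep_creation[OF \<mu> \<xi>] eq \<xi> by (simp add: vec_eq_iff forall_2)
next
  fix D :: "complex ^ 'n ^ 'n" assume "D \<in> diag_algebra"
  then show "\<rho> (phi_inf C D) = rep \<mu> (phi_inf C D)"
    using \<rho> rep_phi_inf[OF \<mu>] by (simp add: G_def)
qed

lemma mu_ball_eqI:
  assumes "\<mu> \<in> mu_ball" "\<nu> \<in> mu_ball"
    and "\<And>v. v \<in> ell2 (coords (C $ i $ j)) \<Longrightarrow> ip \<mu> v = ip \<nu> v"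
  shows "\<mu> = \<nu>"
proof -
  have m: "\<mu> \<in> ell2 (coords (C $ i $ j))" "\<nu> \<in> ell2 (coords (C $ i $ j))"
    using assms by (auto simp: mu_ball_iff)
  then have d: "\<mu> - \<nu> \<in> ell2 (coords (C $ i $ j))" by blast
  have "ip (\<mu> - \<nu>) \<mu> = ip (\<mu> - \<nu>) \<nu>" using assms(3)[OF d] by (metis ip_cnj)
  then have "ip (\<mu> - \<nu>) (\<mu> - \<nu>) = 0" using ip_diff_right[OF d m] by simp
  then have "ell2_norm (\<mu> - \<nu>) = 0" by (simp add: ip_self[OF d])
  then have "\<mu> - \<nu> = 0" using ell2_norm_eq_0[OF d] by blast
  then show ?thesis by (simp add: fun_eq_iff)
qed

section \<open>Comparison of the two topologies\<close>

definition weak_ball :: "(nat \<Rightarrow> complex) topology" where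
  "weak_ball = subtopology (weak_topology (C $ i $ j)) mu_ball"

lemma topspace_weak_ball: "topspace weak_ball = mu_ball"
  by (auto simp: weak_ball_def weak_topology_def topspace_pullback_topology mu_ball_def closed_ball_def)

text \<open>The functionals defining the weak topology have the moving vector in the second slot,
  whereas \<open>rep\<close> has \<mu> in the first; conjugation exchanges the two.\<close>

lemma weak_ball_ip:
  assumes "v \<in> ell2 (coords (C $ i $ j))"
  shows "continuous_map weak_ball euclidean (\<lambda>\<mu>. ip \<mu> v)"
proof -
  have "continuous_map (weak_topology (C $ i $ j)) euclidean
      ((\<lambda>h. h v) \<circ> (\<lambda>x. \<lambda>y\<in>Cspace (C $ i $ j). ip y x))"
    unfolding weak_topology_def
    by (intro continuous_map_pullback continuous_map_product_projection) (simp add: Cspace_def assms)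
  then have "continuous_map (weak_topology (C $ i $ j)) euclidean (\<lambda>x. ip v x)"
    using assms by (simp add: o_def Cspace_def)
  then have "continuous_map weak_ball euclidean (\<lambda>x. ip v x)"
    unfolding weak_ball_def by (rule continuous_map_from_subtopology)
  then have "continuous_map weak_ball euclidean (cnj \<circ> (\<lambda>x. ip v x))"
    by (rule continuous_map_compose) (simp add: continuous_intros)
  then show ?thesis by (simp add: o_def ip_cnj)
qed

text \<open>Continuity holds on generators and survives the algebra operations. It passes to limits
  because every \<open>rep \<mu>\<close> is contractive: an approximant \<open>T\<close> of
  \<open>S\<close> is equally good for all \<mu> in the ball.\<close>

lemma rep_continuous:
  assumes "S \<in> tensor_algebra C"
  shows "\<forall>p q. continuous_map weak_ball euclidean (\<lambda>\<mu>. rep \<mu> S $ p $ q)"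
  using assms
proof (induction rule: tensor_algebra_induct)
  case (creation \<xi>)
  have "continuous_map weak_ball euclidean (\<lambda>\<mu>. rep \<mu> (creation C \<xi>) $ p $ q)" for p q
  proof (rule continuous_map_eq[where f = "\<lambda>\<mu>. if p = 1 \<and> q = 1 then ip li (\<xi> i i)
      else if p = 1 \<and> q = 2 then ip \<mu> (\<xi> i j) else if p = 2 \<and> q = 1 then 0 else ip lj (\<xi> j j)"])
    show "continuous_map weak_ball euclidean (\<lambda>\<mu>. if p = 1 \<and> q = 1 then ip li (\<xi> i i)
        else if p = 1 \<and> q = 2 then ip \<mu> (\<xi> i j) else if p = 2 \<and> q = 1 then 0 else ip lj (\<xi> j j))"
      using weak_ball_ip[OF E_ell2[OF creation]] by (cases "p = 1"; cases "q = 1"; cases "q = 2") auto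
  qed (use rep_creation[OF _ creation] exhaust_2[of p] exhaust_2[of q] in \<open>auto simp: topspace_weak_ball\<close>)
  then show ?case by blast
next
  case (phi_inf D)
  have "continuous_map weak_ball euclidean (\<lambda>\<mu>. rep \<mu> (phi_inf C D) $ p $ q)" for p q
    by (rule continuous_map_eq[where f = "\<lambda>\<mu>. diag2 (delta i D) (delta j D) $ p $ q"])
       (auto simp: topspace_weak_ball rep_phi_inf[OF _ phi_inf])
  then show ?case by blast
next
  case (add S T)
  have "continuous_map weak_ball euclidean (\<lambda>\<mu>. rep \<mu> (S + T) $ p $ q)" for p q
  proof (rule continuous_map_eq[where f = "\<lambda>\<mu>. rep \<mu> S $ p $ q + rep \<mu> T $ p $ q"])
    show "continuous_map weak_ball euclidean (\<lambda>\<mu>. rep \<mu> S $ p $ q + rep \<mu> T $ p $ q)"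
      by (rule continuous_map_add[OF add.IH(1)[rule_format] add.IH(2)[rule_format]])
    show "rep \<mu> S $ p $ q + rep \<mu> T $ p $ q = rep \<mu> (S + T) $ p $ q" if "\<mu> \<in> topspace weak_ball" for \<mu>
      using that by (simp only: topspace_weak_ball rep_add[OF _ add.hyps] vector_add_component)
  qed
  then show ?case by blast
next
  case (comp S T)
  have "continuous_map weak_ball euclidean (\<lambda>\<mu>. rep \<mu> (S \<circ> T) $ p $ q)" for p q
  proof (rule continuous_map_eq[where f = "\<lambda>\<mu>. \<Sum>r\<in>UNIV. rep \<mu> S $ p $ r * rep \<mu> T $ r $ q"])
    show "continuous_map weak_ball euclidean (\<lambda>\<mu>. \<Sum>r\<in>UNIV. rep \<mu> S $ p $ r * rep \<mu> T $ r $ q)"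
      by (rule continuous_map_sum[OF finite_class.finite_UNIV
          continuous_map_complex_mult[OF comp.IH(1)[rule_format] comp.IH(2)[rule_format]]])
    show "(\<Sum>r\<in>UNIV. rep \<mu> S $ p $ r * rep \<mu> T $ r $ q) = rep \<mu> (S \<circ> T) $ p $ q"
      if "\<mu> \<in> topspace weak_ball" for \<mu>
      using that by (simp only: topspace_weak_ball rep_comp[OF _ comp.hyps] matrix_matrix_mult_def vec_lambda_beta)
  qed
  then show ?case by blast
next
  case (scale a S)
  have "continuous_map weak_ball euclidean (\<lambda>\<mu>. rep \<mu> (op_scale a S) $ p $ q)" for p q
  proof (rule continuous_map_eq[where f = "\<lambda>\<mu>. a * rep \<mu> S $ p $ q"])
    show "continuous_map weak_ball euclidean (\<lambda>\<mu>. a * rep \<mu> S $ p $ q)"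
      by (rule continuous_map_complex_mult[OF _ scale.IH[rule_format]]) simp
  qed (simp add: topspace_weak_ball rep_scale[OF _ scale.hyps])
  then show ?case by blast
next
  case (limit S)
  have "((\<lambda>\<mu>. rep \<mu> S $ p $ q) \<longlongrightarrow> rep \<nu> S $ p $ q) (atin weak_ball \<nu>)" if \<nu>: "\<nu> \<in> mu_ball" for p q \<nu>
  proof (rule tendstoI)
    fix \<epsilon> :: real assume "\<epsilon> > 0"
    \<comment> \<open>A third of \<epsilon> for each of three terms, and a factor 4 for passing from
      the operator norm to distances of 2x2 matrices.\<close>
    then have "\<epsilon> / 12 > 0" by simp
    then obtain T where T: "T \<in> tensor_algebra C"
      "\<forall>p q. continuous_map weak_ball euclidean (\<lambda>\<mu>. rep \<mu> T $ p $ q)" "op_norm C (S - T) < \<epsilon> / 12"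
      using limit.IH by blast
    have close: "dist (rep \<mu> S $ p $ q) (rep \<mu> T $ p $ q) < \<epsilon> / 3" if "\<mu> \<in> mu_ball" for \<mu>
    proof -
      have "dist (rep \<mu> S $ p $ q) (rep \<mu> T $ p $ q) \<le> dist (rep \<mu> S) (rep \<mu> T)"
        by (rule order_trans[OF dist_vec_nth_le dist_vec_nth_le])
      also have "\<dots> \<le> 4 * op_norm C (S - T)"
        using contractive_rep_diff[OF rep_contractive[OF that] limit.hyps T(1)] by simp
      also have "\<dots> < \<epsilon> / 3" using T(3) by simp
      finally show ?thesis .
    qed
    have "\<forall>\<^sub>F \<mu> in atin weak_ball \<nu>. \<mu> \<in> mu_ball"
      unfolding eventually_atin
      using openin_topspace[of weak_ball] by (intro disjI2 exI[of _ "topspace weak_ball"]) (use \<nu> in \<open>auto simp: topspace_weak_ball\<close>)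
    moreover have "((\<lambda>\<mu>. rep \<mu> T $ p $ q) \<longlongrightarrow> rep \<nu> T $ p $ q) (atin weak_ball \<nu>)"
      using T(2) \<nu> by (simp add: continuous_map_atin topspace_weak_ball)
    then have "\<forall>\<^sub>F \<mu> in atin weak_ball \<nu>. dist (rep \<mu> T $ p $ q) (rep \<nu> T $ p $ q) < \<epsilon> / 3"
      using \<open>\<epsilon> > 0\<close> by (intro tendstoD) auto
    ultimately show "\<forall>\<^sub>F \<mu> in atin weak_ball \<nu>. dist (rep \<mu> S $ p $ q) (rep \<nu> S $ p $ q) < \<epsilon>"
    proof eventually_elim
      case (elim \<mu>)
      have "dist (rep \<mu> S $ p $ q) (rep \<nu> S $ p $ q) \<le> dist (rep \<mu> S $ p $ q) (rep \<mu> T $ p $ q) +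
          dist (rep \<mu> T $ p $ q) (rep \<nu> T $ p $ q) + dist (rep \<nu> S $ p $ q) (rep \<nu> T $ p $ q)"
        by metric
      then show ?case using close[OF elim(1)] close[OF \<nu>] elim(2) by linarith
    qed
  qed
  then show ?case by (simp add: continuous_map_atin topspace_weak_ball)
qed

text \<open>Evaluation at \<open>creation C (corner v)\<close> has (1,2) entry
  \<open>ip (g \<rho>) v\<close>. The conjugates of these numbers are the functionals that define
  the weak topology, which makes \<open>g\<close> continuous; for \<open>rep\<close> the evaluations
  are covered by \<open>rep_continuous\<close>.\<close>

lemma homeomorphic_G:
  "subtopology (pointwise_topology C) (G C (li, lj) i j) homeomorphic_space weak_ball"
proof -
  let ?G = "G C (li, lj) i j"
  let ?X = "subtopology (pointwise_topology C) ?G"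
  have "\<forall>\<rho>\<in>?G. \<exists>\<mu>. \<mu> \<in> mu_ball \<and> (\<forall>\<xi>\<in>E C. \<rho> (creation C \<xi>) $ 1 $ 2 = ip \<mu> (\<xi> i j))"
    using G_functional G_mu_ball by meson
  then obtain g where g: "\<And>\<rho>. \<rho> \<in> ?G \<Longrightarrow> g \<rho> \<in> mu_ball"
    "\<And>\<rho> \<xi>. \<rho> \<in> ?G \<Longrightarrow> \<xi> \<in> E C \<Longrightarrow> \<rho> (creation C \<xi>) $ 1 $ 2 = ip (g \<rho>) (\<xi> i j)"
    by metis
  \<comment> \<open>Representations are extensional, so \<open>G\<close> lies inside the product
    space and no point is lost in the subtopology.\<close>
  have X: "topspace ?X = ?G"
    by (auto simp: pointwise_topology_def G_def contractive_rep_def PiE_def)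
  have corner: "corner v i j = v" for v by (simp add: corner_def)
  have "homeomorphic_maps weak_ball ?X rep g"
    unfolding homeomorphic_maps_def
  proof (intro conjI ballI)
    show "continuous_map weak_ball ?X rep"
      unfolding continuous_map_in_subtopology
    proof
      show "continuous_map weak_ball (pointwise_topology C) rep"
        unfolding pointwise_topology_def continuous_map_componentwise
      proof (intro conjI ballI)
        show "rep ` topspace weak_ball \<subseteq> extensional (tensor_algebra C)"
          by (auto simp: rep_def)
        fix S assume "S \<in> tensor_algebra C"
        from rep_continuous[OF this] show "continuous_map weak_ball euclidean (\<lambda>\<mu>. rep \<mu> S)"
          by (auto simp: continuous_map_atin intro!: vec_tendstoI)
      qed
      show "rep \<in> topspace weak_ball \<rightarrow> ?G"
        using rep_in_G by (auto simp: topspace_weak_ball)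
    qed
    show "continuous_map ?X weak_ball g"
      unfolding weak_ball_def continuous_map_in_subtopology
    proof
      show "g \<in> topspace ?X \<rightarrow> mu_ball" using g(1) X by blast
      show "continuous_map ?X (weak_topology (C $ i $ j)) g"
        unfolding weak_topology_def
      proof (rule continuous_map_pullback')
        show "topspace ?X \<subseteq> g -` Cspace (C $ i $ j)" using g(1) X by (auto simp: mu_ball_iff Cspace_def)
        show "continuous_map ?X (product_topology (\<lambda>_. euclidean) (Cspace (C $ i $ j)))
            ((\<lambda>x. \<lambda>y\<in>Cspace (C $ i $ j). ip y x) \<circ> g)"
          unfolding continuous_map_componentwise
        proof (intro conjI ballI)
          fix v assume v: "v \<in> Cspace (C $ i $ j)"
          have cv: "corner v \<in> E C" using v by (simp add: Cspace_def corner_E)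
          show "continuous_map ?X euclidean (\<lambda>\<rho>. ((\<lambda>x. \<lambda>y\<in>Cspace (C $ i $ j). ip y x) \<circ> g) \<rho> v)"
          proof (rule continuous_map_eq[where f = "\<lambda>\<rho>. cnj (\<rho> (creation C (corner v)) $ 1 $ 2)"])
            have "continuous_map ?X euclidean (\<lambda>\<rho>. \<rho> (creation C (corner v)))"
              unfolding pointwise_topology_def
              by (intro continuous_map_from_subtopology continuous_map_product_projection
                  creation_tensor_algebra[OF cv])
            then have "continuous_map ?X euclidean ((\<lambda>M. cnj (M $ 1 $ 2)) \<circ> (\<lambda>\<rho>. \<rho> (creation C (corner v))))"
              by (rule continuous_map_compose) (simp add: continuous_intros)
            then show "continuous_map ?X euclidean (\<lambda>\<rho>. cnj (\<rho> (creation C (corner v)) $ 1 $ 2))"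
              by (simp add: o_def)
            show "cnj (\<rho> (creation C (corner v)) $ 1 $ 2) =
                ((\<lambda>x. \<lambda>y\<in>Cspace (C $ i $ j). ip y x) \<circ> g) \<rho> v" if "\<rho> \<in> topspace ?X" for \<rho>
              using g(2)[OF _ cv] that X v by (simp add: corner ip_cnj)
          qed
        qed auto
      qed
    qed
    show "rep (g \<rho>) = \<rho>" if "\<rho> \<in> topspace ?X" for \<rho>
      using that G_eq_rep[of \<rho> "g \<rho>"] g X by simp
    show "g (rep \<mu>) = \<mu>" if "\<mu> \<in> topspace weak_ball" for \<mu>
    proof (rule mu_ball_eqI)
      have \<mu>: "\<mu> \<in> mu_ball" using that by (simp add: topspace_weak_ball)
      then show "\<mu> \<in> mu_ball" "g (rep \<mu>) \<in> mu_ball" using g(1) rep_in_G by auto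
      fix v assume v: "v \<in> ell2 (coords (C $ i $ j))"
      show "ip (g (rep \<mu>)) v = ip \<mu> v"
        using g(2)[OF rep_in_G[OF \<mu>] corner_E[OF v]] rep_creation(2)[OF \<mu> corner_E[OF v]]
        by (simp add: corner)
    qed
  qed
  then have "weak_ball homeomorphic_space ?X" unfolding homeomorphic_space_def by blast
  then show ?thesis by (rule homeomorphic_space_sym[THEN iffD1])
qed

end

theorem proposition3p6:
  fixes C :: "enat ^ 'n::finite ^ 'n" and i j :: 'n
    and l_i l_j :: "nat \<Rightarrow> complex"
  assumes "i \<noteq> j"
    and "(l_i, l_j) \<in> open_unit_ball (C $ i $ i) \<times> open_unit_ball (C $ j $ j)"
  shows "\<exists>z\<in>Cspace (C $ i $ j). \<exists>r>0.
    subtopology (pointwise_topology C) (G C (l_i, l_j) i j)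
      homeomorphic_space
    subtopology (weak_topology (C $ i $ j)) (closed_ball (C $ i $ j) z r)"
proof -
  interpret two_points C i j l_i l_j
    using assms by unfold_locales auto
  have "0 \<in> Cspace (C $ i $ j)" by (simp add: Cspace_def)
  with radius_pos homeomorphic_G show ?thesis unfolding weak_ball_def mu_ball_def by blast
qed

end
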